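(* Let $A$ be a commutative ring whose underlying abelian group is torsion-free, and suppose that $A$ is finitely generated as a commutative ring. Let $I$ be a maximal ideal of $A$, and let $A_I$ denote the localization of $A$ at $I$ (all elements outside $I$ inverted). Then, for each integer $m$, the grading degree $m$ summand $L^{A_I}_m$ of the classifying ring $L^{A_I}$ of formal $A_I$-modules is a finitely generated, $I$-adically separated $A_I$-module.
   Context: For a commutative ring $B$ and a commutative $B$-algebra $R$, a (one-dimensional) formal $B$-module over $R$ is a formal group law $F(X,Y)\in R[[X,Y]]$ together with a ring homomorphism $\rho: B\to \mathrm{End}(F)$ such that $\rho(b)(X)\equiv bX \bmod X^2$ for all $b\in B$; here $\mathrm{End}(F)\subseteq R[[X]]$ has addition $F(f(X),g(X))$ and multiplication given by composition. $L^B$ is the commutative $B$-algebra corepresenting the functor sending $R$ to the set of formal $B$-modules over $R$. It is graded, concentrated in even nonnegative degrees: if the universal formal $B$-module is $F(X,Y)=\sum_{i,j} \alpha_{i,j}X^iY^j$ and $\rho(b)(X)=\sum_{i\ge 1} \rho_{b,i} X^i$, then $\alpha_{i,j}$ has degree $2(i+j-1)$ and $\rho_{b,i}$ has degree $2(i-1)$. A module $M$ is $I$-adically separated if $\bigcap_n I^nM=0$. *)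

theory Defs
  imports "HOL-Library.Multiset" "HOL-Algebra.Ideal_Product" "HOL-Algebra.Generated_Rings"
    "HOL-Algebra.QuotRing" "HOL-Algebra.Module"
begin

section \<open>Multivariate power series and polynomials over a commutative ring\<close>

text \<open>A monomial in the variables \<open>'v\<close> is a multiset of variables; a power series is its
  coefficient function. Every monomial has only finitely many factorizations, so the Cauchy
  product makes sense for arbitrarily many variables.\<close>

definition mps :: "('r, 'x) ring_scheme \<Rightarrow> ('v multiset \<Rightarrow> 'r) ring" where
  "mps R = \<lparr>carrier = {f. \<forall>m. f m \<in> carrier R},
    mult = (\<lambda>f g m. \<Oplus>\<^bsub>R\<^esub>a\<in>{a. a \<subseteq># m}. f a \<otimes>\<^bsub>R\<^esub> g (m - a)),
    one = (\<lambda>m. if m = {#} then \<one>\<^bsub>R\<^esub> else \<zero>\<^bsub>R\<^esub>),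
    zero = (\<lambda>m. \<zero>\<^bsub>R\<^esub>),
    add = (\<lambda>f g m. f m \<oplus>\<^bsub>R\<^esub> g m)\<rparr>"

definition indet :: "('r, 'x) ring_scheme \<Rightarrow> 'v \<Rightarrow> 'v multiset \<Rightarrow> 'r" where
  "indet R v = (\<lambda>m. if m = {#v#} then \<one>\<^bsub>R\<^esub> else \<zero>\<^bsub>R\<^esub>)"

definition mconst :: "('r, 'x) ring_scheme \<Rightarrow> 'r \<Rightarrow> 'v multiset \<Rightarrow> 'r" where
  "mconst R c = (\<lambda>m. if m = {#} then c else \<zero>\<^bsub>R\<^esub>)"

definition mpoly :: "('r, 'x) ring_scheme \<Rightarrow> 'v set \<Rightarrow> ('v multiset \<Rightarrow> 'r) ring" where
  "mpoly R V = (mps R)\<lparr>carrier := {p. (\<forall>m. p m \<in> carrier R) \<and> finite {m. p m \<noteq> \<zero>\<^bsub>R\<^esub>}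
    \<and> (\<forall>m. p m \<noteq> \<zero>\<^bsub>R\<^esub> \<longrightarrow> set_mset m \<subseteq> V)}\<rparr>"


section \<open>Formal group laws and formal modules\<close>

text \<open>All identities between power series below live in \<open>R[[X,Y,Z]]\<close>.\<close>

datatype xyz = Xvar | Yvar | Zvar

text \<open>\<open>subst1 R f g\<close> is \<open>f(g)\<close> and \<open>subst2 R F f g\<close> is \<open>F(f,g)\<close>, for series \<open>f(T) = \<Sum> f i T^i\<close> and
  \<open>F(S,T) = \<Sum> F i j S^i T^j\<close>. They are only meaningful if the series substituted have zero
  constant term: then no power above the total degree of the monomial \<open>m\<close> contributes to its
  coefficient, so that the finite sums below are the full sums.\<close>

definition subst1 ::
  "('r, 'x) ring_scheme \<Rightarrow> (nat \<Rightarrow> 'r) \<Rightarrow> (xyz multiset \<Rightarrow> 'r) \<Rightarrow> (xyz multiset \<Rightarrow> 'r)" where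
  "subst1 R f g = (\<lambda>m. \<Oplus>\<^bsub>R\<^esub>i\<in>{..size m}. f i \<otimes>\<^bsub>R\<^esub> (g [^]\<^bsub>mps R\<^esub> i) m)"

definition subst2 :: "('r, 'x) ring_scheme \<Rightarrow> (nat \<Rightarrow> nat \<Rightarrow> 'r) \<Rightarrow> (xyz multiset \<Rightarrow> 'r)
    \<Rightarrow> (xyz multiset \<Rightarrow> 'r) \<Rightarrow> (xyz multiset \<Rightarrow> 'r)" where
  "subst2 R F f g = (\<lambda>m. \<Oplus>\<^bsub>R\<^esub>i\<in>{..size m}. \<Oplus>\<^bsub>R\<^esub>j\<in>{..size m}.
     F i j \<otimes>\<^bsub>R\<^esub> (f [^]\<^bsub>mps R\<^esub> i \<otimes>\<^bsub>mps R\<^esub> g [^]\<^bsub>mps R\<^esub> j) m)"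

text \<open>Formal group laws are commutative and one-dimensional; the existence of a formal inverse is
  automatic.\<close>

definition formal_group_law :: "('r, 'x) ring_scheme \<Rightarrow> (nat \<Rightarrow> nat \<Rightarrow> 'r) \<Rightarrow> bool" where
  "formal_group_law R F \<longleftrightarrow>
    (let X = indet R Xvar; Y = indet R Yvar; Z = indet R Zvar; N = \<zero>\<^bsub>mps R\<^esub> in
      (\<forall>i j. F i j \<in> carrier R) \<and>
      subst2 R F X N = X \<and> subst2 R F N X = X \<and>
      subst2 R F X Y = subst2 R F Y X \<and>
      subst2 R F (subst2 R F X Y) Z = subst2 R F X (subst2 R F Y Z))"

text \<open>The coefficients of a series in \<open>X\<close> alone.\<close>

definition X_coeffs :: "(xyz multiset \<Rightarrow> 'r) \<Rightarrow> nat \<Rightarrow> 'r" where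
  "X_coeffs f = (\<lambda>i. f (replicate_mset i Xvar))"

text \<open>The endomorphism ring of a formal group law. Endomorphisms have zero constant term; addition
  is \<open>F(f(X), g(X))\<close> and multiplication is the composition \<open>f(g(X))\<close>.\<close>

definition fgl_End :: "('r, 'x) ring_scheme \<Rightarrow> (nat \<Rightarrow> nat \<Rightarrow> 'r) \<Rightarrow> (nat \<Rightarrow> 'r) ring" where
  "fgl_End R F = (let X = indet R Xvar; Y = indet R Yvar in
    \<lparr>carrier = {f. (\<forall>i. f i \<in> carrier R) \<and> f 0 = \<zero>\<^bsub>R\<^esub> \<and>
       subst1 R f (subst2 R F X Y) = subst2 R F (subst1 R f X) (subst1 R f Y)},
     mult = (\<lambda>f g. X_coeffs (subst1 R f (subst1 R g X))),
     one = X_coeffs X,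
     zero = (\<lambda>i. \<zero>\<^bsub>R\<^esub>),
     add = (\<lambda>f g. X_coeffs (subst2 R F (subst1 R f X) (subst1 R g X)))\<rparr>)"

text \<open>A formal \<open>B\<close>-module over \<open>R\<close>, where \<open>R\<close> is a commutative \<open>B\<close>-algebra through the ring
  homomorphism \<open>\<phi>\<close>. The last condition is \<open>\<rho>(b)(X) = bX mod X^2\<close>, as members of
  \<^const>\<open>fgl_End\<close> have no constant term.\<close>

definition formal_module :: "('b, 'x) ring_scheme \<Rightarrow> ('r, 'y) ring_scheme \<Rightarrow> ('b \<Rightarrow> 'r) \<Rightarrow>
    (nat \<Rightarrow> nat \<Rightarrow> 'r) \<Rightarrow> ('b \<Rightarrow> nat \<Rightarrow> 'r) \<Rightarrow> bool" where
  "formal_module B R \<phi> F \<rho> \<longleftrightarrow> cring B \<and> cring R \<and> \<phi> \<in> ring_hom B R \<and>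
    formal_group_law R F \<and> \<rho> \<in> ring_hom B (fgl_End R F) \<and>
    (\<forall>b\<in>carrier B. \<rho> b 1 = \<phi> b)"


section \<open>The classifying ring of formal modules and its grading\<close>

text \<open>The classifying ring \<open>L^B\<close> is constructed as the quotient of the polynomial \<open>B\<close>-algebra on the
  coefficients of a would-be universal formal module by the least ideal modulo which these
  coefficients do form a formal \<open>B\<close>-module. Theorems \<open>universal_formal_module\<close>, \<open>classify_exists\<close> and
  \<open>classify_unique\<close> below say that the result corepresents formal \<open>B\<close>-modules.\<close>

datatype 'b gen = Alpha nat nat | Rho 'b nat

definition gens :: "('b, 'x) ring_scheme \<Rightarrow> 'b gen set" where
  "gens B = {Alpha i j |i j. True} \<union> {Rho b i |b i. b \<in> carrier B \<and> i \<ge> 1}"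

abbreviation gen_poly :: "('b, 'x) ring_scheme \<Rightarrow> ('b gen multiset \<Rightarrow> 'b) ring" where
  "gen_poly B \<equiv> mpoly B (gens B)"

definition rho_poly :: "('b, 'x) ring_scheme \<Rightarrow> 'b \<Rightarrow> nat \<Rightarrow> 'b gen multiset \<Rightarrow> 'b" where
  "rho_poly B b i = (if i = 0 then \<zero>\<^bsub>gen_poly B\<^esub> else indet B (Rho b i))"

definition formal_module_ideal :: "('b, 'x) ring_scheme \<Rightarrow> ('b gen multiset \<Rightarrow> 'b) set" where
  "formal_module_ideal B = \<Inter>{J. ideal J (gen_poly B) \<and>
     formal_module B (gen_poly B Quot J)
       (\<lambda>b. J +>\<^bsub>gen_poly B\<^esub> mconst B b)
       (\<lambda>i j. J +>\<^bsub>gen_poly B\<^esub> indet B (Alpha i j))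
       (\<lambda>b i. J +>\<^bsub>gen_poly B\<^esub> rho_poly B b i)}"

definition L_ring :: "('b, 'x) ring_scheme \<Rightarrow> ('b gen multiset \<Rightarrow> 'b) set ring" where
  "L_ring B = gen_poly B Quot formal_module_ideal B"

definition L_class ::
  "('b, 'x) ring_scheme \<Rightarrow> ('b gen multiset \<Rightarrow> 'b) \<Rightarrow> ('b gen multiset \<Rightarrow> 'b) set" where
  "L_class B p = formal_module_ideal B +>\<^bsub>gen_poly B\<^esub> p"

definition L_unit :: "('b, 'x) ring_scheme \<Rightarrow> 'b \<Rightarrow> ('b gen multiset \<Rightarrow> 'b) set" where
  "L_unit B b = L_class B (mconst B b)"

definition L_alpha :: "('b, 'x) ring_scheme \<Rightarrow> nat \<Rightarrow> nat \<Rightarrow> ('b gen multiset \<Rightarrow> 'b) set" where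
  "L_alpha B i j = L_class B (indet B (Alpha i j))"

definition L_rho :: "('b, 'x) ring_scheme \<Rightarrow> 'b \<Rightarrow> nat \<Rightarrow> ('b gen multiset \<Rightarrow> 'b) set" where
  "L_rho B b i = L_class B (rho_poly B b i)"

text \<open>The generator \<open>\<alpha>\<^sub>0\<^sub>0\<close> has degree \<open>-2\<close>, but vanishes in \<open>L^B\<close>.\<close>

fun gen_degree :: "'b gen \<Rightarrow> int" where
  "gen_degree (Alpha i j) = 2 * (int i + int j - 1)"
| "gen_degree (Rho b i) = 2 * (int i - 1)"

definition mono_degree :: "'b gen multiset \<Rightarrow> int" where
  "mono_degree m = (\<Sum>x\<in>#m. gen_degree x)"

text \<open>The degree \<open>d\<close> summand of \<open>L^B\<close>, as a \<open>B\<close>-module: the classes of the polynomials all of whose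
  monomials have degree \<open>d\<close>.\<close>

definition L_summand ::
  "('b, 'x) ring_scheme \<Rightarrow> int \<Rightarrow> ('b, ('b gen multiset \<Rightarrow> 'b) set) module" where
  "L_summand B d =
    \<lparr>carrier = {L_class B p |p. p \<in> carrier (gen_poly B) \<and>
       (\<forall>m. p m \<noteq> \<zero>\<^bsub>B\<^esub> \<longrightarrow> mono_degree m = d)},
     mult = monoid.mult (L_ring B), one = one (L_ring B), zero = zero (L_ring B), add = add (L_ring B),
     smult = (\<lambda>b x. L_unit B b \<otimes>\<^bsub>L_ring B\<^esub> x)\<rparr>"


section \<open>Localization\<close>

text \<open>The fraction \<open>a/s\<close> as an equivalence class of pairs.\<close>

definition loc_frac :: "('a, 'x) ring_scheme \<Rightarrow> 'a set \<Rightarrow> 'a \<Rightarrow> 'a \<Rightarrow> ('a \<times> 'a) set" where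
  "loc_frac A S a s = {(b, t). b \<in> carrier A \<and> t \<in> S \<and>
     (\<exists>u\<in>S. u \<otimes>\<^bsub>A\<^esub> (a \<otimes>\<^bsub>A\<^esub> t) = u \<otimes>\<^bsub>A\<^esub> (b \<otimes>\<^bsub>A\<^esub> s))}"

definition localization :: "('a, 'x) ring_scheme \<Rightarrow> 'a set \<Rightarrow> ('a \<times> 'a) set ring" where
  "localization A S =
    \<lparr>carrier = {loc_frac A S a s |a s. a \<in> carrier A \<and> s \<in> S},
     mult = (\<lambda>x y. \<Union>(a, s)\<in>x. \<Union>(b, t)\<in>y. loc_frac A S (a \<otimes>\<^bsub>A\<^esub> b) (s \<otimes>\<^bsub>A\<^esub> t)),
     one = loc_frac A S \<one>\<^bsub>A\<^esub> \<one>\<^bsub>A\<^esub>,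
     zero = loc_frac A S \<zero>\<^bsub>A\<^esub> \<one>\<^bsub>A\<^esub>,
     add = (\<lambda>x y. \<Union>(a, s)\<in>x. \<Union>(b, t)\<in>y.
       loc_frac A S ((a \<otimes>\<^bsub>A\<^esub> t) \<oplus>\<^bsub>A\<^esub> (b \<otimes>\<^bsub>A\<^esub> s)) (s \<otimes>\<^bsub>A\<^esub> t))\<rparr>"

definition localize_at :: "('a, 'x) ring_scheme \<Rightarrow> 'a set \<Rightarrow> ('a \<times> 'a) set ring" where
  "localize_at A I = localization A (carrier A - I)"

definition localize_map :: "('a, 'x) ring_scheme \<Rightarrow> 'a set \<Rightarrow> 'a \<Rightarrow> ('a \<times> 'a) set" where
  "localize_map A I a = loc_frac A (carrier A - I) a \<one>\<^bsub>A\<^esub>"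


section \<open>Finitely generated and adically separated modules\<close>

definition torsion_free_ring :: "('a, 'x) ring_scheme \<Rightarrow> bool" where
  "torsion_free_ring A \<longleftrightarrow>
    (\<forall>n::nat. \<forall>a\<in>carrier A. n > 0 \<and> [n] \<cdot>\<^bsub>A\<^esub> a = \<zero>\<^bsub>A\<^esub> \<longrightarrow> a = \<zero>\<^bsub>A\<^esub>)"

definition finitely_generated_ring :: "('a, 'x) ring_scheme \<Rightarrow> bool" where
  "finitely_generated_ring A \<longleftrightarrow>
    (\<exists>S. finite S \<and> S \<subseteq> carrier A \<and> generate_ring A S = carrier A)"

definition finitely_generated_module ::
  "('a, 'x) ring_scheme \<Rightarrow> ('a, 'c, 'y) module_scheme \<Rightarrow> bool" where
  "finitely_generated_module A M \<longleftrightarrow> module A M \<and>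
    (\<exists>S. finite S \<and> S \<subseteq> carrier M \<and>
      carrier M = {\<Oplus>\<^bsub>M\<^esub>s\<in>S. c s \<odot>\<^bsub>M\<^esub> s |c. c \<in> S \<rightarrow> carrier A})"

definition restrict_scalars ::
  "('a \<Rightarrow> 'b) \<Rightarrow> ('b, 'c, 'y) module_scheme \<Rightarrow> ('a, 'c) module" where
  "restrict_scalars f M = \<lparr>carrier = carrier M, mult = monoid.mult M, one = one M, zero = zero M,
     add = add M, smult = (\<lambda>a x. f a \<odot>\<^bsub>M\<^esub> x)\<rparr>"

text \<open>\<open>J M\<close>, the additive subgroup generated by the products.\<close>

definition ideal_times_module ::
  "'a set \<Rightarrow> ('a, 'c, 'y) module_scheme \<Rightarrow> 'c set" where
  "ideal_times_module J M = generate (add_monoid M) {a \<odot>\<^bsub>M\<^esub> x |a x. a \<in> J \<and> x \<in> carrier M}"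

definition adically_separated ::
  "('a, 'x) ring_scheme \<Rightarrow> 'a set \<Rightarrow> ('a, 'c, 'y) module_scheme \<Rightarrow> bool" where
  "adically_separated A I M \<longleftrightarrow>
    (\<Inter>n::nat. ideal_times_module (I [^]\<^bsub>ideals_set A\<^esub> n) M) = {\<zero>\<^bsub>M\<^esub>}"


section \<open>Power series and polynomials form commutative rings\<close>

lemma finite_submultisets: "finite {a. a \<subseteq># (m :: 'v multiset)}"
proof (induction m)
  case (add x m)
  have "{a. a \<subseteq># add_mset x m} \<subseteq> {a. a \<subseteq># m} \<union> add_mset x ` {a. a \<subseteq># m}"
  proof
    fix a assume a: "a \<in> {a. a \<subseteq># add_mset x m}"
    show "a \<in> {a. a \<subseteq># m} \<union> add_mset x ` {a. a \<subseteq># m}"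
    proof (cases "x \<in># a")
      case True
      then have "a = add_mset x (a - {#x#})" by simp
      moreover from this a have "a - {#x#} \<subseteq># m"
        by (metis mem_Collect_eq mset_subset_eq_add_mset_cancel)
      ultimately show ?thesis by blast
    next
      case False
      then have "a \<subseteq># m"
        using a by (metis mem_Collect_eq subset_eq_diff_conv diff_single_trivial
            add_mset_add_single)
      then show ?thesis by simp
    qed
  qed
  then show ?case using add.IH by (meson finite_Un finite_imageI finite_subset)
qed simp

context cring
begin

lemma finsum_fibres:
  assumes "finite S" "finite T" "g \<in> S \<rightarrow> T" "f \<in> S \<rightarrow> carrier R"
  shows "(\<Oplus>s\<in>S. f s) = (\<Oplus>t\<in>T. \<Oplus>s\<in>{s \<in> S. g s = t}. f s)"
proof -
  have "S = (\<Union>t\<in>T. {s \<in> S. g s = t})" using assms(3) by auto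
  then have "(\<Oplus>s\<in>S. f s) = (\<Oplus>s\<in>(\<Union>t\<in>T. {s \<in> S. g s = t}). f s)" by simp
  also have "\<dots> = (\<Oplus>t\<in>T. \<Oplus>s\<in>{s \<in> S. g s = t}. f s)"
    by (rule add.finprod_UN_disjoint) (use assms in \<open>auto simp: pairwise_def disjnt_def\<close>)
  finally show ?thesis .
qed

lemma finsum_bij:
  assumes "bij_betw h S T" "f \<in> T \<rightarrow> carrier R" "\<And>s. s \<in> S \<Longrightarrow> f (h s) = g s"
  shows "(\<Oplus>t\<in>T. f t) = (\<Oplus>s\<in>S. g s)"
proof -
  have T: "T = h ` S" and inj: "inj_on h S" using assms(1) by (auto simp: bij_betw_def)
  have "(\<Oplus>t\<in>T. f t) = (\<Oplus>s\<in>S. f (h s))"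
    unfolding T using assms(2) inj by (intro add.finprod_reindex) (auto simp: T)
  also have "\<dots> = (\<Oplus>s\<in>S. g s)"
    using assms T by (intro add.finprod_cong') (auto, metis PiE imageI)
  finally show ?thesis .
qed

lemma mps_mult_assoc:
  assumes f: "\<And>m. f m \<in> carrier R" and g: "\<And>m. g m \<in> carrier R" and h: "\<And>m. h m \<in> carrier R"
  shows "(\<Oplus>c\<in>{c. c \<subseteq># m}. (\<Oplus>a\<in>{a. a \<subseteq># c}. f a \<otimes> g (c - a)) \<otimes> h (m - c))
    = (\<Oplus>a\<in>{a. a \<subseteq># m}. f a \<otimes> (\<Oplus>b\<in>{b. b \<subseteq># m - a}. g b \<otimes> h (m - a - b)))"
    (is "?l = ?r")
proof -
  define S where "S = {(a, c). a \<subseteq># c \<and> c \<subseteq># m}"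
  have finS: "finite S"
    by (rule finite_subset[of _ "{a. a \<subseteq># m} \<times> {a. a \<subseteq># m}"])
       (auto simp: S_def finite_submultisets)
  let ?t = "\<lambda>(a, c). f a \<otimes> g (c - a) \<otimes> h (m - c)"
  have "?l = (\<Oplus>c\<in>{c. c \<subseteq># m}. \<Oplus>s\<in>{s \<in> S. snd s = c}. ?t s)"
  proof (rule add.finprod_cong')
    show "(\<lambda>c. \<Oplus>s\<in>{s \<in> S. snd s = c}. ?t s) \<in> {c. c \<subseteq># m} \<rightarrow> carrier R"
      using f g h by (auto intro!: finsum_closed)
    fix c assume c: "c \<in> {c. c \<subseteq># m}"
    have "(\<Oplus>a\<in>{a. a \<subseteq># c}. f a \<otimes> g (c - a)) \<otimes> h (m - c)
      = (\<Oplus>a\<in>{a. a \<subseteq># c}. f a \<otimes> g (c - a) \<otimes> h (m - c))"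
      by (rule finsum_ldistr) (use f g h finite_submultisets in auto)
    also have "\<dots> = (\<Oplus>s\<in>{s \<in> S. snd s = c}. ?t s)"
    proof (rule finsum_bij[symmetric])
      show "bij_betw (\<lambda>a. (a, c)) {a. a \<subseteq># c} {s \<in> S. snd s = c}"
        using c by (auto simp: bij_betw_def inj_on_def S_def)
    qed (use f g h in auto)
    finally show "(\<Oplus>a\<in>{a. a \<subseteq># c}. f a \<otimes> g (c - a)) \<otimes> h (m - c) =
      (\<Oplus>s\<in>{s \<in> S. snd s = c}. ?t s)" .
  qed simp
  also have "\<dots> = (\<Oplus>s\<in>S. ?t s)"
    by (rule finsum_fibres[symmetric])
       (use f g h finite_submultisets finS in \<open>auto simp: S_def\<close>)
  also have "\<dots> = (\<Oplus>a\<in>{a. a \<subseteq># m}. \<Oplus>s\<in>{s \<in> S. fst s = a}. ?t s)"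
    by (rule finsum_fibres)
       (use f g h finite_submultisets finS in \<open>auto simp: S_def intro: subset_mset.order_trans\<close>)
  also have "\<dots> = ?r"
  proof (rule add.finprod_cong')
    show "(\<lambda>a. f a \<otimes> (\<Oplus>b\<in>{b. b \<subseteq># m - a}. g b \<otimes> h (m - a - b)))
        \<in> {a. a \<subseteq># m} \<rightarrow> carrier R"
      using f g h by (auto intro!: finsum_closed)
    fix a assume a: "a \<in> {a. a \<subseteq># m}"
    have "(\<Oplus>s\<in>{s \<in> S. fst s = a}. ?t s)
      = (\<Oplus>b\<in>{b. b \<subseteq># m - a}. f a \<otimes> (g b \<otimes> h (m - a - b)))"
    proof (rule finsum_bij)
      show "bij_betw (\<lambda>b. (a, a + b)) {b. b \<subseteq># m - a} {s \<in> S. fst s = a}"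
        unfolding bij_betw_def
      proof
        show "(\<lambda>b. (a, a + b)) ` {b. b \<subseteq># m - a} = {s \<in> S. fst s = a}"
        proof (intro equalityI subsetI)
          fix s assume "s \<in> {s \<in> S. fst s = a}"
          then obtain c where s: "s = (a, c)" "a \<subseteq># c" "c \<subseteq># m"
            by (auto simp: S_def)
          then have "c = a + (c - a)" "c - a \<subseteq># m - a"
            by (simp_all add: subset_mset.add_diff_inverse subset_eq_diff_conv)
          then show "s \<in> (\<lambda>b. (a, a + b)) ` {b. b \<subseteq># m - a}" using s(1) by auto
        next
          fix s assume "s \<in> (\<lambda>b. (a, a + b)) ` {b. b \<subseteq># m - a}"
          then show "s \<in> {s \<in> S. fst s = a}" using a
            by (auto simp: S_def)
               (metis subset_mset.add_diff_inverse subset_mset.add_left_mono)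
        qed
      qed (auto simp: inj_on_def)
    qed (use f g h in \<open>auto simp: m_assoc\<close>)
    also have "\<dots> = f a \<otimes> (\<Oplus>b\<in>{b. b \<subseteq># m - a}. g b \<otimes> h (m - a - b))"
      by (rule finsum_rdistr[symmetric]) (use f g h finite_submultisets in auto)
    finally show "(\<Oplus>s\<in>{s \<in> S. fst s = a}. ?t s)
      = f a \<otimes> (\<Oplus>b\<in>{b. b \<subseteq># m - a}. g b \<otimes> h (m - a - b))" .
  qed simp
  finally show ?thesis .
qed

lemma diff_diff_mset: "a \<subseteq># m \<Longrightarrow> m - (m - a) = (a :: 'v multiset)"
  by (metis add_diff_cancel_right' subset_mset.add_diff_inverse)

lemma mps_mult_comm:
  assumes f: "\<And>m. f m \<in> carrier R" and g: "\<And>m. g m \<in> carrier R"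
  shows "(\<Oplus>a\<in>{a. a \<subseteq># m}. f a \<otimes> g (m - a)) = (\<Oplus>a\<in>{a. a \<subseteq># m}. g a \<otimes> f (m - a))"
proof (rule finsum_bij)
  show "bij_betw (\<lambda>a. m - a) {a. a \<subseteq># m} {a. a \<subseteq># m}"
    by (rule bij_betwI[of _ _ _ "\<lambda>a. m - a"]) (auto simp: diff_diff_mset)
qed (use f g in \<open>auto simp: diff_diff_mset m_comm\<close>)

lemma mps_cring: "cring (mps R :: ('v multiset \<Rightarrow> 'a) ring)"
proof (rule cringI)
  show "abelian_group (mps R :: ('v multiset \<Rightarrow> 'a) ring)"
  proof (rule abelian_groupI)
    fix x :: "'v multiset \<Rightarrow> 'a" assume "x \<in> carrier (mps R)"
    then show "\<exists>y\<in>carrier (mps R). y \<oplus>\<^bsub>mps R\<^esub> x = \<zero>\<^bsub>mps R\<^esub>"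
      by (intro bexI[of _ "\<lambda>m. \<ominus> x m"]) (auto simp: mps_def l_neg)
  qed (auto simp: mps_def a_ac)
  show "Group.comm_monoid (mps R :: ('v multiset \<Rightarrow> 'a) ring)"
  proof (rule comm_monoidI)
    fix x y z :: "'v multiset \<Rightarrow> 'a"
    assume "x \<in> carrier (mps R)" "y \<in> carrier (mps R)" "z \<in> carrier (mps R)"
    then show "x \<otimes>\<^bsub>mps R\<^esub> y \<otimes>\<^bsub>mps R\<^esub> z = x \<otimes>\<^bsub>mps R\<^esub> (y \<otimes>\<^bsub>mps R\<^esub> z)"
      by (auto simp: mps_def mps_mult_assoc)
  next
    fix x y :: "'v multiset \<Rightarrow> 'a"
    assume x: "x \<in> carrier (mps R)" and y: "y \<in> carrier (mps R)"
    then show "x \<otimes>\<^bsub>mps R\<^esub> y = y \<otimes>\<^bsub>mps R\<^esub> x"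
      by (auto simp: mps_def fun_eq_iff intro: mps_mult_comm)
    show "\<one>\<^bsub>mps R\<^esub> \<otimes>\<^bsub>mps R\<^esub> x = x"
    proof
      fix m
      have "(\<Oplus>a\<in>{a. a \<subseteq># m}. (if a = {#} then \<one> else \<zero>) \<otimes> x (m - a)) = (\<Oplus>a\<in>{{#} :: 'v multiset}. x m)"
        by (rule add.finprod_mono_neutral_cong_right)
           (use x finite_submultisets in \<open>auto simp: mps_def\<close>)
      then show "(\<one>\<^bsub>mps R\<^esub> \<otimes>\<^bsub>mps R\<^esub> x) m = x m" using x by (simp add: mps_def)
    qed
  qed (auto simp: mps_def)
  fix x y z :: "'v multiset \<Rightarrow> 'a"
  assume "x \<in> carrier (mps R)" "y \<in> carrier (mps R)" "z \<in> carrier (mps R)"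
  then have c: "\<And>m. x m \<in> carrier R" "\<And>m. y m \<in> carrier R" "\<And>m. z m \<in> carrier R"
    by (auto simp: mps_def)
  then show "(x \<oplus>\<^bsub>mps R\<^esub> y) \<otimes>\<^bsub>mps R\<^esub> z = x \<otimes>\<^bsub>mps R\<^esub> z \<oplus>\<^bsub>mps R\<^esub> y \<otimes>\<^bsub>mps R\<^esub> z"
    by (auto simp: mps_def fun_eq_iff l_distr Pi_def intro!: finsum_addf)
qed

end


section \<open>Functoriality of substitution; formal modules by equations\<close>

context ring_hom_cring
begin

lemma mps_map_hom: "(\<lambda>f m. h (f m)) \<in> ring_hom (mps R) (mps S :: ('v multiset \<Rightarrow> 'c) ring)"
proof (rule ring_hom_memI)
  fix f :: "'v multiset \<Rightarrow> 'a" assume "f \<in> carrier (mps R)"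
  then show "(\<lambda>m. h (f m)) \<in> carrier (mps S)" by (simp add: mps_def)
next
  fix f g :: "'v multiset \<Rightarrow> 'a"
  assume "f \<in> carrier (mps R)" "g \<in> carrier (mps R)"
  then have c: "\<And>m. f m \<in> carrier R" "\<And>m. g m \<in> carrier R" by (auto simp: mps_def)
  show "(\<lambda>m. h ((f \<oplus>\<^bsub>mps R\<^esub> g) m)) = (\<lambda>m. h (f m)) \<oplus>\<^bsub>mps S\<^esub> (\<lambda>m. h (g m))"
    using c by (simp add: mps_def)
  show "(\<lambda>m. h ((f \<otimes>\<^bsub>mps R\<^esub> g) m)) = (\<lambda>m. h (f m)) \<otimes>\<^bsub>mps S\<^esub> (\<lambda>m. h (g m))"
  proof
    fix m
    have "h (\<Oplus>a\<in>{a. a \<subseteq># m}. f a \<otimes> g (m - a))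
      = (\<Oplus>\<^bsub>S\<^esub>a\<in>{a. a \<subseteq># m}. (h \<circ> (\<lambda>a. f a \<otimes> g (m - a))) a)"
      by (rule hom_finsum) (use c in auto)
    then show "h ((f \<otimes>\<^bsub>mps R\<^esub> g) m) = ((\<lambda>m. h (f m)) \<otimes>\<^bsub>mps S\<^esub> (\<lambda>m. h (g m))) m"
      using c by (simp add: mps_def comp_def)
  qed
next
  show "(\<lambda>m. h (\<one>\<^bsub>mps R\<^esub> m)) = (\<one>\<^bsub>mps S\<^esub> :: 'v multiset \<Rightarrow> 'c)"
    by (auto simp: mps_def)
qed

lemma mps_map_ring_hom:
  "ring_hom_cring (mps R) (mps S :: ('v multiset \<Rightarrow> 'c) ring) (\<lambda>f m. h (f m))"
  using mps_map_hom R.mps_cring S.mps_cring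
  by (auto simp: ring_hom_cring_def ring_hom_cring_axioms_def)

lemma mps_map_pow:
  assumes "g \<in> carrier (mps R)"
  shows "(\<lambda>m. h ((g [^]\<^bsub>mps R\<^esub> (i::nat)) m)) = (\<lambda>m. h (g m)) [^]\<^bsub>mps S\<^esub> i"
proof -
  interpret m: ring_hom_cring "mps R" "mps S" "\<lambda>f m. h (f m)" by (rule mps_map_ring_hom)
  show ?thesis using m.ring.hom_nat_pow[OF assms] .
qed

end

context cring
begin

lemma mps_memD: "f \<in> carrier (mps R) \<Longrightarrow> f m \<in> carrier R"
  by (simp add: mps_def)

lemma mps_memI: "(\<And>m. f m \<in> carrier R) \<Longrightarrow> f \<in> carrier (mps R)"
  by (simp add: mps_def)

lemma mps_pow_closed:
  assumes "g \<in> carrier (mps R)"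
  shows "(g [^]\<^bsub>mps R\<^esub> (i::nat)) m \<in> carrier R"
proof -
  interpret m: cring "mps R" by (rule mps_cring)
  show ?thesis using assms by (intro mps_memD) simp
qed

lemma mps_powmult_closed:
  assumes "f \<in> carrier (mps R)" "g \<in> carrier (mps R)"
  shows "(f [^]\<^bsub>mps R\<^esub> (i::nat) \<otimes>\<^bsub>mps R\<^esub> g [^]\<^bsub>mps R\<^esub> (j::nat)) m \<in> carrier R"
proof -
  interpret m: cring "mps R" by (rule mps_cring)
  show ?thesis using assms by (intro mps_memD) simp
qed

lemma subst1_closed:
  assumes "\<And>i. f i \<in> carrier R" "g \<in> carrier (mps R)"
  shows "subst1 R f g \<in> carrier (mps R)"
  unfolding subst1_def
  by (intro mps_memI finsum_closed Pi_I m_closed mps_pow_closed assms)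

lemma subst2_closed:
  assumes "\<And>i j. F i j \<in> carrier R" "f \<in> carrier (mps R)" "g \<in> carrier (mps R)"
  shows "subst2 R F f g \<in> carrier (mps R)"
  unfolding subst2_def
  by (intro mps_memI finsum_closed Pi_I m_closed mps_powmult_closed assms)

lemma indet_closed: "indet R v \<in> carrier (mps R)"
  by (auto simp: indet_def mps_def)

lemma mps_zero_closed: "\<zero>\<^bsub>mps R\<^esub> \<in> carrier (mps R)"
  by (auto simp: mps_def)

end

context ring_hom_cring
begin

lemma map_subst1:
  assumes "\<And>i. f i \<in> carrier R" "g \<in> carrier (mps R)"
  shows "h (subst1 R f g m) = subst1 S (\<lambda>i. h (f i)) (\<lambda>m. h (g m)) m"
proof -
  have "h (subst1 R f g m) = (\<Oplus>\<^bsub>S\<^esub>i\<in>{..size m}. (h \<circ> (\<lambda>i. f i \<otimes> (g [^]\<^bsub>mps R\<^esub> i) m)) i)"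
    unfolding subst1_def by (rule hom_finsum) (use assms in \<open>auto simp: R.mps_pow_closed\<close>)
  also have "\<dots> = subst1 S (\<lambda>i. h (f i)) (\<lambda>m. h (g m)) m"
    unfolding subst1_def comp_def
    by (simp add: assms R.mps_pow_closed mps_map_pow[symmetric])
  finally show ?thesis .
qed

lemma map_subst2:
  assumes "\<And>i j. F i j \<in> carrier R" "f \<in> carrier (mps R)" "g \<in> carrier (mps R)"
  shows "h (subst2 R F f g m) = subst2 S (\<lambda>i j. h (F i j)) (\<lambda>m. h (f m)) (\<lambda>m. h (g m)) m"
proof -
  interpret m: ring_hom_cring "mps R" "mps S" "\<lambda>f m. h (f m)" by (rule mps_map_ring_hom)
  let ?p = "\<lambda>i j. f [^]\<^bsub>mps R\<^esub> (i::nat) \<otimes>\<^bsub>mps R\<^esub> g [^]\<^bsub>mps R\<^esub> (j::nat)"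
  have p: "h (?p i j m) = ((\<lambda>m. h (f m)) [^]\<^bsub>mps S\<^esub> i \<otimes>\<^bsub>mps S\<^esub> (\<lambda>m. h (g m)) [^]\<^bsub>mps S\<^esub> j) m" for i j
    using fun_cong[OF m.hom_mult[of "f [^]\<^bsub>mps R\<^esub> i" "g [^]\<^bsub>mps R\<^esub> j"], of m] assms
    by (simp add: mps_map_pow)
  have "h (subst2 R F f g m)
    = (\<Oplus>\<^bsub>S\<^esub>i\<in>{..size m}. (h \<circ> (\<lambda>i. \<Oplus>j\<in>{..size m}. F i j \<otimes> ?p i j m)) i)"
    unfolding subst2_def by (rule hom_finsum) (use assms in \<open>auto simp: R.mps_powmult_closed intro!: R.finsum_closed\<close>)
  also have "\<dots> = (\<Oplus>\<^bsub>S\<^esub>i\<in>{..size m}. \<Oplus>\<^bsub>S\<^esub>j\<in>{..size m}. h (F i j) \<otimes>\<^bsub>S\<^esub> h (?p i j m))"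
  proof (rule S.add.finprod_cong')
    fix i
    have "h (\<Oplus>j\<in>{..size m}. F i j \<otimes> ?p i j m) = (\<Oplus>\<^bsub>S\<^esub>j\<in>{..size m}. (h \<circ> (\<lambda>j. F i j \<otimes> ?p i j m)) j)"
      by (rule hom_finsum) (use assms in \<open>auto simp: R.mps_powmult_closed\<close>)
    then show "(h \<circ> (\<lambda>i. \<Oplus>j\<in>{..size m}. F i j \<otimes> ?p i j m)) i =
      (\<Oplus>\<^bsub>S\<^esub>j\<in>{..size m}. h (F i j) \<otimes>\<^bsub>S\<^esub> h (?p i j m))"
      by (simp add: assms R.mps_powmult_closed comp_def)
  qed (use assms in \<open>auto simp: R.mps_powmult_closed intro!: S.finsum_closed\<close>)
  also have "\<dots> = subst2 S (\<lambda>i j. h (F i j)) (\<lambda>m. h (f m)) (\<lambda>m. h (g m)) m"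
    by (simp add: subst2_def p)
  finally show ?thesis .
qed

lemma map_indet: "h (indet R v m) = indet S v m"
  by (simp add: indet_def)

lemma map_mps_zero: "h (\<zero>\<^bsub>mps R\<^esub> m) = \<zero>\<^bsub>mps S\<^esub> m"
  by (simp add: mps_def)

end

text \<open>The equations between coefficients that make up the definition of a formal module.\<close>

definition module_eqns :: "('b, 'x) ring_scheme \<Rightarrow> ('r, 'y) ring_scheme \<Rightarrow> ('b \<Rightarrow> 'r) \<Rightarrow>
    (nat \<Rightarrow> nat \<Rightarrow> 'r) \<Rightarrow> ('b \<Rightarrow> nat \<Rightarrow> 'r) \<Rightarrow> ('r \<times> 'r) set" where
  "module_eqns B R \<phi> F \<rho> =
    (let X = indet R Xvar; Y = indet R Yvar; Z = indet R Zvar; N = \<zero>\<^bsub>mps R\<^esub> in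
      range (\<lambda>m. (subst2 R F X N m, X m)) \<union>
      range (\<lambda>m. (subst2 R F N X m, X m)) \<union>
      range (\<lambda>m. (subst2 R F X Y m, subst2 R F Y X m)) \<union>
      range (\<lambda>m. (subst2 R F (subst2 R F X Y) Z m, subst2 R F X (subst2 R F Y Z) m)) \<union>
      (\<Union>b\<in>carrier B. range (\<lambda>m. (subst1 R (\<rho> b) (subst2 R F X Y) m,
         subst2 R F (subst1 R (\<rho> b) X) (subst1 R (\<rho> b) Y) m))) \<union>
      (\<Union>b\<in>carrier B. \<Union>c\<in>carrier B. range (\<lambda>i. (\<rho> (b \<otimes>\<^bsub>B\<^esub> c) i,
         subst1 R (\<rho> b) (subst1 R (\<rho> c) X) (replicate_mset i Xvar)))) \<union>
      (\<Union>b\<in>carrier B. \<Union>c\<in>carrier B. range (\<lambda>i. (\<rho> (b \<oplus>\<^bsub>B\<^esub> c) i,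
         subst2 R F (subst1 R (\<rho> b) X) (subst1 R (\<rho> c) X) (replicate_mset i Xvar)))) \<union>
      range (\<lambda>i. (\<rho> \<one>\<^bsub>B\<^esub> i, X (replicate_mset i Xvar))) \<union>
      (\<lambda>b. (\<rho> b 1, \<phi> b)) ` carrier B)"

lemma (in cring) formal_module_iff_eqns:
  assumes "\<And>i j. F i j \<in> carrier R" "\<And>b i. b \<in> carrier B \<Longrightarrow> \<rho> b i \<in> carrier R"
    and "\<And>b. b \<in> carrier B \<Longrightarrow> \<rho> b 0 = \<zero>"
  shows "formal_module B R \<phi> F \<rho> \<longleftrightarrow>
    cring B \<and> \<phi> \<in> ring_hom B R \<and> (\<forall>e\<in>module_eqns B R \<phi> F \<rho>. fst e = snd e)"
proof -
  have fgl: "formal_group_law R F \<longleftrightarrow>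
      (\<forall>m. subst2 R F (indet R Xvar) \<zero>\<^bsub>mps R\<^esub> m = indet R Xvar m) \<and>
      (\<forall>m. subst2 R F \<zero>\<^bsub>mps R\<^esub> (indet R Xvar) m = indet R Xvar m) \<and>
      (\<forall>m. subst2 R F (indet R Xvar) (indet R Yvar) m = subst2 R F (indet R Yvar) (indet R Xvar) m) \<and>
      (\<forall>m. subst2 R F (subst2 R F (indet R Xvar) (indet R Yvar)) (indet R Zvar) m
        = subst2 R F (indet R Xvar) (subst2 R F (indet R Yvar) (indet R Zvar)) m)"
    using assms(1) by (simp add: formal_group_law_def Let_def fun_eq_iff)
  have hom: "\<rho> \<in> ring_hom B (fgl_End R F) \<longleftrightarrow>
      (\<forall>b\<in>carrier B. \<forall>m. subst1 R (\<rho> b) (subst2 R F (indet R Xvar) (indet R Yvar)) m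
        = subst2 R F (subst1 R (\<rho> b) (indet R Xvar)) (subst1 R (\<rho> b) (indet R Yvar)) m) \<and>
      (\<forall>b\<in>carrier B. \<forall>c\<in>carrier B. \<forall>i. \<rho> (b \<otimes>\<^bsub>B\<^esub> c) i
        = subst1 R (\<rho> b) (subst1 R (\<rho> c) (indet R Xvar)) (replicate_mset i Xvar)) \<and>
      (\<forall>b\<in>carrier B. \<forall>c\<in>carrier B. \<forall>i. \<rho> (b \<oplus>\<^bsub>B\<^esub> c) i
        = subst2 R F (subst1 R (\<rho> b) (indet R Xvar)) (subst1 R (\<rho> c) (indet R Xvar)) (replicate_mset i Xvar)) \<and>
      (\<forall>i. \<rho> \<one>\<^bsub>B\<^esub> i = indet R Xvar (replicate_mset i Xvar))"
    unfolding ring_hom_def fgl_End_def Let_def X_coeffs_def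
    using assms(2,3) by (simp add: fun_eq_iff Pi_iff) blast
  have eqns: "(\<forall>e\<in>module_eqns B R \<phi> F \<rho>. fst e = snd e) \<longleftrightarrow>
      formal_group_law R F \<and> \<rho> \<in> ring_hom B (fgl_End R F) \<and> (\<forall>b\<in>carrier B. \<rho> b 1 = \<phi> b)"
    unfolding fgl hom module_eqns_def Let_def ball_Un ball_UN ball_simps by simp
  show ?thesis unfolding formal_module_def eqns using is_cring by blast
qed

lemma (in ring_hom_cring) map_module_eqns:
  assumes "\<And>i j. F i j \<in> carrier R" "\<And>b i. b \<in> carrier B \<Longrightarrow> \<rho> b i \<in> carrier R"
  shows "module_eqns B S (\<lambda>b. h (\<phi> b)) (\<lambda>i j. h (F i j)) (\<lambda>b i. h (\<rho> b i))
    = map_prod h h ` module_eqns B R \<phi> F \<rho>"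
  unfolding module_eqns_def Let_def image_Un image_UN image_image map_prod_simp
  by (simp add: assms map_subst1 map_subst2 map_indet map_mps_zero R.subst1_closed R.subst2_closed
      R.indet_closed R.mps_zero_closed cong: image_cong SUP_cong)


section \<open>Polynomial rings and evaluation\<close>

definition mono_eval :: "('r, 'x) ring_scheme \<Rightarrow> ('v \<Rightarrow> 'r) \<Rightarrow> 'v multiset \<Rightarrow> 'r" where
  "mono_eval R \<sigma> m = (\<Otimes>\<^bsub>R\<^esub>v\<in>set_mset m. \<sigma> v [^]\<^bsub>R\<^esub> count m v)"

definition monom_fun :: "('r, 'x) ring_scheme \<Rightarrow> 'v multiset \<Rightarrow> 'r \<Rightarrow> 'v multiset \<Rightarrow> 'r" where
  "monom_fun R a c = (\<lambda>k. if k = a then c else \<zero>\<^bsub>R\<^esub>)"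

lemma mconst_monom: "mconst R c = monom_fun R {#} c"
  by (simp add: mconst_def monom_fun_def)

lemma indet_monom: "indet R v = monom_fun R {#v#} \<one>\<^bsub>R\<^esub>"
  by (simp add: indet_def monom_fun_def)

lemma mpoly_ops [simp]:
  "add (mpoly R V) = add (mps R)" "monoid.mult (mpoly R V) = monoid.mult (mps R)"
  "zero (mpoly R V) = zero (mps R)" "one (mpoly R V) = one (mps R)"
  by (simp_all add: mpoly_def)

lemma mpoly_mem: "p \<in> carrier (mpoly R V) \<longleftrightarrow> (\<forall>m. p m \<in> carrier R) \<and>
    finite {m. p m \<noteq> \<zero>\<^bsub>R\<^esub>} \<and> (\<forall>m. p m \<noteq> \<zero>\<^bsub>R\<^esub> \<longrightarrow> set_mset m \<subseteq> V)"
  by (simp add: mpoly_def)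

context cring
begin

lemma mps_mult_finite:
  assumes f: "\<And>m. f m \<in> carrier R" and g: "\<And>m. g m \<in> carrier R"
    and "finite S" "finite T" "\<And>m. m \<notin> S \<Longrightarrow> f m = \<zero>" "\<And>m. m \<notin> T \<Longrightarrow> g m = \<zero>"
  shows "(f \<otimes>\<^bsub>mps R\<^esub> g) m = (\<Oplus>s\<in>{s \<in> S \<times> T. fst s + snd s = m}. f (fst s) \<otimes> g (snd s))"
proof -
  let ?A = "{a. a \<subseteq># m}" and ?S = "{s \<in> S \<times> T. fst s + snd s = m}"
  have "(f \<otimes>\<^bsub>mps R\<^esub> g) m = (\<Oplus>a\<in>?A. f a \<otimes> g (m - a))" by (simp add: mps_def)
  also have "\<dots> = (\<Oplus>a\<in>fst ` ?S. f a \<otimes> g (m - a))"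
  proof (rule add.finprod_mono_neutral_cong_right)
    fix a assume a: "a \<in> ?A - fst ` ?S"
    then have "a + (m - a) = m" by (simp add: subset_mset.add_diff_inverse)
    with a have "\<not> (a \<in> S \<and> m - a \<in> T)" by (auto simp: image_iff)
    then show "f a \<otimes> g (m - a) = \<zero>" using assms by auto
  qed (use f g finite_submultisets in auto)
  also have "\<dots> = (\<Oplus>s\<in>?S. f (fst s) \<otimes> g (snd s))"
  proof (rule finsum_bij)
    show "bij_betw fst ?S (fst ` ?S)" by (auto simp: bij_betw_def inj_on_def)
  qed (use f g in auto)
  finally show ?thesis .
qed

lemma mpoly_mult_closed:
  assumes "p \<in> carrier (mpoly R V)" "q \<in> carrier (mpoly R V)"
  shows "p \<otimes>\<^bsub>mps R\<^esub> q \<in> carrier (mpoly R V)"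
proof -
  interpret m: cring "mps R" by (rule mps_cring)
  let ?S = "{m. p m \<noteq> \<zero>}" and ?T = "{m. q m \<noteq> \<zero>}"
  have c: "\<And>m. p m \<in> carrier R" "\<And>m. q m \<in> carrier R" using assms by (auto simp: mpoly_mem)
  have S: "finite ?S" "finite ?T" using assms by (auto simp: mpoly_mem)
  have nz: "\<exists>a b. p a \<noteq> \<zero> \<and> q b \<noteq> \<zero> \<and> m = a + b" if "(p \<otimes>\<^bsub>mps R\<^esub> q) m \<noteq> \<zero>" for m
  proof (rule ccontr)
    assume "\<not> ?thesis"
    then have e: "{s \<in> ?S \<times> ?T. fst s + snd s = m} = {}" by auto
    have "(p \<otimes>\<^bsub>mps R\<^esub> q) m = (\<Oplus>s\<in>{s \<in> ?S \<times> ?T. fst s + snd s = m}. p (fst s) \<otimes> q (snd s))"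
      by (rule mps_mult_finite[OF c S]) auto
    also have "\<dots> = \<zero>" unfolding e by (rule finsum_empty)
    finally show False using that by contradiction
  qed
  have "{m. (p \<otimes>\<^bsub>mps R\<^esub> q) m \<noteq> \<zero>} \<subseteq> (\<lambda>(a, b). a + b) ` (?S \<times> ?T)"
    using nz by force
  then have fin: "finite {m. (p \<otimes>\<^bsub>mps R\<^esub> q) m \<noteq> \<zero>}"
    by (rule finite_subset) (use S in simp)
  have vars: "set_mset m \<subseteq> V" if nz': "(p \<otimes>\<^bsub>mps R\<^esub> q) m \<noteq> \<zero>" for m
  proof -
    obtain a b where "p a \<noteq> \<zero>" "q b \<noteq> \<zero>" "m = a + b" using nz[OF nz'] by blast
    then show ?thesis using assms by (simp add: mpoly_mem)
  qed
  have "p \<otimes>\<^bsub>mps R\<^esub> q \<in> carrier (mps R)" using c by (intro m.m_closed mps_memI)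
  then show ?thesis using fin vars by (simp add: mpoly_mem mps_memD)
qed

lemma mps_a_inv: "f \<in> carrier (mps R) \<Longrightarrow> \<ominus>\<^bsub>mps R\<^esub> f = (\<lambda>m. \<ominus> f m)"
proof -
  interpret m: cring "mps R" by (rule mps_cring)
  assume f: "f \<in> carrier (mps R)"
  then show ?thesis
    by (intro m.minus_equality) (auto simp: mps_def l_neg)
qed

lemma mpoly_cring: "cring (mpoly R V)"
proof -
  interpret m: cring "mps R :: ('c multiset \<Rightarrow> 'a) ring" by (rule mps_cring)
  let ?H = "carrier (mpoly R V)"
  have sub: "?H \<subseteq> carrier (mps R)" by (auto simp: mpoly_mem intro: mps_memI)
  have "subring ?H (mps R)"
  proof (rule m.subringI[OF sub])
    show "\<one>\<^bsub>mps R\<^esub> \<in> ?H" by (auto simp: mpoly_mem mps_def split: if_splits)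
  next
    fix f assume f: "f \<in> ?H"
    have eq: "\<And>m. \<ominus> f m = \<zero> \<longleftrightarrow> f m = \<zero>" using f
      by (metis mpoly_mem a_inv_closed minus_minus minus_zero)
    show "\<ominus>\<^bsub>mps R\<^esub> f \<in> ?H"
      using f sub eq by (subst mps_a_inv) (auto simp: mpoly_mem)
  next
    fix f g assume f: "f \<in> ?H" and g: "g \<in> ?H"
    then show "f \<otimes>\<^bsub>mps R\<^esub> g \<in> ?H" by (rule mpoly_mult_closed)
    have "{m. f m \<oplus> g m \<noteq> \<zero>} \<subseteq> {m. f m \<noteq> \<zero>} \<union> {m. g m \<noteq> \<zero>}" by auto
    then have "finite {m. f m \<oplus> g m \<noteq> \<zero>}"
      by (rule finite_subset) (use f g in \<open>auto simp: mpoly_mem\<close>)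
    moreover have "set_mset m \<subseteq> V" if "f m \<oplus> g m \<noteq> \<zero>" for m
      using that f g by (cases "f m = \<zero>") (simp_all add: mpoly_mem)
    ultimately show "f \<oplus>\<^bsub>mps R\<^esub> g \<in> ?H" using f g by (auto simp: mpoly_mem mps_def)
  qed
  then have "subcring ?H (mps R)" by (rule m.subcringI')
  then have "cring ((mps R)\<lparr>carrier := ?H\<rparr>)" using m.subcring_iff[OF sub] by blast
  moreover have "(mps R)\<lparr>carrier := ?H\<rparr> = mpoly R V" by (simp add: mpoly_def)
  ultimately show ?thesis by simp
qed

lemma monom_closed:
  "set_mset a \<subseteq> V \<Longrightarrow> c \<in> carrier R \<Longrightarrow> monom_fun R a c \<in> carrier (mpoly R V)"
  by (auto simp: mpoly_mem monom_fun_def split: if_splits)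

lemma monom_mult:
  assumes "c \<in> carrier R" "d \<in> carrier R"
  shows "monom_fun R a c \<otimes>\<^bsub>mps R\<^esub> monom_fun R b d = monom_fun R (a + b) (c \<otimes> d)"
proof
  fix m
  have *: "{s \<in> {a} \<times> {b}. fst s + snd s = m} = (if m = a + b then {(a, b)} else {})" by auto
  have "(monom_fun R a c \<otimes>\<^bsub>mps R\<^esub> monom_fun R b d) m
    = (\<Oplus>s\<in>{s \<in> {a} \<times> {b}. fst s + snd s = m}. monom_fun R a c (fst s) \<otimes> monom_fun R b d (snd s))"
    by (rule mps_mult_finite) (use assms in \<open>auto simp: monom_fun_def\<close>)
  then show "(monom_fun R a c \<otimes>\<^bsub>mps R\<^esub> monom_fun R b d) m = monom_fun R (a + b) (c \<otimes> d) m"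
    using assms unfolding * by (auto simp: monom_fun_def)
qed

lemma monom_add:
  assumes "c \<in> carrier R" "d \<in> carrier R"
  shows "monom_fun R a c \<oplus>\<^bsub>mps R\<^esub> monom_fun R a d = monom_fun R a (c \<oplus> d)"
  using assms by (auto simp: monom_fun_def mps_def)

lemma mconst_hom: "mconst R \<in> ring_hom R (mpoly R V)"
  by (rule ring_hom_memI)
     (auto simp: mconst_monom monom_mult monom_add monom_closed, auto simp: monom_fun_def mps_def)

lemma mono_eval_superset:
  assumes "finite T" "set_mset m \<subseteq> T" "\<And>v. v \<in> T \<Longrightarrow> \<sigma> v \<in> carrier R"
  shows "mono_eval R \<sigma> m = (\<Otimes>v\<in>T. \<sigma> v [^] count m v)"
  unfolding mono_eval_def
  by (rule finprod_mono_neutral_cong_left) (use assms in \<open>auto simp: not_in_iff\<close>)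

lemma mono_eval_closed [simp]:
  "(\<And>v. v \<in># m \<Longrightarrow> \<sigma> v \<in> carrier R) \<Longrightarrow> mono_eval R \<sigma> m \<in> carrier R"
  by (auto simp: mono_eval_def intro!: finprod_closed)

lemma mono_eval_add:
  assumes "\<And>v. v \<in># m + n \<Longrightarrow> \<sigma> v \<in> carrier R"
  shows "mono_eval R \<sigma> (m + n) = mono_eval R \<sigma> m \<otimes> mono_eval R \<sigma> n"
proof -
  let ?T = "set_mset (m + n)"
  have "mono_eval R \<sigma> (m + n) = (\<Otimes>v\<in>?T. \<sigma> v [^] count m v \<otimes> \<sigma> v [^] count n v)"
    unfolding mono_eval_def
    by (rule finprod_cong') (use assms in \<open>auto simp: nat_pow_mult\<close>)
  also have "\<dots> = (\<Otimes>v\<in>?T. \<sigma> v [^] count m v) \<otimes> (\<Otimes>v\<in>?T. \<sigma> v [^] count n v)"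
    by (rule finprod_multf) (use assms in auto)
  also have "\<dots> = mono_eval R \<sigma> m \<otimes> mono_eval R \<sigma> n"
    using assms by (subst (1 2) mono_eval_superset[of ?T]) auto
  finally show ?thesis .
qed

lemma mono_eval_empty [simp]: "mono_eval R \<sigma> {#} = \<one>"
  by (simp add: mono_eval_def)

lemma mono_eval_single: "\<sigma> v \<in> carrier R \<Longrightarrow> mono_eval R \<sigma> {#v#} = \<sigma> v"
  by (simp add: mono_eval_def)

lemma mono_eval_indet:
  assumes "set_mset m \<subseteq> V"
  shows "mono_eval (mpoly R V) (indet R) m = monom_fun R m \<one>"
proof -
  interpret P: cring "mpoly R V" by (rule mpoly_cring)
  show ?thesis using assms
  proof (induction m)
    case empty
    then show ?case by (auto simp: monom_fun_def mps_def)
  next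
    case (add v m)
    have cl: "indet R w \<in> carrier (mpoly R V)" if "w \<in> V" for w
      using that by (simp add: indet_monom monom_closed)
    have "mono_eval (mpoly R V) (indet R) ({#v#} + m)
      = mono_eval (mpoly R V) (indet R) {#v#} \<otimes>\<^bsub>mpoly R V\<^esub> mono_eval (mpoly R V) (indet R) m"
      by (rule P.mono_eval_add) (use add.prems cl in auto)
    moreover have "mono_eval (mpoly R V) (indet R) {#v#} = monom_fun R {#v#} \<one>"
      using add.prems cl[of v] P.mono_eval_single[of "indet R" v] by (simp add: indet_monom[of R v])
    moreover have "mono_eval (mpoly R V) (indet R) m = monom_fun R m \<one>"
      using add by simp
    ultimately show ?case
      by (simp add: monom_mult)
  qed
qed

lemma mpoly_finsum_apply:
  assumes "f \<in> A \<rightarrow> carrier (mpoly R V)"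
  shows "(\<Oplus>\<^bsub>mpoly R V\<^esub>a\<in>A. f a) k = (\<Oplus>a\<in>A. f a k)"
proof -
  interpret P: cring "mpoly R V" by (rule mpoly_cring)
  show ?thesis using assms
  proof (induction A rule: infinite_finite_induct)
    case (insert a A)
    then have "(\<Oplus>\<^bsub>mpoly R V\<^esub>a\<in>insert a A. f a) = f a \<oplus>\<^bsub>mpoly R V\<^esub> (\<Oplus>\<^bsub>mpoly R V\<^esub>a\<in>A. f a)"
      by (intro P.finsum_insert) auto
    then have "(\<Oplus>\<^bsub>mpoly R V\<^esub>a\<in>insert a A. f a) k = f a k \<oplus> (\<Oplus>a\<in>A. f a k)"
      using insert by (simp add: mps_def)
    also have "\<dots> = (\<Oplus>a\<in>insert a A. f a k)"
      using insert by (intro finsum_insert[symmetric]) (auto simp: mpoly_mem Pi_iff)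
    finally show ?case .
  qed (simp_all add: mps_def)
qed

lemma mpoly_expand:
  assumes p: "p \<in> carrier (mpoly R V)"
  shows "p = (\<Oplus>\<^bsub>mpoly R V\<^esub>m\<in>{m. p m \<noteq> \<zero>}.
    mconst R (p m) \<otimes>\<^bsub>mpoly R V\<^esub> mono_eval (mpoly R V) (indet R) m)"
proof -
  interpret P: cring "mpoly R V" by (rule mpoly_cring)
  let ?S = "{m. p m \<noteq> \<zero>}"
  have S: "finite ?S" and V: "\<And>m. m \<in> ?S \<Longrightarrow> set_mset m \<subseteq> V" and c: "\<And>m. p m \<in> carrier R"
    using p by (auto simp: mpoly_mem)
  have "p = (\<Oplus>\<^bsub>mpoly R V\<^esub>m\<in>?S. monom_fun R m (p m))"
  proof
    fix k
    have "(\<Oplus>\<^bsub>mpoly R V\<^esub>m\<in>?S. monom_fun R m (p m)) k = (\<Oplus>m\<in>?S. monom_fun R m (p m) k)"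
      by (rule mpoly_finsum_apply) (intro Pi_I monom_closed V c)
    also have "\<dots> = (\<Oplus>m\<in>?S. if k = m then p m else \<zero>)" by (simp add: monom_fun_def)
    also have "\<dots> = p k"
    proof (cases "k \<in> ?S")
      case True
      then show ?thesis using S c by (intro add.finprod_singleton) auto
    next
      case False
      then have "(\<Oplus>m\<in>?S. if k = m then p m else \<zero>) = \<zero>"
        by (intro add.finprod_one_eqI) auto
      then show ?thesis using False by simp
    qed
    finally show "p k = (\<Oplus>\<^bsub>mpoly R V\<^esub>m\<in>?S. monom_fun R m (p m)) k" by simp
  qed
  also have "\<dots> = (\<Oplus>\<^bsub>mpoly R V\<^esub>m\<in>?S.
    mconst R (p m) \<otimes>\<^bsub>mpoly R V\<^esub> mono_eval (mpoly R V) (indet R) m)"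
  proof (rule P.add.finprod_cong')
    fix m assume m: "m \<in> ?S"
    show "monom_fun R m (p m) = mconst R (p m) \<otimes>\<^bsub>mpoly R V\<^esub> mono_eval (mpoly R V) (indet R) m"
      using m V c by (simp add: mono_eval_indet mconst_monom monom_mult)
  next
    show "(\<lambda>m. mconst R (p m) \<otimes>\<^bsub>mpoly R V\<^esub> mono_eval (mpoly R V) (indet R) m)
        \<in> ?S \<rightarrow> carrier (mpoly R V)"
    proof (intro Pi_I P.m_closed)
      fix m assume m: "m \<in> ?S"
      show "mconst R (p m) \<in> carrier (mpoly R V)" using c by (simp add: mconst_monom monom_closed)
      show "mono_eval (mpoly R V) (indet R) m \<in> carrier (mpoly R V)"
        using V[OF m] by (simp add: mono_eval_indet monom_closed)
    qed
  qed simp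
  finally show ?thesis .
qed

end

definition poly_eval :: "('r, 'x) ring_scheme \<Rightarrow> ('s, 'y) ring_scheme \<Rightarrow> ('r \<Rightarrow> 's) \<Rightarrow> ('v \<Rightarrow> 's)
    \<Rightarrow> ('v multiset \<Rightarrow> 'r) \<Rightarrow> 's" where
  "poly_eval R S h \<sigma> p = (\<Oplus>\<^bsub>S\<^esub>m\<in>{m. p m \<noteq> \<zero>\<^bsub>R\<^esub>}. h (p m) \<otimes>\<^bsub>S\<^esub> mono_eval S \<sigma> m)"

context cring
begin

lemma finsum_times:
  assumes "finite A" "finite B" "f \<in> A \<rightarrow> carrier R" "g \<in> B \<rightarrow> carrier R"
  shows "(\<Oplus>s\<in>A \<times> B. f (fst s) \<otimes> g (snd s)) = (\<Oplus>a\<in>A. f a) \<otimes> (\<Oplus>b\<in>B. g b)"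
proof -
  have "(\<Oplus>s\<in>A \<times> B. f (fst s) \<otimes> g (snd s))
    = (\<Oplus>a\<in>A. \<Oplus>s\<in>{s \<in> A \<times> B. fst s = a}. f (fst s) \<otimes> g (snd s))"
    by (rule finsum_fibres) (use assms in \<open>auto simp: Pi_iff\<close>)
  also have "\<dots> = (\<Oplus>a\<in>A. f a \<otimes> (\<Oplus>b\<in>B. g b))"
  proof (rule add.finprod_cong')
    show "(\<lambda>a. f a \<otimes> (\<Oplus>b\<in>B. g b)) \<in> A \<rightarrow> carrier R"
      using assms by (auto simp: Pi_iff intro!: finsum_closed)
    fix a assume a: "a \<in> A"
    have "(\<Oplus>s\<in>{s \<in> A \<times> B. fst s = a}. f (fst s) \<otimes> g (snd s)) = (\<Oplus>b\<in>B. f a \<otimes> g b)"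
    proof (rule finsum_bij)
      show "bij_betw (\<lambda>b. (a, b)) B {s \<in> A \<times> B. fst s = a}"
        using a by (auto simp: bij_betw_def inj_on_def)
    qed (use assms in \<open>auto simp: Pi_iff\<close>)
    also have "\<dots> = f a \<otimes> (\<Oplus>b\<in>B. g b)"
      by (rule finsum_rdistr[symmetric]) (use assms a in auto)
    finally show "(\<Oplus>s\<in>{s \<in> A \<times> B. fst s = a}. f (fst s) \<otimes> g (snd s)) = f a \<otimes> (\<Oplus>b\<in>B. g b)" .
  qed simp
  also have "\<dots> = (\<Oplus>a\<in>A. f a) \<otimes> (\<Oplus>b\<in>B. g b)"
    by (rule finsum_ldistr[symmetric]) (use assms in \<open>auto intro!: finsum_closed\<close>)
  finally show ?thesis .
qed

end

context ring_hom_cring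
begin

lemma poly_eval_superset:
  assumes "finite T" "{m. p m \<noteq> \<zero>} \<subseteq> T" "\<And>m. p m \<in> carrier R"
    and "\<And>m v. m \<in> T \<Longrightarrow> v \<in># m \<Longrightarrow> \<sigma> v \<in> carrier S"
  shows "poly_eval R S h \<sigma> p = (\<Oplus>\<^bsub>S\<^esub>m\<in>T. h (p m) \<otimes>\<^bsub>S\<^esub> mono_eval S \<sigma> m)"
  unfolding poly_eval_def
proof (rule S.add.finprod_mono_neutral_cong_left)
  fix m assume "m \<in> T - {m. p m \<noteq> \<zero>}"
  then show "h (p m) \<otimes>\<^bsub>S\<^esub> mono_eval S \<sigma> m = \<zero>\<^bsub>S\<^esub>"
    using S.mono_eval_closed[of m \<sigma>] assms(4) by auto
next
  show "(\<lambda>m. h (p m) \<otimes>\<^bsub>S\<^esub> mono_eval S \<sigma> m) \<in> T \<rightarrow> carrier S"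
    using assms(3,4) by (intro Pi_I S.m_closed S.mono_eval_closed hom_closed) auto
qed (use assms in auto)

lemma poly_eval_hom:
  assumes \<sigma>: "\<And>v. v \<in> V \<Longrightarrow> \<sigma> v \<in> carrier S"
  shows "poly_eval R S h \<sigma> \<in> ring_hom (mpoly R V) S"
proof (rule ring_hom_memI)
  have mc: "mono_eval S \<sigma> m \<in> carrier S" if "set_mset m \<subseteq> V" for m
    using that \<sigma> by (intro S.mono_eval_closed) auto
  fix p assume p: "p \<in> carrier (mpoly R V)"
  show "poly_eval R S h \<sigma> p \<in> carrier S"
    unfolding poly_eval_def using p mc
    by (intro S.finsum_closed Pi_I S.m_closed hom_closed) (auto simp: mpoly_mem)
next
  have mc: "mono_eval S \<sigma> m \<in> carrier S" if "set_mset m \<subseteq> V" for m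
    using that \<sigma> by (intro S.mono_eval_closed) auto
  fix p q assume p: "p \<in> carrier (mpoly R V)" and q: "q \<in> carrier (mpoly R V)"
  interpret P: cring "mpoly R V" by (rule R.mpoly_cring)
  let ?A = "{m. p m \<noteq> \<zero>}" and ?B = "{m. q m \<noteq> \<zero>}"
  have fin: "finite ?A" "finite ?B" and c: "\<And>m. p m \<in> carrier R" "\<And>m. q m \<in> carrier R"
    and V: "\<And>m. m \<in> ?A \<Longrightarrow> set_mset m \<subseteq> V" "\<And>m. m \<in> ?B \<Longrightarrow> set_mset m \<subseteq> V"
    using p q by (auto simp: mpoly_mem)
  show "poly_eval R S h \<sigma> (p \<oplus>\<^bsub>mpoly R V\<^esub> q) = poly_eval R S h \<sigma> p \<oplus>\<^bsub>S\<^esub> poly_eval R S h \<sigma> q"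
  proof -
    let ?T = "?A \<union> ?B"
    have T: "finite ?T" and VT: "\<And>m. m \<in> ?T \<Longrightarrow> set_mset m \<subseteq> V" using fin V by blast+
    have \<sigma>T: "\<And>m v. m \<in> ?T \<Longrightarrow> v \<in># m \<Longrightarrow> \<sigma> v \<in> carrier S" using VT \<sigma> by blast
    have pq: "(p \<oplus>\<^bsub>mpoly R V\<^esub> q) m = p m \<oplus> q m" for m by (simp add: mps_def)
    have e: "poly_eval R S h \<sigma> r = (\<Oplus>\<^bsub>S\<^esub>m\<in>?T. h (r m) \<otimes>\<^bsub>S\<^esub> mono_eval S \<sigma> m)"
      if "{m. r m \<noteq> \<zero>} \<subseteq> ?T" "\<And>m. r m \<in> carrier R" for r
      using T that \<sigma>T by (rule poly_eval_superset)
    have "poly_eval R S h \<sigma> (p \<oplus>\<^bsub>mpoly R V\<^esub> q)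
      = (\<Oplus>\<^bsub>S\<^esub>m\<in>?T. h (p m \<oplus> q m) \<otimes>\<^bsub>S\<^esub> mono_eval S \<sigma> m)"
      unfolding pq[symmetric] by (rule e) (use c in \<open>auto simp: mps_def\<close>)
    also have "\<dots> = (\<Oplus>\<^bsub>S\<^esub>m\<in>?T. h (p m) \<otimes>\<^bsub>S\<^esub> mono_eval S \<sigma> m \<oplus>\<^bsub>S\<^esub> h (q m) \<otimes>\<^bsub>S\<^esub> mono_eval S \<sigma> m)"
    proof (rule S.add.finprod_cong')
      show "(\<lambda>m. h (p m) \<otimes>\<^bsub>S\<^esub> mono_eval S \<sigma> m \<oplus>\<^bsub>S\<^esub> h (q m) \<otimes>\<^bsub>S\<^esub> mono_eval S \<sigma> m) \<in> ?T \<rightarrow> carrier S"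
        by (intro Pi_I S.a_closed S.m_closed hom_closed c mc VT)
    next
      fix m assume "m \<in> ?T"
      then show "h (p m \<oplus> q m) \<otimes>\<^bsub>S\<^esub> mono_eval S \<sigma> m
        = h (p m) \<otimes>\<^bsub>S\<^esub> mono_eval S \<sigma> m \<oplus>\<^bsub>S\<^esub> h (q m) \<otimes>\<^bsub>S\<^esub> mono_eval S \<sigma> m"
        using mc[OF VT] c by (simp add: S.l_distr)
    qed simp
    also have "\<dots> = poly_eval R S h \<sigma> p \<oplus>\<^bsub>S\<^esub> poly_eval R S h \<sigma> q"
      unfolding e[of p, OF _ c(1), OF Un_upper1] e[of q, OF _ c(2), OF Un_upper2]
      by (rule S.finsum_addf) (intro Pi_I S.m_closed hom_closed c mc VT; assumption)+
    finally show ?thesis .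
  qed
  show "poly_eval R S h \<sigma> (p \<otimes>\<^bsub>mpoly R V\<^esub> q) = poly_eval R S h \<sigma> p \<otimes>\<^bsub>S\<^esub> poly_eval R S h \<sigma> q"
  proof -
    let ?T = "(\<lambda>s. fst s + snd s) ` (?A \<times> ?B)"
    let ?N = "\<lambda>m. {s \<in> ?A \<times> ?B. fst s + snd s = m}"
    let ?t = "\<lambda>s. (h (p (fst s)) \<otimes>\<^bsub>S\<^esub> mono_eval S \<sigma> (fst s)) \<otimes>\<^bsub>S\<^esub> (h (q (snd s)) \<otimes>\<^bsub>S\<^esub> mono_eval S \<sigma> (snd s))"
    have T: "finite ?T" using fin by simp
    have VT: "\<And>m. m \<in> ?T \<Longrightarrow> set_mset m \<subseteq> V"
    proof -
      fix m assume "m \<in> ?T"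
      then obtain s where "s \<in> ?A \<times> ?B" "m = fst s + snd s" by blast
      then show "set_mset m \<subseteq> V" using V(1)[of "fst s"] V(2)[of "snd s"] by auto
    qed
    have \<sigma>T: "\<And>m v. m \<in> ?T \<Longrightarrow> v \<in># m \<Longrightarrow> \<sigma> v \<in> carrier S" using VT \<sigma> by blast
    have pq: "(p \<otimes>\<^bsub>mps R\<^esub> q) m = (\<Oplus>s\<in>?N m. p (fst s) \<otimes> q (snd s))" for m
      by (rule R.mps_mult_finite[OF c fin]) auto
    have tcl: "?t s \<in> carrier S" if "s \<in> ?A \<times> ?B" for s
      by (intro S.m_closed hom_closed c mc V) (use that in auto)
    have supp: "{m. (p \<otimes>\<^bsub>mps R\<^esub> q) m \<noteq> \<zero>} \<subseteq> ?T"
    proof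
      fix m assume "m \<in> {m. (p \<otimes>\<^bsub>mps R\<^esub> q) m \<noteq> \<zero>}"
      then have nz: "(p \<otimes>\<^bsub>mps R\<^esub> q) m \<noteq> \<zero>" by blast
      show "m \<in> ?T"
      proof (rule ccontr)
        assume "m \<notin> ?T"
        then have e: "?N m = {}" by blast
        show False using nz pq[of m] by (simp only: e R.finsum_empty) simp
      qed
    qed
    have "poly_eval R S h \<sigma> (p \<otimes>\<^bsub>mpoly R V\<^esub> q)
      = (\<Oplus>\<^bsub>S\<^esub>m\<in>?T. h ((p \<otimes>\<^bsub>mps R\<^esub> q) m) \<otimes>\<^bsub>S\<^esub> mono_eval S \<sigma> m)"
      unfolding mpoly_ops
      by (rule poly_eval_superset[OF T supp _ \<sigma>T]) (use R.mpoly_mult_closed[OF p q] in \<open>auto simp: mpoly_mem\<close>)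
    also have "\<dots> = (\<Oplus>\<^bsub>S\<^esub>m\<in>?T. \<Oplus>\<^bsub>S\<^esub>s\<in>?N m. ?t s)"
    proof (rule S.add.finprod_cong')
      show "(\<lambda>m. \<Oplus>\<^bsub>S\<^esub>s\<in>?N m. ?t s) \<in> ?T \<rightarrow> carrier S"
        by (intro Pi_I S.finsum_closed tcl) simp
      fix m assume m: "m \<in> ?T"
      have "h ((p \<otimes>\<^bsub>mps R\<^esub> q) m) = (\<Oplus>\<^bsub>S\<^esub>s\<in>?N m. (h \<circ> (\<lambda>s. p (fst s) \<otimes> q (snd s))) s)"
        unfolding pq by (rule hom_finsum) (use c in auto)
      also have "\<dots> = (\<Oplus>\<^bsub>S\<^esub>s\<in>?N m. h (p (fst s)) \<otimes>\<^bsub>S\<^esub> h (q (snd s)))"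
        by (rule S.add.finprod_cong') (use c in auto)
      finally have "h ((p \<otimes>\<^bsub>mps R\<^esub> q) m) \<otimes>\<^bsub>S\<^esub> mono_eval S \<sigma> m
        = (\<Oplus>\<^bsub>S\<^esub>s\<in>?N m. h (p (fst s)) \<otimes>\<^bsub>S\<^esub> h (q (snd s))) \<otimes>\<^bsub>S\<^esub> mono_eval S \<sigma> m" by simp
      also have "\<dots> = (\<Oplus>\<^bsub>S\<^esub>s\<in>?N m. h (p (fst s)) \<otimes>\<^bsub>S\<^esub> h (q (snd s)) \<otimes>\<^bsub>S\<^esub> mono_eval S \<sigma> m)"
        by (rule S.finsum_ldistr) (use c mc[OF VT[OF m]] fin in auto)
      also have "\<dots> = (\<Oplus>\<^bsub>S\<^esub>s\<in>?N m. ?t s)"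
      proof (rule S.add.finprod_cong')
        show "?t \<in> ?N m \<rightarrow> carrier S" by (intro Pi_I tcl) simp
        fix s assume s: "s \<in> ?N m"
        have fm: "fst s + snd s = m" using s by simp
        have "mono_eval S \<sigma> m = mono_eval S \<sigma> (fst s) \<otimes>\<^bsub>S\<^esub> mono_eval S \<sigma> (snd s)"
          using S.mono_eval_add[of "fst s" "snd s" \<sigma>] \<sigma>T[OF m] unfolding fm by blast
        moreover have "mono_eval S \<sigma> (fst s) \<in> carrier S" "mono_eval S \<sigma> (snd s) \<in> carrier S"
          using s mc V by auto
        moreover have "h (p (fst s)) \<in> carrier S" "h (q (snd s)) \<in> carrier S" using c by auto
        ultimately show "h (p (fst s)) \<otimes>\<^bsub>S\<^esub> h (q (snd s)) \<otimes>\<^bsub>S\<^esub> mono_eval S \<sigma> m = ?t s"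
          by (simp only: S.m_ac S.m_closed)
      qed simp
      finally show "h ((p \<otimes>\<^bsub>mps R\<^esub> q) m) \<otimes>\<^bsub>S\<^esub> mono_eval S \<sigma> m = (\<Oplus>\<^bsub>S\<^esub>s\<in>?N m. ?t s)" .
    qed simp
    also have "\<dots> = (\<Oplus>\<^bsub>S\<^esub>s\<in>?A \<times> ?B. ?t s)"
      by (rule S.finsum_fibres[symmetric]) (use fin T in simp, rule T, blast, intro Pi_I tcl)
    also have "\<dots> = poly_eval R S h \<sigma> p \<otimes>\<^bsub>S\<^esub> poly_eval R S h \<sigma> q"
      unfolding poly_eval_def
      by (rule S.finsum_times[OF fin, of "\<lambda>m. h (p m) \<otimes>\<^bsub>S\<^esub> mono_eval S \<sigma> m"
          "\<lambda>m. h (q m) \<otimes>\<^bsub>S\<^esub> mono_eval S \<sigma> m"])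
         (intro Pi_I S.m_closed hom_closed c mc V; assumption)+
    finally show ?thesis .
  qed
next
  have "poly_eval R S h \<sigma> \<one>\<^bsub>mpoly R V\<^esub> =
    (\<Oplus>\<^bsub>S\<^esub>m\<in>{{#}}. h (\<one>\<^bsub>mpoly R V\<^esub> m) \<otimes>\<^bsub>S\<^esub> mono_eval S \<sigma> m)"
    by (rule poly_eval_superset) (auto simp: mps_def)
  then show "poly_eval R S h \<sigma> \<one>\<^bsub>mpoly R V\<^esub> = \<one>\<^bsub>S\<^esub>"
    by (simp add: mps_def)
qed

lemma poly_eval_mconst:
  assumes "c \<in> carrier R"
  shows "poly_eval R S h \<sigma> (mconst R c) = h c"
proof -
  have "poly_eval R S h \<sigma> (mconst R c) =
    (\<Oplus>\<^bsub>S\<^esub>m\<in>{{#}}. h (mconst R c m) \<otimes>\<^bsub>S\<^esub> mono_eval S \<sigma> m)"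
    by (rule poly_eval_superset) (use assms in \<open>auto simp: mconst_def\<close>)
  then show ?thesis using assms by (simp add: mconst_def)
qed

lemma poly_eval_indet:
  assumes "\<sigma> v \<in> carrier S"
  shows "poly_eval R S h \<sigma> (indet R v) = \<sigma> v"
proof -
  have "poly_eval R S h \<sigma> (indet R v) =
    (\<Oplus>\<^bsub>S\<^esub>m\<in>{{#v#}}. h (indet R v m) \<otimes>\<^bsub>S\<^esub> mono_eval S \<sigma> m)"
    by (rule poly_eval_superset) (use assms in \<open>auto simp: indet_def\<close>)
  then show ?thesis using assms by (simp add: indet_def S.mono_eval_single)
qed

lemma hom_mono_eval:
  assumes "\<And>v. v \<in># m \<Longrightarrow> \<tau> v \<in> carrier R"
  shows "h (mono_eval R \<tau> m) = mono_eval S (\<lambda>v. h (\<tau> v)) m"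
proof -
  have "h (mono_eval R \<tau> m) = (\<Otimes>\<^bsub>S\<^esub>v\<in>set_mset m. (h \<circ> (\<lambda>v. \<tau> v [^] count m v)) v)"
    unfolding mono_eval_def by (rule hom_finprod) (use assms in auto)
  also have "\<dots> = mono_eval S (\<lambda>v. h (\<tau> v)) m"
    unfolding mono_eval_def
    by (rule S.finprod_cong') (use assms in \<open>auto simp: ring.hom_nat_pow\<close>)
  finally show ?thesis .
qed

end

lemma poly_hom_unique:
  assumes "cring R" "cring S" and g: "g \<in> ring_hom (mpoly R V) S" and g': "g' \<in> ring_hom (mpoly R V) S"
    and const: "\<And>c. c \<in> carrier R \<Longrightarrow> g (mconst R c) = g' (mconst R c)"
    and indet: "\<And>v. v \<in> V \<Longrightarrow> g (indet R v) = g' (indet R v)"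
    and p: "p \<in> carrier (mpoly R V)"
  shows "g p = g' p"
proof -
  interpret R: cring R by fact
  interpret g: ring_hom_cring "mpoly R V" S g
    using R.mpoly_cring assms(2) g by (simp add: ring_hom_cring_def ring_hom_cring_axioms_def)
  interpret g': ring_hom_cring "mpoly R V" S g'
    using R.mpoly_cring assms(2) g' by (simp add: ring_hom_cring_def ring_hom_cring_axioms_def)
  have cl: "indet R w \<in> carrier (mpoly R V)" if "w \<in> V" for w
    using that by (simp add: indet_monom R.monom_closed)
  have V: "\<And>m v. p m \<noteq> \<zero>\<^bsub>R\<^esub> \<Longrightarrow> v \<in># m \<Longrightarrow> v \<in> V" and c: "\<And>m. p m \<in> carrier R"
    using p by (auto simp: mpoly_mem)
  let ?S = "{m. p m \<noteq> \<zero>\<^bsub>R\<^esub>}"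
  let ?t = "\<lambda>m. mconst R (p m) \<otimes>\<^bsub>mpoly R V\<^esub> mono_eval (mpoly R V) (indet R) m"
  have cc: "mconst R (p m) \<in> carrier (mpoly R V)" for m
    using c by (simp add: mconst_monom R.monom_closed)
  have mcl: "mono_eval (mpoly R V) (indet R) m \<in> carrier (mpoly R V)" if "m \<in> ?S" for m
    using that V cl by (intro g.R.mono_eval_closed) auto
  have tcl: "?t \<in> ?S \<rightarrow> carrier (mpoly R V)"
    by (intro Pi_I g.R.m_closed cc mcl)
  have t: "g (?t m) = g' (?t m)" if m: "m \<in> ?S" for m
  proof -
    have "mono_eval S (\<lambda>v. g (indet R v)) m = mono_eval S (\<lambda>v. g' (indet R v)) m"
      unfolding mono_eval_def
      by (rule g.S.finprod_cong') (use m V indet cl g'.hom_closed in auto)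
    then have "g (mono_eval (mpoly R V) (indet R) m) = g' (mono_eval (mpoly R V) (indet R) m)"
      using m V cl by (subst g.hom_mono_eval, blast, subst g'.hom_mono_eval, blast) simp
    then show ?thesis using cc mcl[OF m] const c by (simp del: mpoly_ops)
  qed
  have "g (finsum (mpoly R V) ?t ?S) = g' (finsum (mpoly R V) ?t ?S)"
    unfolding g.hom_finsum[OF tcl] g'.hom_finsum[OF tcl]
    by (rule g.S.add.finprod_cong') (use t funcset_mem[OF tcl, THEN g'.hom_closed] in \<open>auto simp del: mpoly_ops\<close>)
  then show ?thesis using R.mpoly_expand[OF p] by simp
qed


section \<open>The classifying ring corepresents formal modules\<close>

lemma module_eqns_cong:
  assumes "cring B" "\<And>b. b \<in> carrier B \<Longrightarrow> \<phi> b = \<phi>' b" "\<And>b. b \<in> carrier B \<Longrightarrow> \<rho> b = \<rho>' b"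
  shows "module_eqns B R \<phi> F \<rho> = module_eqns B R \<phi>' F \<rho>'"
proof -
  interpret cring B by fact
  show ?thesis unfolding module_eqns_def Let_def
    by (simp add: assms(2,3) cong: image_cong SUP_cong)
qed

lemma (in cring) module_eqns_closed:
  assumes "cring B" "\<And>i j. F i j \<in> carrier R" "\<And>b i. b \<in> carrier B \<Longrightarrow> \<rho> b i \<in> carrier R"
    and "\<And>b. b \<in> carrier B \<Longrightarrow> \<phi> b \<in> carrier R" and "e \<in> module_eqns B R \<phi> F \<rho>"
  shows "fst e \<in> carrier R" "snd e \<in> carrier R"
proof -
  interpret B: cring B by fact
  have "module_eqns B R \<phi> F \<rho> \<subseteq> carrier R \<times> carrier R"
    unfolding module_eqns_def Let_def
    by (intro Un_least UN_least image_subsetI)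
       (auto intro!: mps_memD subst2_closed subst1_closed assms(2,3,4) indet_closed mps_zero_closed)
  then show "fst e \<in> carrier R" "snd e \<in> carrier R" using assms(5) by auto
qed

lemma formal_module_closed:
  assumes "formal_module B R \<phi> F \<rho>"
  shows "F i j \<in> carrier R" "b \<in> carrier B \<Longrightarrow> \<rho> b i \<in> carrier R"
    "b \<in> carrier B \<Longrightarrow> \<rho> b 0 = \<zero>\<^bsub>R\<^esub>" "b \<in> carrier B \<Longrightarrow> \<phi> b \<in> carrier R"
  using assms
  by (auto simp: formal_module_def formal_group_law_def ring_hom_def fgl_End_def Let_def)

lemma gen_poly_cring: "cring B \<Longrightarrow> cring (gen_poly B)"
  by (rule cring.mpoly_cring)

lemma gen_poly_closed:
  assumes "cring B"
  shows "b \<in> carrier B \<Longrightarrow> mconst B b \<in> carrier (gen_poly B)"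
    and "indet B (Alpha i j) \<in> carrier (gen_poly B)"
    and "b \<in> carrier B \<Longrightarrow> rho_poly B b i \<in> carrier (gen_poly B)"
proof -
  interpret cring B by fact
  interpret P: cring "gen_poly B" by (rule mpoly_cring)
  show "b \<in> carrier B \<Longrightarrow> mconst B b \<in> carrier (gen_poly B)"
    by (simp add: mconst_monom monom_closed)
  show "indet B (Alpha i j) \<in> carrier (gen_poly B)"
    unfolding indet_monom by (rule monom_closed) (auto simp: gens_def)
  show "b \<in> carrier B \<Longrightarrow> rho_poly B b i \<in> carrier (gen_poly B)"
    unfolding rho_poly_def indet_monom
    by (auto simp del: mpoly_ops intro!: monom_closed) (auto simp: gens_def)
qed

definition gen_eqns where
  "gen_eqns B = module_eqns B (gen_poly B) (mconst B) (\<lambda>i j. indet B (Alpha i j)) (rho_poly B)"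

lemma gen_eqns_closed:
  assumes "cring B" "e \<in> gen_eqns B"
  shows "fst e \<in> carrier (gen_poly B)" "snd e \<in> carrier (gen_poly B)"
  using cring.module_eqns_closed[OF gen_poly_cring[OF assms(1)] assms(1)
      gen_poly_closed(2,3,1)[OF assms(1)] assms(2)[unfolded gen_eqns_def]] by auto

lemma formal_module_quot_iff:
  assumes "cring B" "ideal J (gen_poly B)"
  shows "formal_module B (gen_poly B Quot J)
       (\<lambda>b. J +>\<^bsub>gen_poly B\<^esub> mconst B b)
       (\<lambda>i j. J +>\<^bsub>gen_poly B\<^esub> indet B (Alpha i j))
       (\<lambda>b i. J +>\<^bsub>gen_poly B\<^esub> rho_poly B b i) \<longleftrightarrow>
     (\<forall>e\<in>gen_eqns B. fst e \<ominus>\<^bsub>gen_poly B\<^esub> snd e \<in> J)"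
proof -
  interpret B: cring B by fact
  interpret P: cring "gen_poly B" by (rule gen_poly_cring[OF assms(1)])
  interpret J: ideal J "gen_poly B" by fact
  let ?q = "\<lambda>p. J +>\<^bsub>gen_poly B\<^esub> p"
  interpret q: ring_hom_cring "gen_poly B" "gen_poly B Quot J" ?q
    using J.rcos_ring_hom_cring[OF P.is_cring] .
  note cl = gen_poly_closed[OF assms(1)]
  have hom: "(\<lambda>b. ?q (mconst B b)) \<in> ring_hom B (gen_poly B Quot J)"
    using ring_hom_trans[OF B.mconst_hom q.homh] by (simp add: comp_def)
  have zero: "?q (rho_poly B b 0) = \<zero>\<^bsub>gen_poly B Quot J\<^esub>" for b
    unfolding rho_poly_def using q.hom_zero by (simp del: mpoly_ops)
  have "formal_module B (gen_poly B Quot J) (\<lambda>b. ?q (mconst B b)) (\<lambda>i j. ?q (indet B (Alpha i j)))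
      (\<lambda>b i. ?q (rho_poly B b i)) \<longleftrightarrow> (\<forall>e\<in>map_prod ?q ?q ` gen_eqns B. fst e = snd e)"
    unfolding gen_eqns_def
    using q.S.formal_module_iff_eqns[of "\<lambda>i j. ?q (indet B (Alpha i j))" B
        "\<lambda>b i. ?q (rho_poly B b i)" "\<lambda>b. ?q (mconst B b)"] hom cl zero assms(1)
    by (subst q.map_module_eqns[symmetric]) (auto simp del: mpoly_ops)
  also have "\<dots> \<longleftrightarrow> (\<forall>e\<in>gen_eqns B. fst e \<ominus>\<^bsub>gen_poly B\<^esub> snd e \<in> J)"
    using gen_eqns_closed[OF assms(1)] P.quotient_eq_iff_same_a_r_cos[OF assms(2)] by auto
  finally show ?thesis .
qed

lemma formal_module_ideal_eq:
  assumes "cring B"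
  shows "formal_module_ideal B
    = \<Inter>{J. ideal J (gen_poly B) \<and> (\<forall>e\<in>gen_eqns B. fst e \<ominus>\<^bsub>gen_poly B\<^esub> snd e \<in> J)}"
  unfolding formal_module_ideal_def using formal_module_quot_iff[OF assms]
  by (intro arg_cong[where f = Inter]) auto

lemma formal_module_ideal_ideal:
  assumes "cring B"
  shows "ideal (formal_module_ideal B) (gen_poly B)"
proof -
  interpret P: cring "gen_poly B" by (rule gen_poly_cring[OF assms(1)])
  have "carrier (gen_poly B) \<in>
      {J. ideal J (gen_poly B) \<and> (\<forall>e\<in>gen_eqns B. fst e \<ominus>\<^bsub>gen_poly B\<^esub> snd e \<in> J)}"
    using gen_eqns_closed[OF assms] P.oneideal by (auto simp del: mpoly_ops)
  then show ?thesis unfolding formal_module_ideal_eq[OF assms]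
    by (intro P.i_Intersect) auto
qed

lemma L_ring_cring: "cring B \<Longrightarrow> cring (L_ring B)"
  unfolding L_ring_def by (intro ideal.quotient_is_cring formal_module_ideal_ideal gen_poly_cring)

lemma L_class_hom: "cring B \<Longrightarrow> L_class B \<in> ring_hom (gen_poly B) (L_ring B)"
  unfolding L_ring_def L_class_def[abs_def]
  by (intro ideal.rcos_ring_hom formal_module_ideal_ideal)

theorem universal_formal_module:
  assumes "cring B"
  shows "formal_module B (L_ring B) (L_unit B) (L_alpha B) (L_rho B)"
  unfolding L_ring_def L_unit_def[abs_def] L_alpha_def[abs_def] L_rho_def[abs_def] L_class_def
  using formal_module_quot_iff[OF assms formal_module_ideal_ideal[OF assms]]
  by (auto simp: formal_module_ideal_eq[OF assms])

theorem classify_exists: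
  assumes "formal_module B R \<phi> F \<rho>"
  shows "\<exists>h\<in>ring_hom (L_ring B) R. (\<forall>b\<in>carrier B. h (L_unit B b) = \<phi> b) \<and>
    (\<forall>i j. h (L_alpha B i j) = F i j) \<and> (\<forall>b\<in>carrier B. \<forall>i. h (L_rho B b i) = \<rho> b i)"
proof -
  have B: "cring B" and R: "cring R" and \<phi>: "\<phi> \<in> ring_hom B R"
    using assms by (auto simp: formal_module_def)
  interpret \<phi>: ring_hom_cring B R \<phi>
    using B R \<phi> by (simp add: ring_hom_cring_def ring_hom_cring_axioms_def)
  interpret P: cring "gen_poly B" by (rule gen_poly_cring[OF B])
  note cl = gen_poly_closed[OF B]
  note rcl = formal_module_closed[OF assms]
  define \<sigma> where "\<sigma> = (\<lambda>Alpha i j \<Rightarrow> F i j | Rho b i \<Rightarrow> \<rho> b i)"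
  define ev where "ev = poly_eval B R \<phi> \<sigma>"
  have \<sigma>: "\<sigma> v \<in> carrier R" if "v \<in> gens B" for v
    using that rcl by (auto simp: gens_def \<sigma>_def)
  interpret ev: ring_hom_cring "gen_poly B" R ev
    using P.is_cring R \<phi>.poly_eval_hom[of "gens B" \<sigma>] \<sigma>
    by (simp add: ring_hom_cring_def ring_hom_cring_axioms_def ev_def)
  have ev_const: "ev (mconst B b) = \<phi> b" if "b \<in> carrier B" for b
    using that by (simp add: ev_def \<phi>.poly_eval_mconst)
  have ev_alpha: "ev (indet B (Alpha i j)) = F i j" for i j
    using \<phi>.poly_eval_indet[of \<sigma> "Alpha i j"] rcl(1) by (simp add: ev_def \<sigma>_def)
  have ev_rho: "ev (rho_poly B b i) = \<rho> b i" if "b \<in> carrier B" for b i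
  proof (cases "i = 0")
    case True
    then show ?thesis using rcl(3)[OF that] ev.hom_zero by (simp add: rho_poly_def)
  next
    case False
    then show ?thesis
      using \<phi>.poly_eval_indet[of \<sigma> "Rho b i"] rcl(2)[OF that]
      by (simp add: ev_def \<sigma>_def rho_poly_def)
  qed
  define K where "K = a_kernel (gen_poly B) R ev"
  have K: "ideal K (gen_poly B)" unfolding K_def by (rule ev.ring.kernel_is_ideal)
  have eqns: "module_eqns B R \<phi> F \<rho> = map_prod ev ev ` gen_eqns B"
  proof -
    have "map_prod ev ev ` gen_eqns B
      = module_eqns B R (\<lambda>b. ev (mconst B b)) (\<lambda>i j. ev (indet B (Alpha i j))) (\<lambda>b i. ev (rho_poly B b i))"
      unfolding gen_eqns_def by (rule ev.map_module_eqns[symmetric]) (use cl in auto)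
    also have "\<dots> = module_eqns B R \<phi> F \<rho>"
      unfolding ev_alpha by (rule module_eqns_cong[OF B]) (simp_all add: ev_const ev_rho)
    finally show ?thesis by simp
  qed
  have "fst e \<ominus>\<^bsub>gen_poly B\<^esub> snd e \<in> K" if e: "e \<in> gen_eqns B" for e
  proof -
    note ecl = gen_eqns_closed[OF B e]
    have "\<forall>e\<in>module_eqns B R \<phi> F \<rho>. fst e = snd e"
      using assms cring.formal_module_iff_eqns[OF R, of F B \<rho> \<phi>] rcl by blast
    then have "ev (fst e) = ev (snd e)" using e eqns by force
    then have "ev (fst e \<ominus>\<^bsub>gen_poly B\<^esub> snd e) = \<zero>\<^bsub>R\<^esub>"
      using ecl by (simp add: a_minus_def ring.ring_simprules(16)[OF cring.axioms(1)[OF R]] del: mpoly_ops)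
    moreover have "fst e \<ominus>\<^bsub>gen_poly B\<^esub> snd e \<in> carrier (gen_poly B)"
      using ecl by (rule P.minus_closed)
    ultimately show ?thesis unfolding K_def a_kernel_def' by blast
  qed
  then have sub: "formal_module_ideal B \<subseteq> K"
    using K by (auto simp: formal_module_ideal_eq[OF B])
  interpret J: ideal "formal_module_ideal B" "gen_poly B" by (rule formal_module_ideal_ideal[OF B])
  define h where "h = (\<lambda>X. the_elem (ev ` X))"
  have h: "h (L_class B p) = ev p" if p: "p \<in> carrier (gen_poly B)" for p
  proof -
    have "ev x = ev p" if x: "x \<in> L_class B p" for x
    proof -
      obtain k where k: "k \<in> formal_module_ideal B" "x = k \<oplus>\<^bsub>gen_poly B\<^esub> p"
        using x unfolding L_class_def a_r_coset_def' by blast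
      then have "ev k = \<zero>\<^bsub>R\<^esub>" "k \<in> carrier (gen_poly B)"
        using subsetD[OF sub k(1)] unfolding K_def a_kernel_def' by blast+
      then show ?thesis unfolding k(2) using p by (simp only: ev.hom_add \<phi>.S.l_zero ev.hom_closed)
    qed
    moreover have "p \<in> L_class B p" unfolding L_class_def using p by (rule J.a_rcos_self)
    ultimately have "ev ` L_class B p = {ev p}" by blast
    then show ?thesis by (simp add: h_def)
  qed
  have surj: "\<exists>p\<in>carrier (gen_poly B). X = L_class B p" if "X \<in> carrier (L_ring B)" for X
    using that by (auto simp: L_ring_def FactRing_def A_RCOSETS_def' L_class_def)
  note Lh = ring_hom_memE[OF L_class_hom[OF B]]
  have "h \<in> ring_hom (L_ring B) R"
  proof (rule ring_hom_memI)
    fix X assume "X \<in> carrier (L_ring B)"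
    then show "h X \<in> carrier R" using surj h by force
  next
    fix X Y assume "X \<in> carrier (L_ring B)" "Y \<in> carrier (L_ring B)"
    then obtain p q where p: "p \<in> carrier (gen_poly B)" "X = L_class B p"
      and q: "q \<in> carrier (gen_poly B)" "Y = L_class B q" using surj by metis
    show "h (X \<otimes>\<^bsub>L_ring B\<^esub> Y) = h X \<otimes>\<^bsub>R\<^esub> h Y"
      unfolding p(2) q(2) Lh(2)[OF p(1) q(1), symmetric]
      by (simp only: h p(1) q(1) P.m_closed ev.hom_mult)
    show "h (X \<oplus>\<^bsub>L_ring B\<^esub> Y) = h X \<oplus>\<^bsub>R\<^esub> h Y"
      unfolding p(2) q(2) Lh(3)[OF p(1) q(1), symmetric]
      by (simp only: h p(1) q(1) P.a_closed ev.hom_add)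
  next
    show "h \<one>\<^bsub>L_ring B\<^esub> = \<one>\<^bsub>R\<^esub>" 
      unfolding Lh(4)[symmetric] by (simp only: h P.one_closed ev.hom_one)
  qed
  moreover have "\<forall>b\<in>carrier B. h (L_unit B b) = \<phi> b"
    using cl by (simp add: L_unit_def h ev_const)
  moreover have "\<forall>i j. h (L_alpha B i j) = F i j"
    using cl by (simp add: L_alpha_def h ev_alpha)
  moreover have "\<forall>b\<in>carrier B. \<forall>i. h (L_rho B b i) = \<rho> b i"
    using cl by (simp add: L_rho_def h ev_rho)
  ultimately show ?thesis by blast
qed

theorem classify_unique:
  assumes "cring B" "cring R" "h \<in> ring_hom (L_ring B) R" "h' \<in> ring_hom (L_ring B) R"
    and "\<And>b. b \<in> carrier B \<Longrightarrow> h (L_unit B b) = h' (L_unit B b)"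
    and "\<And>i j. h (L_alpha B i j) = h' (L_alpha B i j)"
    and "\<And>b i. b \<in> carrier B \<Longrightarrow> h (L_rho B b i) = h' (L_rho B b i)"
    and x: "x \<in> carrier (L_ring B)"
  shows "h x = h' x"
proof -
  obtain p where p: "p \<in> carrier (gen_poly B)" "x = L_class B p"
    using x by (auto simp: L_ring_def FactRing_def A_RCOSETS_def' L_class_def)
  have "(h \<circ> L_class B) p = (h' \<circ> L_class B) p"
  proof (rule poly_hom_unique[OF assms(1,2) _ _ _ _ p(1)])
    show "h \<circ> L_class B \<in> ring_hom (gen_poly B) R" "h' \<circ> L_class B \<in> ring_hom (gen_poly B) R"
      using ring_hom_trans L_class_hom assms(1,3,4) by blast+
    show "(h \<circ> L_class B) (mconst B c) = (h' \<circ> L_class B) (mconst B c)" if "c \<in> carrier B" for c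
      using assms(5)[OF that] by (simp add: L_unit_def)
    show "(h \<circ> L_class B) (indet B v) = (h' \<circ> L_class B) (indet B v)" if v: "v \<in> gens B" for v
    proof -
      consider i j where "v = Alpha i j" | b i where "v = Rho b i" "b \<in> carrier B" "i \<ge> 1"
        using v by (auto simp: gens_def)
      then show ?thesis
      proof cases
        case 1
        then show ?thesis using assms(6) by (simp add: L_alpha_def)
      next
        case 2
        then show ?thesis using assms(7)[of b i] by (simp add: L_rho_def rho_poly_def)
      qed
    qed
  qed
  then show ?thesis using p(2) by simp
qed


section \<open>The localization is a ring\<close>

lemma UN_UN_const:
  assumes "\<And>p q. p \<in> X \<Longrightarrow> q \<in> Y \<Longrightarrow> f p q = C" "X \<noteq> {}" "Y \<noteq> {}"
  shows "(\<Union>p\<in>X. \<Union>q\<in>Y. f p q) = C"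
  using assms by simp

locale mult_subset = cring +
  fixes S
  assumes S_carrier: "S \<subseteq> carrier R" and one_S: "\<one> \<in> S"
    and mult_S: "\<And>s t. s \<in> S \<Longrightarrow> t \<in> S \<Longrightarrow> s \<otimes> t \<in> S"
begin

lemma S_cl [simp]: "s \<in> S \<Longrightarrow> s \<in> carrier R" using S_carrier by blast

lemma loc_frac_trans:
  assumes c: "a \<in> carrier R" "b \<in> carrier R" "c \<in> carrier R" "s \<in> S" "t \<in> S" "r \<in> S"
    and 1: "u \<in> S" "u \<otimes> (a \<otimes> t) = u \<otimes> (b \<otimes> s)"
    and 2: "v \<in> S" "v \<otimes> (b \<otimes> r) = v \<otimes> (c \<otimes> t)"
  shows "\<exists>w\<in>S. w \<otimes> (a \<otimes> r) = w \<otimes> (c \<otimes> s)"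
proof (intro bexI[of _ "u \<otimes> v \<otimes> t"])
  have cl: "s \<in> carrier R" "t \<in> carrier R" "r \<in> carrier R" "u \<in> carrier R" "v \<in> carrier R"
    using c 1(1) 2(1) by auto
  note cs = c(1-3) cl
  have "u \<otimes> v \<otimes> t \<otimes> (a \<otimes> r) = v \<otimes> r \<otimes> (u \<otimes> (a \<otimes> t))" using cs by algebra
  also have "\<dots> = v \<otimes> r \<otimes> (u \<otimes> (b \<otimes> s))" using 1 by simp
  also have "\<dots> = u \<otimes> s \<otimes> (v \<otimes> (b \<otimes> r))" using cs by algebra
  also have "\<dots> = u \<otimes> s \<otimes> (v \<otimes> (c \<otimes> t))" using 2 by simp
  also have "\<dots> = u \<otimes> v \<otimes> t \<otimes> (c \<otimes> s)" using cs by algebra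
  finally show "u \<otimes> v \<otimes> t \<otimes> (a \<otimes> r) = u \<otimes> v \<otimes> t \<otimes> (c \<otimes> s)" .
qed (use c 1 2 mult_S in auto)

lemma loc_frac_self: "a \<in> carrier R \<Longrightarrow> s \<in> S \<Longrightarrow> (a, s) \<in> loc_frac R S a s"
  using one_S by (auto simp: loc_frac_def)

lemma loc_frac_eq_iff:
  assumes c: "a \<in> carrier R" "s \<in> S" "b \<in> carrier R" "t \<in> S"
  shows "loc_frac R S a s = loc_frac R S b t \<longleftrightarrow> (\<exists>u\<in>S. u \<otimes> (a \<otimes> t) = u \<otimes> (b \<otimes> s))"
proof
  assume "loc_frac R S a s = loc_frac R S b t"
  then have "(b, t) \<in> loc_frac R S a s" using loc_frac_self c by simp
  then show "\<exists>u\<in>S. u \<otimes> (a \<otimes> t) = u \<otimes> (b \<otimes> s)" by (simp add: loc_frac_def)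
next
  assume "\<exists>u\<in>S. u \<otimes> (a \<otimes> t) = u \<otimes> (b \<otimes> s)"
  then obtain u where u: "u \<in> S" "u \<otimes> (a \<otimes> t) = u \<otimes> (b \<otimes> s)" by blast
  show "loc_frac R S a s = loc_frac R S b t"
  proof (intro equalityI subrelI)
    fix d r assume "(d, r) \<in> loc_frac R S a s"
    then obtain v where "d \<in> carrier R" "r \<in> S" "v \<in> S" "v \<otimes> (a \<otimes> r) = v \<otimes> (d \<otimes> s)"
      by (auto simp: loc_frac_def)
    then show "(d, r) \<in> loc_frac R S b t"
      using loc_frac_trans[of b a d t s r u v] c u by (simp add: loc_frac_def)
  next
    fix d r assume "(d, r) \<in> loc_frac R S b t"
    then obtain v where "d \<in> carrier R" "r \<in> S" "v \<in> S" "v \<otimes> (b \<otimes> r) = v \<otimes> (d \<otimes> t)"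
      by (auto simp: loc_frac_def)
    then show "(d, r) \<in> loc_frac R S a s"
      using loc_frac_trans[of a b d s t r u v] c u by (simp add: loc_frac_def)
  qed
qed

lemma loc_frac_mem:
  assumes "(b, t) \<in> loc_frac R S a s" "a \<in> carrier R" "s \<in> S"
  shows "b \<in> carrier R" "t \<in> S" "\<exists>u\<in>S. u \<otimes> (b \<otimes> s) = u \<otimes> (a \<otimes> t)"
  using assms by (auto simp: loc_frac_def dest: sym)

lemma loc_mult:
  assumes c: "a \<in> carrier R" "s \<in> S" "b \<in> carrier R" "t \<in> S"
  shows "loc_frac R S a s \<otimes>\<^bsub>localization R S\<^esub> loc_frac R S b t = loc_frac R S (a \<otimes> b) (s \<otimes> t)"
proof -
  have eq: "loc_frac R S (a' \<otimes> b') (s' \<otimes> t') = loc_frac R S (a \<otimes> b) (s \<otimes> t)"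
    if a: "(a', s') \<in> loc_frac R S a s" and b: "(b', t') \<in> loc_frac R S b t" for a' s' b' t'
  proof -
    note a' = loc_frac_mem[OF a c(1,2)] and b' = loc_frac_mem[OF b c(3,4)]
    obtain u v where u: "u \<in> S" "u \<otimes> (a' \<otimes> s) = u \<otimes> (a \<otimes> s')"
      and v: "v \<in> S" "v \<otimes> (b' \<otimes> t) = v \<otimes> (b \<otimes> t')" using a'(3) b'(3) by blast
    have cs: "a \<in> carrier R" "s \<in> carrier R" "b \<in> carrier R" "t \<in> carrier R" "a' \<in> carrier R"
      "s' \<in> carrier R" "b' \<in> carrier R" "t' \<in> carrier R" "u \<in> carrier R" "v \<in> carrier R"
      using c a' b' u v by auto
    have "u \<otimes> v \<otimes> ((a' \<otimes> b') \<otimes> (s \<otimes> t)) = (u \<otimes> (a' \<otimes> s)) \<otimes> (v \<otimes> (b' \<otimes> t))" using cs by algebra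
    also have "\<dots> = (u \<otimes> (a \<otimes> s')) \<otimes> (v \<otimes> (b \<otimes> t'))" using u v by simp
    also have "\<dots> = u \<otimes> v \<otimes> ((a \<otimes> b) \<otimes> (s' \<otimes> t'))" using cs by algebra
    finally show ?thesis
      using c a' b' u v by (subst loc_frac_eq_iff) (auto intro!: mult_S bexI[of _ "u \<otimes> v"])
  qed
  have "(\<Union>p\<in>loc_frac R S a s. \<Union>q\<in>loc_frac R S b t. loc_frac R S (fst p \<otimes> fst q) (snd p \<otimes> snd q))
    = loc_frac R S (a \<otimes> b) (s \<otimes> t)"
    using loc_frac_self[OF c(1,2)] loc_frac_self[OF c(3,4)]
    by (intro UN_UN_const eq) (auto simp only: prod.collapse)
  then show ?thesis
    by (simp add: localization_def case_prod_unfold)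
qed

lemma loc_add:
  assumes c: "a \<in> carrier R" "s \<in> S" "b \<in> carrier R" "t \<in> S"
  shows "loc_frac R S a s \<oplus>\<^bsub>localization R S\<^esub> loc_frac R S b t
    = loc_frac R S (a \<otimes> t \<oplus> b \<otimes> s) (s \<otimes> t)"
proof -
  have eq: "loc_frac R S (a' \<otimes> t' \<oplus> b' \<otimes> s') (s' \<otimes> t') = loc_frac R S (a \<otimes> t \<oplus> b \<otimes> s) (s \<otimes> t)"
    if a: "(a', s') \<in> loc_frac R S a s" and b: "(b', t') \<in> loc_frac R S b t" for a' s' b' t'
  proof -
    note a' = loc_frac_mem[OF a c(1,2)] and b' = loc_frac_mem[OF b c(3,4)]
    obtain u v where u: "u \<in> S" "u \<otimes> (a' \<otimes> s) = u \<otimes> (a \<otimes> s')"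
      and v: "v \<in> S" "v \<otimes> (b' \<otimes> t) = v \<otimes> (b \<otimes> t')" using a'(3) b'(3) by blast
    have cs: "a \<in> carrier R" "s \<in> carrier R" "b \<in> carrier R" "t \<in> carrier R" "a' \<in> carrier R"
      "s' \<in> carrier R" "b' \<in> carrier R" "t' \<in> carrier R" "u \<in> carrier R" "v \<in> carrier R"
      using c a' b' u v by auto
    have "u \<otimes> v \<otimes> ((a' \<otimes> t' \<oplus> b' \<otimes> s') \<otimes> (s \<otimes> t))
      = v \<otimes> t \<otimes> t' \<otimes> (u \<otimes> (a' \<otimes> s)) \<oplus> u \<otimes> s \<otimes> s' \<otimes> (v \<otimes> (b' \<otimes> t))" using cs by algebra
    also have "\<dots> = v \<otimes> t \<otimes> t' \<otimes> (u \<otimes> (a \<otimes> s')) \<oplus> u \<otimes> s \<otimes> s' \<otimes> (v \<otimes> (b \<otimes> t'))" using u v by simp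
    also have "\<dots> = u \<otimes> v \<otimes> ((a \<otimes> t \<oplus> b \<otimes> s) \<otimes> (s' \<otimes> t'))" using cs by algebra
    finally show ?thesis
      using c a' b' u v by (subst loc_frac_eq_iff) (auto intro!: mult_S bexI[of _ "u \<otimes> v"])
  qed
  have "(\<Union>p\<in>loc_frac R S a s. \<Union>q\<in>loc_frac R S b t. loc_frac R S (fst p \<otimes> snd q \<oplus> fst q \<otimes> snd p) (snd p \<otimes> snd q))
    = loc_frac R S (a \<otimes> t \<oplus> b \<otimes> s) (s \<otimes> t)"
    using loc_frac_self[OF c(1,2)] loc_frac_self[OF c(3,4)]
    by (intro UN_UN_const eq) (auto simp only: prod.collapse)
  then show ?thesis
    by (simp add: localization_def case_prod_unfold)
qed

lemma loc_carrier:
  "x \<in> carrier (localization R S) \<longleftrightarrow> (\<exists>a s. x = loc_frac R S a s \<and> a \<in> carrier R \<and> s \<in> S)"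
  by (auto simp: localization_def)

lemma loc_one: "\<one>\<^bsub>localization R S\<^esub> = loc_frac R S \<one> \<one>"
  and loc_zero: "\<zero>\<^bsub>localization R S\<^esub> = loc_frac R S \<zero> \<one>"
  by (simp_all add: localization_def)

lemma loc_frac_eqI:
  assumes "a \<in> carrier R" "s \<in> S" "b \<in> carrier R" "t \<in> S" "a \<otimes> t = b \<otimes> s"
  shows "loc_frac R S a s = loc_frac R S b t"
  using assms one_S by (subst loc_frac_eq_iff) auto

theorem localization_cring: "cring (localization R S)"
proof (rule cringI)
  show "abelian_group (localization R S)"
  proof (rule abelian_groupI)
    fix x y z
    assume "x \<in> carrier (localization R S)" "y \<in> carrier (localization R S)"
      "z \<in> carrier (localization R S)"
    then obtain a s b t c r where x: "x = loc_frac R S a s" "a \<in> carrier R" "s \<in> S"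
      and y: "y = loc_frac R S b t" "b \<in> carrier R" "t \<in> S"
      and z: "z = loc_frac R S c r" "c \<in> carrier R" "r \<in> S" by (auto simp: loc_carrier)
    have cl: "s \<in> carrier R" "t \<in> carrier R" "r \<in> carrier R" using x y z by auto
    have eq: "(a \<otimes> t \<oplus> b \<otimes> s) \<otimes> r \<oplus> c \<otimes> (s \<otimes> t) = a \<otimes> (t \<otimes> r) \<oplus> (b \<otimes> r \<oplus> c \<otimes> t) \<otimes> s"
      using x(2) y(2) z(2) cl by algebra
    show "x \<oplus>\<^bsub>localization R S\<^esub> y \<oplus>\<^bsub>localization R S\<^esub> z
      = x \<oplus>\<^bsub>localization R S\<^esub> (y \<oplus>\<^bsub>localization R S\<^esub> z)"
      using x y z by (simp add: loc_add mult_S eq m_assoc)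
  next
    fix x y assume "x \<in> carrier (localization R S)" "y \<in> carrier (localization R S)"
    then obtain a s b t where x: "x = loc_frac R S a s" "a \<in> carrier R" "s \<in> S"
      and y: "y = loc_frac R S b t" "b \<in> carrier R" "t \<in> S" by (auto simp: loc_carrier)
    show "x \<oplus>\<^bsub>localization R S\<^esub> y \<in> carrier (localization R S)"
      using x y mult_S by (auto simp: loc_add loc_carrier intro!: exI)
    show "x \<oplus>\<^bsub>localization R S\<^esub> y = y \<oplus>\<^bsub>localization R S\<^esub> x"
      using x y by (simp add: loc_add a_comm m_comm)
  next
    show "\<zero>\<^bsub>localization R S\<^esub> \<in> carrier (localization R S)"
      unfolding loc_zero loc_carrier using one_S by blast
  next
    fix x assume "x \<in> carrier (localization R S)"
    then obtain a s where x: "x = loc_frac R S a s" "a \<in> carrier R" "s \<in> S"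
      by (auto simp: loc_carrier)
    show "\<zero>\<^bsub>localization R S\<^esub> \<oplus>\<^bsub>localization R S\<^esub> x = x"
      using x one_S by (simp add: loc_zero loc_add)
    have "loc_frac R S (\<ominus> a \<otimes> s \<oplus> a \<otimes> s) (s \<otimes> s) = loc_frac R S \<zero> \<one>"
      using x one_S by (intro loc_frac_eqI) (auto simp: mult_S l_minus l_neg)
    then show "\<exists>y\<in>carrier (localization R S). y \<oplus>\<^bsub>localization R S\<^esub> x = \<zero>\<^bsub>localization R S\<^esub>"
      using x by (intro bexI[of _ "loc_frac R S (\<ominus> a) s"]) (auto simp: loc_add loc_zero loc_carrier)
  qed
  show "Group.comm_monoid (localization R S)"
  proof (rule comm_monoidI)
    fix x y z
    assume "x \<in> carrier (localization R S)" "y \<in> carrier (localization R S)"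
      "z \<in> carrier (localization R S)"
    then obtain a s b t c r where x: "x = loc_frac R S a s" "a \<in> carrier R" "s \<in> S"
      and y: "y = loc_frac R S b t" "b \<in> carrier R" "t \<in> S"
      and z: "z = loc_frac R S c r" "c \<in> carrier R" "r \<in> S" by (auto simp: loc_carrier)
    then show "x \<otimes>\<^bsub>localization R S\<^esub> y \<otimes>\<^bsub>localization R S\<^esub> z
      = x \<otimes>\<^bsub>localization R S\<^esub> (y \<otimes>\<^bsub>localization R S\<^esub> z)"
      by (simp add: loc_mult mult_S m_assoc)
  next
    fix x y assume "x \<in> carrier (localization R S)" "y \<in> carrier (localization R S)"
    then obtain a s b t where x: "x = loc_frac R S a s" "a \<in> carrier R" "s \<in> S"
      and y: "y = loc_frac R S b t" "b \<in> carrier R" "t \<in> S" by (auto simp: loc_carrier)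
    show "x \<otimes>\<^bsub>localization R S\<^esub> y \<in> carrier (localization R S)"
      using x y mult_S by (auto simp: loc_mult loc_carrier intro!: exI)
    show "x \<otimes>\<^bsub>localization R S\<^esub> y = y \<otimes>\<^bsub>localization R S\<^esub> x"
      using x y by (simp add: loc_mult m_comm)
  next
    show "\<one>\<^bsub>localization R S\<^esub> \<in> carrier (localization R S)"
      unfolding loc_one loc_carrier using one_S by blast
  next
    fix x assume "x \<in> carrier (localization R S)"
    then obtain a s where x: "x = loc_frac R S a s" "a \<in> carrier R" "s \<in> S"
      by (auto simp: loc_carrier)
    show "\<one>\<^bsub>localization R S\<^esub> \<otimes>\<^bsub>localization R S\<^esub> x = x"
      using x one_S by (simp add: loc_one loc_mult)
  qed
next
  fix x y z
  assume "x \<in> carrier (localization R S)" "y \<in> carrier (localization R S)"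
    "z \<in> carrier (localization R S)"
  then obtain a s b t c r where x: "x = loc_frac R S a s" "a \<in> carrier R" "s \<in> S"
    and y: "y = loc_frac R S b t" "b \<in> carrier R" "t \<in> S"
    and z: "z = loc_frac R S c r" "c \<in> carrier R" "r \<in> S" by (auto simp: loc_carrier)
  have cl: "s \<in> carrier R" "t \<in> carrier R" "r \<in> carrier R" using x y z by auto
  have eq: "(a \<otimes> t \<oplus> b \<otimes> s) \<otimes> c \<otimes> (s \<otimes> r \<otimes> (t \<otimes> r))
      = (a \<otimes> c \<otimes> (t \<otimes> r) \<oplus> b \<otimes> c \<otimes> (s \<otimes> r)) \<otimes> (s \<otimes> t \<otimes> r)"
    using x(2) y(2) z(2) cl by algebra
  show "(x \<oplus>\<^bsub>localization R S\<^esub> y) \<otimes>\<^bsub>localization R S\<^esub> z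
    = x \<otimes>\<^bsub>localization R S\<^esub> z \<oplus>\<^bsub>localization R S\<^esub> y \<otimes>\<^bsub>localization R S\<^esub> z"
    using x y z eq by (simp add: loc_add loc_mult mult_S) (rule loc_frac_eqI, auto intro: mult_S)
qed

end

lemma maximal_ideal_complement:
  assumes "cring A" "maximalideal I A"
  shows "mult_subset A (carrier A - I)"
proof -
  interpret cring A by fact
  interpret primeideal I A by (rule maximalideal_prime[OF assms(2)])
  show ?thesis
    using I_prime I_notcarr one_imp_carrier by unfold_locales auto
qed

theorem localize_at_cring:
  "cring A \<Longrightarrow> maximalideal I A \<Longrightarrow> cring (localize_at A I)"
  unfolding localize_at_def by (intro mult_subset.localization_cring maximal_ideal_complement)

theorem localize_map_hom:
  assumes "cring A" "maximalideal I A"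
  shows "localize_map A I \<in> ring_hom A (localize_at A I)"
proof -
  interpret mult_subset A "carrier A - I" by (rule maximal_ideal_complement[OF assms])
  show ?thesis
    unfolding localize_at_def localize_map_def[abs_def] using one_S
    by (intro ring_hom_memI) (auto simp: loc_mult loc_add loc_one loc_carrier simp del: Diff_iff)
qed

end

theory Submission
  imports Defs
begin

text \<open>
  Substituting homogeneous series into one another preserves homogeneity, so the elements \<open>b\<close> for
  which every coefficient of \<open>\<rho>\<^sub>b\<close> is a homogeneous polynomial of the right degree in a given set
  of generators are closed under sums, products and inverses. Every element of \<open>A\<^sub>I\<close> arises by these
  operations from \<open>-1\<close> and finitely many generators of \<open>A\<close>; hence \<open>L\<close> is generated as an
  \<open>A\<^sub>I\<close>-algebra by elements of positive degree, finitely many in each degree, and its summands are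
  finitely generated modules. They are separated by Krull's intersection theorem, as \<open>A\<close> is
  noetherian and \<open>A\<^sub>I\<close> is local. Noetherianity is expressed through sequences: every sequence has
  a member that is a linear combination of its predecessors.
\<close>

section \<open>Finitely generated commutative rings are noetherian\<close>

text \<open>The presentation of \<open>L^B\<close> has a generator \<open>Rho b i\<close> for every
  \<open>b\<close>, so for infinite \<open>B\<close> each positive even degree contains infinitely
  many generators. The laws rho_(b+c) = F(rho_b, rho_c) and rho_(bc) = rho_b(rho_c) dispose of sums
  and products. A denominator is harder: rho_(1/s) has to be recovered from rho_s by inverting a
  power series, which succeeds because the linear coefficient s is a unit in the localization. For
  separatedness, the ideal belongs to \<open>A\<close> while the module has its coefficients in
  \<open>A_I\<close>. Clearing denominators moves the question to coefficient vectors over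
  \<open>A\<close>, one for each power of \<open>I\<close>. The Rees algebra yields a single linear
  relation between these vectors with coefficients in \<open>I\<close>; it replaces the usual
  passage from I N = N, for the intersection N of all I^n M, to N = 0 by Nakayama's lemma.\<close>

inductive_set hspan :: "('a, 'x) ring_scheme \<Rightarrow> 'a set \<Rightarrow> 'a set \<Rightarrow> 'a set" for R H G where
  zero: "\<zero>\<^bsub>R\<^esub> \<in> hspan R H G"
| step: "h \<in> H \<Longrightarrow> g \<in> G \<Longrightarrow> y \<in> hspan R H G \<Longrightarrow> h \<otimes>\<^bsub>R\<^esub> g \<oplus>\<^bsub>R\<^esub> y \<in> hspan R H G"

text \<open>Stated for a subring \<open>H\<close> of a fixed ring \<open>R\<close>, so that
  adjoining generators one at a time never changes the type of the elements.\<close>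

definition noetherian_on :: "('a, 'x) ring_scheme \<Rightarrow> 'a set \<Rightarrow> bool" where
  "noetherian_on R H \<longleftrightarrow>
    (\<forall>f :: nat \<Rightarrow> 'a. range f \<subseteq> H \<longrightarrow> (\<exists>N. f N \<in> hspan R H (f ` {..<N})))"

text \<open>Values at \<open>t\<close> of polynomials over \<open>H\<close> with \<open>d\<close>
  coefficients, that is of degree below \<open>d\<close>; their union over \<open>d\<close> is
  \<open>H[t]\<close>. The recursion splits off the leading term. Values take the place of
  polynomials because \<open>t\<close> may satisfy relations over \<open>H\<close>.\<close>

primrec poly_values :: "('a, 'x) ring_scheme \<Rightarrow> 'a set \<Rightarrow> 'a \<Rightarrow> nat \<Rightarrow> 'a set" where
  "poly_values R H t 0 = {\<zero>\<^bsub>R\<^esub>}"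
| "poly_values R H t (Suc d) =
    {r \<otimes>\<^bsub>R\<^esub> t [^]\<^bsub>R\<^esub> d \<oplus>\<^bsub>R\<^esub> p |r p. r \<in> H \<and> p \<in> poly_values R H t d}"

text \<open>Dependent choice in which each step sees the set of all earlier members. It turns the
  failure of a finiteness statement into a sequence that contradicts
  \<open>noetherian_on\<close>.\<close>

lemma seq_choice:
  assumes "\<And>F. finite F \<Longrightarrow> F \<subseteq> J \<Longrightarrow> \<exists>x\<in>J. Q F x"
  shows "\<exists>f :: nat \<Rightarrow> 'a. \<forall>n. f n \<in> J \<and> Q (f ` {..<n}) (f n)"
proof (rule dependent_wellorder_choice)
  fix r and f g :: "nat \<Rightarrow> 'a" and n :: nat
  assume "\<And>y. y < n \<Longrightarrow> f y = g y"
  then have "f ` {..<n} = g ` {..<n}" by (intro image_cong) auto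
  then show "(r \<in> J \<and> Q (f ` {..<n}) r) = (r \<in> J \<and> Q (g ` {..<n}) r)" by simp
next
  fix n :: nat and f :: "nat \<Rightarrow> 'a"
  assume "\<And>y. y < n \<Longrightarrow> f y \<in> J \<and> Q (f ` {..<y}) (f y)"
  then have "f ` {..<n} \<subseteq> J" by auto
  then show "\<exists>r. r \<in> J \<and> Q (f ` {..<n}) r" using assms[of "f ` {..<n}"] by auto
qed

lemma hspan_mono: "y \<in> hspan R H G \<Longrightarrow> G \<subseteq> G' \<Longrightarrow> y \<in> hspan R H G'"
  by (induction rule: hspan.induct) (auto intro: hspan.intros)

section \<open>Linear combinations over a subring\<close>

locale cring_subring = cring + H: subcring H R for H
begin

lemma H_closed [simp]:
  "\<one> \<in> H" "\<zero> \<in> H" "a \<in> H \<Longrightarrow> b \<in> H \<Longrightarrow> a \<otimes> b \<in> H" "a \<in> H \<Longrightarrow> b \<in> H \<Longrightarrow> a \<oplus> b \<in> H"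
  "a \<in> H \<Longrightarrow> \<ominus> a \<in> H" "a \<in> H \<Longrightarrow> a \<in> carrier R"
  using H.subring_axioms subringE[of H R] by auto

lemma H_pow [simp]: "a \<in> H \<Longrightarrow> a [^] (n::nat) \<in> H"
  by (induction n) auto

lemma hspan_carrier: "y \<in> hspan R H G \<Longrightarrow> G \<subseteq> carrier R \<Longrightarrow> y \<in> carrier R"
  by (induction rule: hspan.induct) auto

lemma hspan_add:
  assumes "y \<in> hspan R H G" "z \<in> hspan R H G" "G \<subseteq> carrier R"
  shows "y \<oplus> z \<in> hspan R H G"
  using assms
proof (induction rule: hspan.induct)
  case zero
  then show ?case by (simp add: hspan_carrier)
next
  case (step h g y)
  have "h \<otimes> g \<oplus> y \<oplus> z = h \<otimes> g \<oplus> (y \<oplus> z)"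
    using step hspan_carrier[of _ G] by (intro a_assoc) auto
  then show ?case using step by (simp add: hspan.step)
qed

lemma hspan_smult:
  assumes "y \<in> hspan R H G" "h \<in> H" "G \<subseteq> carrier R"
  shows "h \<otimes> y \<in> hspan R H G"
  using assms
proof (induction rule: hspan.induct)
  case zero
  then show ?case by (simp add: hspan.zero)
next
  case (step k g y)
  have "h \<otimes> (k \<otimes> g \<oplus> y) = (h \<otimes> k) \<otimes> g \<oplus> h \<otimes> y"
    using step hspan_carrier[of _ G] by (subst r_distr) (auto simp: m_assoc)
  then show ?case using step by (simp add: hspan.step)
qed

lemma hspan_incl: "g \<in> G \<Longrightarrow> G \<subseteq> carrier R \<Longrightarrow> g \<in> hspan R H G"
  using hspan.step[of \<one> H g G \<zero> R, OF _ _ hspan.zero] by (auto simp: subset_iff)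

lemma hspan_trans:
  assumes "y \<in> hspan R H F" "F \<subseteq> hspan R H G" "G \<subseteq> carrier R"
  shows "y \<in> hspan R H G"
  using assms by (induction rule: hspan.induct) (auto intro: hspan.zero hspan_add hspan_smult)

lemma hspan_neg: "y \<in> hspan R H G \<Longrightarrow> G \<subseteq> carrier R \<Longrightarrow> \<ominus> y \<in> hspan R H G"
  using hspan_smult[of y G "\<ominus> \<one>"] hspan_carrier[of y G] by (simp add: l_minus)

lemma hspan_subset_H: "y \<in> hspan R H G \<Longrightarrow> G \<subseteq> H \<Longrightarrow> y \<in> H"
  by (induction rule: hspan.induct) auto

text \<open>If no finite subset sufficed, each new member could be chosen outside the span of the
  earlier ones, and no member of the resulting sequence would be a combination of its
  predecessors.\<close>

lemma noetherian_on_finite_span: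
  assumes "noetherian_on R H" "J \<subseteq> H"
  shows "\<exists>F\<subseteq>J. finite F \<and> J \<subseteq> hspan R H F"
proof (rule ccontr)
  assume "\<not> ?thesis"
  then have "\<And>F. finite F \<Longrightarrow> F \<subseteq> J \<Longrightarrow> \<exists>x\<in>J. x \<notin> hspan R H F" by blast
  from seq_choice[of J "\<lambda>F x. x \<notin> hspan R H F", OF this]
  obtain f :: "nat \<Rightarrow> 'a" where "\<forall>n. f n \<in> J \<and> f n \<notin> hspan R H (f ` {..<n})" by blast
  then show False using assms unfolding noetherian_on_def by (metis image_subsetI subset_iff)
qed

section \<open>Hilbert's basis theorem for \<open>H[t]\<close>\<close>

context
  fixes t
  assumes t: "t \<in> carrier R"
begin

abbreviation "V \<equiv> poly_values R H t"

lemma poly_values_carrier: "p \<in> V d \<Longrightarrow> p \<in> carrier R"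
  using t by (induction d arbitrary: p) auto

lemma poly_values_zero: "\<zero> \<in> V d"
  using t by (induction d) (auto intro!: exI[of _ \<zero>])

lemma poly_values_Suc: "p \<in> V d \<Longrightarrow> p \<in> V (Suc d)"
  using t poly_values_carrier[of p d]
  by (simp del: H_closed, intro exI[of _ \<zero>] exI[of _ p]) auto

lemma poly_values_mono: "d \<le> e \<Longrightarrow> p \<in> V d \<Longrightarrow> p \<in> V e"
  by (induction e rule: dec_induct) (auto intro: poly_values_Suc simp del: poly_values.simps)

lemma poly_values_add: "p \<in> V d \<Longrightarrow> q \<in> V d \<Longrightarrow> p \<oplus> q \<in> V d"
proof (induction d arbitrary: p q)
  case (Suc d)
  then obtain r p' s q' where p: "p = r \<otimes> t [^] d \<oplus> p'" "r \<in> H" "p' \<in> V d"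
    and q: "q = s \<otimes> t [^] d \<oplus> q'" "s \<in> H" "q' \<in> V d" by auto
  have cl: "r \<in> carrier R" "s \<in> carrier R" "p' \<in> carrier R" "q' \<in> carrier R" "t [^] d \<in> carrier R"
    using p q t poly_values_carrier by auto
  have "p \<oplus> q = (r \<oplus> s) \<otimes> t [^] d \<oplus> (p' \<oplus> q')"
    unfolding p(1) q(1) using cl by algebra
  moreover have "r \<oplus> s \<in> H" using p(2) q(2) by simp
  ultimately show ?case using Suc.IH[OF p(3) q(3)] unfolding poly_values.simps by blast
qed simp

lemma poly_values_smult: "h \<in> H \<Longrightarrow> p \<in> V d \<Longrightarrow> h \<otimes> p \<in> V d"
proof (induction d arbitrary: p)
  case (Suc d)
  then obtain r p' where p: "p = r \<otimes> t [^] d \<oplus> p'" "r \<in> H" "p' \<in> V d" by auto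
  have cl: "r \<in> carrier R" "h \<in> carrier R" "p' \<in> carrier R" "t [^] d \<in> carrier R"
    using p Suc t poly_values_carrier by auto
  have "h \<otimes> p = (h \<otimes> r) \<otimes> t [^] d \<oplus> h \<otimes> p'"
    unfolding p(1) using cl by algebra
  moreover have "h \<otimes> r \<in> H" using p(2) Suc.prems by simp
  ultimately show ?case using Suc.IH[OF Suc.prems(1) p(3)] unfolding poly_values.simps by blast
qed simp

lemma poly_values_neg: "p \<in> V d \<Longrightarrow> \<ominus> p \<in> V d"
  using poly_values_smult[of "\<ominus> \<one>" p d] poly_values_carrier[of p d] by (simp add: l_minus)

lemma poly_values_t: "p \<in> V d \<Longrightarrow> t \<otimes> p \<in> V (Suc d)"
proof (induction d arbitrary: p)
  case 0
  then have "t \<otimes> p = \<zero>" using t by simp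
  then show ?case using poly_values_zero[of "Suc 0"] by simp
next
  case (Suc d)
  then obtain r p' where p: "p = r \<otimes> t [^] d \<oplus> p'" "r \<in> H" "p' \<in> V d" by auto
  have cl: "r \<in> carrier R" "p' \<in> carrier R" "t [^] d \<in> carrier R"
    using p t poly_values_carrier by auto
  have "t \<otimes> p = r \<otimes> (t [^] d \<otimes> t) \<oplus> t \<otimes> p'"
    unfolding p(1) using cl t by algebra
  then have "t \<otimes> p = r \<otimes> t [^] Suc d \<oplus> t \<otimes> p'" by simp
  then show ?case using Suc.IH[OF p(3)] p(2) unfolding poly_values.simps(2)[of R H t "Suc d"] by blast
qed

lemma poly_values_pow: "p \<in> V d \<Longrightarrow> t [^] k \<otimes> p \<in> V (k + d)"
proof (induction k)
  case 0
  then show ?case using poly_values_carrier by simp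
next
  case (Suc k)
  have "t [^] Suc k \<otimes> p = t \<otimes> (t [^] k \<otimes> p)"
    using poly_values_carrier[OF Suc.prems] t by (simp add: m_assoc m_lcomm)
  then show ?case using poly_values_t[OF Suc.IH[OF Suc.prems]] by simp
qed

lemma poly_values_mult: "p \<in> V d \<Longrightarrow> q \<in> V e \<Longrightarrow> p \<otimes> q \<in> V (d + e)"
proof (induction d arbitrary: p)
  case 0
  then show ?case using poly_values_carrier poly_values_zero by auto
next
  case (Suc d)
  then obtain r p' where p: "p = r \<otimes> t [^] d \<oplus> p'" "r \<in> H" "p' \<in> V d" by auto
  have cl: "r \<in> carrier R" "p' \<in> carrier R" "t [^] d \<in> carrier R" "q \<in> carrier R"
    using p t Suc.prems poly_values_carrier by auto
  have "p \<otimes> q = r \<otimes> (t [^] d \<otimes> q) \<oplus> p' \<otimes> q"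
    unfolding p(1) using cl by algebra
  moreover have "r \<otimes> (t [^] d \<otimes> q) \<oplus> p' \<otimes> q \<in> V (d + e)"
    by (intro poly_values_add poly_values_smult poly_values_pow Suc.IH p Suc.prems)
  ultimately show ?case using poly_values_Suc[of _ "d + e"] by simp
qed

lemma poly_values_subring: "subcring (\<Union>d. V d) R"
proof (intro subcringI' subringI)
  show "(\<Union>d. V d) \<subseteq> carrier R" using poly_values_carrier by blast
  have "\<one> \<in> V (Suc 0)" by (auto intro!: exI[of _ \<one>])
  then show "\<one> \<in> (\<Union>d. V d)" by blast
next
  fix p assume "p \<in> (\<Union>d. V d)"
  then show "\<ominus> p \<in> (\<Union>d. V d)" using poly_values_neg by blast
next
  fix p q assume "p \<in> (\<Union>d. V d)" "q \<in> (\<Union>d. V d)"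
  then obtain d e where pq: "p \<in> V d" "q \<in> V e" by blast
  then show "p \<otimes> q \<in> (\<Union>d. V d)" using poly_values_mult by blast
  have "p \<oplus> q \<in> V (max d e)"
    using pq by (intro poly_values_add) (auto intro: poly_values_mono[rotated])
  then show "p \<oplus> q \<in> (\<Union>d. V d)" by blast
qed

text \<open>Hilbert's argument: inside the ideal \<open>J\<close> generated by the sequence, choose
  \<open>f n\<close> of least degree outside the span of the earlier ones. Some leading coefficient
  \<open>r N\<close> is a combination of its predecessors; subtracting the matching combination of
  the \<open>f i\<close> from \<open>f N\<close> lowers the degree but does not enter the span,
  against minimality.\<close>

theorem noetherian_on_poly_values:
  assumes "noetherian_on R H"
  shows "noetherian_on R (\<Union>d. V d)"
  unfolding noetherian_on_def
proof (intro allI impI)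
  fix g :: "nat \<Rightarrow> 'a"
  define H' where "H' = (\<Union>d. V d)"
  assume g: "range g \<subseteq> (\<Union>d. V d)"
  interpret H': cring_subring R H'
    using poly_values_subring is_cring unfolding H'_def by (simp add: cring_subring_def)
  define J where "J = hspan R H' (range g)"
  have gH: "range g \<subseteq> H'" unfolding H'_def by (rule g)
  then have gc: "range g \<subseteq> carrier R" using H'.H_closed(6) by blast
  have JH: "J \<subseteq> H'" unfolding J_def using H'.hspan_subset_H[OF _ gH] by blast
  then have Jc: "J \<subseteq> carrier R" using H'.H_closed(6) by blast
  \<comment> \<open>The least number of coefficients that represent \<open>x\<close>. An element of
    \<open>H[t]\<close> has no leading term of its own, so the one of a shortest representation is
    used.\<close>
  define dg where "dg = (\<lambda>x. LEAST d. x \<in> V d)"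
  have dg: "x \<in> V (dg x)" if "x \<in> J" for x
    unfolding dg_def by (rule LeastI_ex) (use that JH H'_def in blast)
  have dgle: "x \<in> V d \<Longrightarrow> dg x \<le> d" for x d unfolding dg_def by (rule Least_le)
  have "\<exists>F\<subseteq>J. finite F \<and> J \<subseteq> hspan R H' F"
  proof (rule ccontr)
    assume neg: "\<not> ?thesis"
    define Q where "Q = (\<lambda>F x. x \<notin> hspan R H' F \<and> (\<forall>y\<in>J. y \<notin> hspan R H' F \<longrightarrow> dg x \<le> dg y))"
    have "\<exists>x\<in>J. Q F x" if "finite F" "F \<subseteq> J" for F
    proof -
      have "\<not> J \<subseteq> hspan R H' F" using neg that by simp
      then obtain x where x: "x \<in> J \<and> x \<notin> hspan R H' F" unfolding subset_iff by auto
      show ?thesis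
        using ex_has_least_nat[of "\<lambda>x. x \<in> J \<and> x \<notin> hspan R H' F", OF x, of dg]
        unfolding Q_def by auto
    qed
    from seq_choice[of J Q, OF this] obtain f :: "nat \<Rightarrow> 'a"
      where f: "\<forall>n. f n \<in> J \<and> Q (f ` {..<n}) (f n)" ..
    have fJ: "f n \<in> J" and fQ: "Q (f ` {..<n}) (f n)" for n using f by simp_all
    note fn = fQ[unfolded Q_def, THEN conjunct1] and fmin = fQ[unfolded Q_def, THEN conjunct2, rule_format]
    have fc: "f ` A \<subseteq> carrier R" for A using fJ Jc by blast
    have dpos: "\<exists>d r p. dg (f n) = Suc d \<and> f n = r \<otimes> t [^] d \<oplus> p \<and> r \<in> H \<and> p \<in> V d" for n
    proof (cases "dg (f n)")
      case 0
      then have "f n = \<zero>" using dg[OF fJ[of n]] by simp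
      then show ?thesis using fn[of n] hspan.zero[of R H'] by simp
    next
      case (Suc d)
      then show ?thesis using dg[OF fJ[of n]] by auto
    qed
    then have "\<forall>n. \<exists>c. case c of (d, r, p) \<Rightarrow> dg (f n) = Suc d \<and> f n = r \<otimes> t [^] d \<oplus> p \<and> r \<in> H \<and> p \<in> V d"
      by (simp add: split_paired_Ex)
    from choice[OF this] obtain c where c: "\<forall>n. case c n of (d, r, p) \<Rightarrow>
        dg (f n) = Suc d \<and> f n = r \<otimes> t [^] d \<oplus> p \<and> r \<in> H \<and> p \<in> V d" ..
    define d r p where "d n = fst (c n)" and "r n = fst (snd (c n))" and "p n = snd (snd (c n))" for n
    have d: "dg (f n) = Suc (d n)" and fr: "f n = r n \<otimes> t [^] d n \<oplus> p n"
      and r: "r n \<in> H" and p: "p n \<in> V (d n)" for n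
      using c[rule_format, of n] unfolding d_def r_def p_def case_prod_unfold by blast+
    \<comment> \<open>At stage \<open>i\<close> the element \<open>f n\<close> was already a
      candidate outside the span, so \<open>f i\<close> is no longer than \<open>f n\<close>. This
      makes the exponent \<open>d N - d i\<close> below a genuine difference.\<close>
    have dmono: "d i \<le> d n" if "i \<le> n" for i n
    proof -
      have "f n \<notin> hspan R H' (f ` {..<i})"
        using fn[of n] hspan_mono[OF _ image_mono[of "{..<i}" "{..<n}" f]] that by auto
      then have "dg (f i) \<le> dg (f n)" using fmin[OF fJ] by blast
      then show ?thesis by (simp add: d)
    qed
    have "range r \<subseteq> H" using r by blast
    then obtain N where N: "r N \<in> hspan R H (r ` {..<N})"
      using assms unfolding noetherian_on_def by blast
    have rc: "\<And>n. r n \<in> carrier R" using r by simp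
    \<comment> \<open>Multiplying \<open>f i\<close> by the power of \<open>t\<close> with exponent
      \<open>d N - d i\<close> moves its leading coefficient to degree \<open>d N\<close>. A
      combination of leading coefficients is thus realised by a combination of the
      \<open>f i\<close>, up to shorter terms.\<close>
    have lift: "\<exists>z\<in>hspan R H' (f ` {..<N}). z \<ominus> y \<otimes> t [^] d N \<in> V (d N)"
      if "y \<in> hspan R H (r ` {..<N})" for y
      using that
    proof (induction rule: hspan.induct)
      case zero
      then show ?case using t poly_values_zero
        by (intro bexI[of _ \<zero>]) (auto intro: hspan.zero simp: a_minus_def)
    next
      case (step h ri y)
      then obtain i where i: "i < N" "ri = r i" by auto
      from step obtain z where z: "z \<in> hspan R H' (f ` {..<N})" "z \<ominus> y \<otimes> t [^] d N \<in> V (d N)" by blast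
      define k where "k = d N - d i"
      have k: "d N = k + d i" using dmono[of i N] i by (simp add: k_def)
      have yc: "y \<in> carrier R" using step.hyps(3) hspan_carrier rc by blast
      have zc: "z \<in> carrier R" using z(1) H'.hspan_carrier[OF _ fc] by blast
      have cl: "h \<in> carrier R" "p i \<in> carrier R" "t [^] k \<in> carrier R" "t [^] d i \<in> carrier R"
        using step.hyps(1) t p poly_values_carrier by auto
      have hk: "h \<otimes> t [^] k \<in> H'"
      proof -
        have "h \<otimes> t [^] k = h \<otimes> t [^] k \<oplus> \<zero>" using cl by simp
        then have "h \<otimes> t [^] k \<in> V (Suc k)"
          using step.hyps(1) poly_values_zero[of k] unfolding poly_values.simps by blast
        then show ?thesis unfolding H'_def by blast
      qed
      let ?z = "(h \<otimes> t [^] k) \<otimes> f i \<oplus> z"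
      have "?z \<in> hspan R H' (f ` {..<N})" using hk z(1) i by (intro hspan.step) auto
      moreover have "?z \<ominus> (h \<otimes> ri \<oplus> y) \<otimes> t [^] d N = h \<otimes> (t [^] k \<otimes> p i) \<oplus> (z \<ominus> y \<otimes> t [^] d N)"
        unfolding fr[of i] i(2) k nat_pow_mult[OF t, symmetric] using cl yc zc rc[of i] by algebra
      moreover have "h \<otimes> (t [^] k \<otimes> p i) \<oplus> (z \<ominus> y \<otimes> t [^] d N) \<in> V (d N)"
        using z(2) poly_values_smult[OF step.hyps(1) poly_values_pow[OF p[of i], of k]]
        by (intro poly_values_add) (simp_all add: k)
      ultimately show ?case by metis
    qed
    obtain z where z: "z \<in> hspan R H' (f ` {..<N})" "z \<ominus> r N \<otimes> t [^] d N \<in> V (d N)"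
      using lift[OF N] by blast
    have zc: "z \<in> carrier R" using z(1) H'.hspan_carrier[OF _ fc] by blast
    have cl: "f N \<in> carrier R" "p N \<in> carrier R" "t [^] d N \<in> carrier R"
      using fc t poly_values_carrier[OF p] by auto
    have w: "f N \<ominus> z = p N \<oplus> \<ominus> (z \<ominus> r N \<otimes> t [^] d N)"
      unfolding fr[of N] using cl rc[of N] zc by algebra
    have "f N \<ominus> z \<in> V (d N)" unfolding w using p z(2) by (intro poly_values_add poly_values_neg)
    then have "dg (f N \<ominus> z) \<le> d N" by (rule dgle)
    moreover have "f N \<ominus> z \<notin> hspan R H' (f ` {..<N})"
    proof
      assume "f N \<ominus> z \<in> hspan R H' (f ` {..<N})"
      then have "(f N \<ominus> z) \<oplus> z \<in> hspan R H' (f ` {..<N})" using z(1) fc by (rule H'.hspan_add)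
      moreover have "(f N \<ominus> z) \<oplus> z = f N" using cl zc by algebra
      ultimately show False using fn[of N] by simp
    qed
    moreover have "f N \<ominus> z \<in> J"
    proof -
      have "z \<in> J" unfolding J_def
        by (rule H'.hspan_trans[OF z(1) _ gc]) (use fJ in \<open>auto simp: J_def\<close>)
      then show ?thesis using fJ[of N] unfolding J_def a_minus_def
        by (intro H'.hspan_add H'.hspan_neg gc)
    qed
    ultimately show False using fmin[of "f N \<ominus> z" N] d[of N] by simp
  qed
  then obtain F where F: "F \<subseteq> J" "finite F" "J \<subseteq> hspan R H' F" by blast
  \<comment> \<open>Each element of the finite set \<open>F\<close> involves only finitely many
    \<open>g i\<close>, so an initial segment of \<open>g\<close> spans all of \<open>J\<close>, in
    particular the next member \<open>g N\<close>.\<close>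
  have "\<exists>N. F \<subseteq> hspan R H' (g ` {..<N})"
    using F(2,1)
  proof (induction F rule: finite_induct)
    case (insert x F)
    then obtain N where N: "F \<subseteq> hspan R H' (g ` {..<N})" by auto
    have "x \<in> hspan R H' (range g)" using insert.prems J_def by simp
    then have "\<exists>M. x \<in> hspan R H' (g ` {..<M})"
    proof (induction rule: hspan.induct)
      case (step h y x)
      then obtain M i where M: "x \<in> hspan R H' (g ` {..<M})" and i: "y = g i" by auto
      have "x \<in> hspan R H' (g ` {..<max M (Suc i)})"
        by (rule hspan_mono[OF M image_mono]) simp
      then have "h \<otimes> y \<oplus> x \<in> hspan R H' (g ` {..<max M (Suc i)})"
        using step.hyps(1) i by (intro hspan.step) simp_all
      then show ?case ..
    qed (auto intro: hspan.zero)
    then obtain M where M: "x \<in> hspan R H' (g ` {..<M})" ..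
    have "{..<M} \<subseteq> {..<max M N}" "{..<N} \<subseteq> {..<max M N}" by auto
    then have "insert x F \<subseteq> hspan R H' (g ` {..<max M N})"
      using hspan_mono[OF M image_mono] hspan_mono[OF subsetD[OF N] image_mono] by blast
    then show ?case ..
  qed simp
  then obtain N where N: "F \<subseteq> hspan R H' (g ` {..<N})" by blast
  have "g N \<in> J" unfolding J_def by (rule H'.hspan_incl[OF rangeI gc])
  then have "g N \<in> hspan R H' F" using F(3) by (rule rev_subsetD)
  moreover have "g ` {..<N} \<subseteq> carrier R" using gc by (simp add: image_subset_iff)
  ultimately have "g N \<in> hspan R H' (g ` {..<N})" by (rule H'.hspan_trans[OF _ N])
  then show "\<exists>N. g N \<in> hspan R (\<Union>d. V d) (g ` {..<N})" unfolding H'_def ..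
qed

end

end

section \<open>Induction on the generators of a ring\<close>

context cring
begin

lemma generate_ring_cring_subring: "S \<subseteq> carrier R \<Longrightarrow> cring_subring R (generate_ring R S)"
  using subcringI'[OF generate_ring_is_subring[of S]] is_cring
  by (simp add: cring_subring_def subcring_def)

lemma generate_ring_insert:
  assumes "S \<subseteq> carrier R" "t \<in> carrier R"
  shows "generate_ring R (insert t S) = (\<Union>d. poly_values R (generate_ring R S) t d)"
proof
  let ?H = "generate_ring R S" and ?G = "generate_ring R (insert t S)"
  interpret cring_subring R ?H using assms(1) by (rule generate_ring_cring_subring)
  interpret P: subcring "\<Union>d. poly_values R ?H t d" R by (rule poly_values_subring[OF assms(2)])
  have H1: "h \<in> poly_values R ?H t (Suc 0)" if "h \<in> ?H" for h
    using that by (auto intro!: exI[of _ h])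
  have t2: "t \<in> poly_values R ?H t (Suc (Suc 0))"
    using poly_values_t[OF assms(2) H1[of \<one>]] assms(2) by simp
  show "?G \<subseteq> (\<Union>d. poly_values R ?H t d)"
  proof (rule generate_ring_min_subring1)
    show "insert t S \<subseteq> (\<Union>d. poly_values R ?H t d)"
      using H1[OF generate_ring.incl] t2 by blast
  qed (use assms P.subring_axioms in auto)
  interpret G: cring_subring R ?G using assms by (intro generate_ring_cring_subring) auto
  have sub: "?H \<subseteq> ?G"
    using assms by (intro generate_ring_min_subring1 G.H.subring_axioms) (auto intro: generate_ring.incl)
  have "p \<in> ?G" if "p \<in> poly_values R ?H t d" for p d
    using that
  proof (induction d arbitrary: p)
    case (Suc d)
    then obtain r p' where "p = r \<otimes> t [^] d \<oplus> p'" "r \<in> ?G" "p' \<in> ?G" using sub by auto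
    moreover have "t \<in> ?G" by (rule generate_ring.incl) simp
    ultimately show ?case by simp
  qed simp
  then show "(\<Union>d. poly_values R ?H t d) \<subseteq> ?G" by blast
qed

text \<open>The prime ring is the image of the integers, so division with remainder applies. Take
  the least positive \<open>z\<close> whose image lies in the span of some initial segment, of
  length \<open>N\<close> say. The remainder of \<open>k N\<close> modulo \<open>z\<close> has its
  image in the span of the segment of length \<open>Suc N\<close>, hence vanishes by minimality, and
  \<open>f N\<close> is a multiple of the image of \<open>z\<close>.\<close>

lemma noetherian_on_prime_ring: "noetherian_on R (generate_ring R {})"
  unfolding noetherian_on_def
proof (intro allI impI)
  fix f :: "nat \<Rightarrow> 'a"
  let ?H = "generate_ring R {}"
  assume f: "range f \<subseteq> ?H"
  interpret cring_subring R ?H by (rule generate_ring_cring_subring) simp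
  define c where "c = (\<lambda>k::int. [k] \<cdot> \<one>)"
  have c_add: "c (a + b) = c a \<oplus> c b" for a b unfolding c_def by (rule add.int_pow_mult) simp
  have c_mult: "c (a * b) = c a \<otimes> c b" for a b
    unfolding c_def by (simp add: add_pow_ldistr_int add.int_pow_pow mult.commute)
  have c_neg: "c (- a) = \<ominus> c a" for a unfolding c_def by (simp add: add.int_pow_neg)
  have c_1: "c 1 = \<one>" and c_0: "c 0 = \<zero>" unfolding c_def by (simp_all add: add_pow_def int_pow_def2 nat_pow_def)
  have "x \<in> ?H \<Longrightarrow> \<exists>k. x = c k" for x
  proof (induction rule: generate_ring.induct)
    case one show ?case using c_1 by metis
  qed (auto simp flip: c_add c_mult c_neg)
  then have "\<forall>n. \<exists>k. f n = c k" using f by blast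
  then obtain k where k: "\<And>n. f n = c (k n)" by metis
  have cH: "c a \<in> ?H" for a
  proof (induction a rule: int_induct[where k = 0])
    case base then show ?case by (simp add: c_0)
  next
    case (step1 i) then show ?case by (simp add: c_add c_1)
  next
    case (step2 i)
    have "c (i - 1) = c i \<oplus> \<ominus> \<one>" using c_add[of i "-1"] by (simp add: c_neg c_1)
    then show ?case using step2 by simp
  qed
  have fc: "f ` A \<subseteq> carrier R" for A using k cH H_closed(6) by auto
  show "\<exists>N. f N \<in> hspan R ?H (f ` {..<N})"
  proof (cases "k 0 = 0")
    case True
    then have "f 0 \<in> hspan R ?H (f ` {..<0})" by (simp add: k c_0 hspan.zero)
    then show ?thesis by blast
  next
    case False
    define P where "P = (\<lambda>z::nat. z > 0 \<and> (\<exists>N. c (int z) \<in> hspan R ?H (f ` {..<N})))"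
    have f0: "f 0 \<in> hspan R ?H (f ` {..<1})" using fc by (intro hspan_incl) auto
    then have "c \<bar>k 0\<bar> \<in> hspan R ?H (f ` {..<1})"
      using hspan_neg[OF f0 fc] by (auto simp: abs_if k c_neg)
    then have "P (nat \<bar>k 0\<bar>)" unfolding P_def using False by auto
    then have Pz: "P (LEAST z. P z)" by (rule LeastI)
    define z where "z = (LEAST z. P z)"
    obtain N where z: "z > 0" "c (int z) \<in> hspan R ?H (f ` {..<N})"
      using Pz[folded z_def] unfolding P_def by blast
    have q: "c (k N div int z) \<otimes> c (int z) \<in> hspan R ?H (f ` {..<N})"
      using z(2) cH fc by (intro hspan_smult)
    have "f N \<oplus> \<ominus> (c (k N div int z) \<otimes> c (int z)) \<in> hspan R ?H (f ` {..<Suc N})"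
      by (intro hspan_add hspan_incl fc hspan_neg[OF hspan_mono[OF q image_mono]]) auto
    moreover have "f N \<oplus> \<ominus> (c (k N div int z) \<otimes> c (int z)) = c (k N mod int z)"
      unfolding k by (simp flip: c_mult c_neg c_add) (simp add: minus_div_mult_eq_mod)
    ultimately have m: "c (k N mod int z) \<in> hspan R ?H (f ` {..<Suc N})" by simp
    have "k N mod int z = 0"
    proof (rule ccontr)
      assume nz: "k N mod int z \<noteq> 0"
      have ge: "k N mod int z \<ge> 0" "k N mod int z < int z" using z(1) by auto
      then have "P (nat (k N mod int z))" unfolding P_def using m nz by auto
      then have "z \<le> nat (k N mod int z)" unfolding z_def by (rule Least_le)
      then show False using ge by linarith
    qed
    then have "k N = k N div int z * int z" by (simp add: mod_eq_0_iff_dvd)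
    then have "f N = c (k N div int z) \<otimes> c (int z)" unfolding k c_mult[symmetric] by simp
    with q have "f N \<in> hspan R ?H (f ` {..<N})" by (simp only:)
    then show ?thesis ..
  qed
qed

theorem noetherian_on_generate_ring:
  assumes "finite S" "S \<subseteq> carrier R"
  shows "noetherian_on R (generate_ring R S)"
  using assms
proof (induction S rule: finite_induct)
  case (insert t S)
  interpret cring_subring R "generate_ring R S"
    using insert.prems by (intro generate_ring_cring_subring) simp
  show ?case
    using insert noetherian_on_poly_values[of t] by (simp add: generate_ring_insert)
qed (simp add: noetherian_on_prime_ring)

end

section \<open>Krull's intersection theorem\<close>

context cring
begin

lemma ideal_pow_ideal:
  assumes "ideal I R"
  shows "ideal (I [^]\<^bsub>ideals_set R\<^esub> (n::nat)) R"
proof -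
  interpret M: comm_monoid "ideals_set R" by (rule ideals_set_is_comm_monoid)
  have "I [^]\<^bsub>ideals_set R\<^esub> n \<in> carrier (ideals_set R)"
    using assms by (intro M.nat_pow_closed) (simp add: ideals_set_def)
  then show ?thesis by (simp add: ideals_set_def)
qed

lemma ideal_pow_mult_mem:
  assumes "ideal I R" "a \<in> I [^]\<^bsub>ideals_set R\<^esub> (j::nat)" "b \<in> I [^]\<^bsub>ideals_set R\<^esub> (k::nat)"
  shows "a \<otimes> b \<in> I [^]\<^bsub>ideals_set R\<^esub> (j + k)"
proof -
  interpret M: comm_monoid "ideals_set R" by (rule ideals_set_is_comm_monoid)
  have "I \<in> carrier (ideals_set R)" using assms(1) by (simp add: ideals_set_def)
  from M.nat_pow_mult[OF this, of j k] ideal_prod.prod[OF assms(2,3), of R]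
  show ?thesis by (simp add: ideals_set_def)
qed

lemma ideals_set_one: "\<one>\<^bsub>ideals_set R\<^esub> = carrier R"
  by (simp add: ideals_set_def)

lemma ideal_pow_Suc: "I [^]\<^bsub>ideals_set R\<^esub> Suc n = (I [^]\<^bsub>ideals_set R\<^esub> n) \<cdot> I"
  by (simp add: nat_pow_def ideals_set_def)

lemma ideal_pow_subset:
  assumes "ideal I R" "0 < n"
  shows "I [^]\<^bsub>ideals_set R\<^esub> (n::nat) \<subseteq> I"
proof -
  obtain k where "n = Suc k" using assms(2) gr0_implies_Suc by blast
  then have "I [^]\<^bsub>ideals_set R\<^esub> n = (I [^]\<^bsub>ideals_set R\<^esub> k) \<cdot> I" by (simp only: ideal_pow_Suc)
  then show ?thesis
    using ideal_prod_inter[OF ideal_pow_ideal[OF assms(1)] assms(1)] by blast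
qed

lemma mps_add_apply: "(f \<oplus>\<^bsub>mps R\<^esub> g) k = f k \<oplus> g k"
  by (simp add: mps_def)

lemma mps_mult_apply: "(f \<otimes>\<^bsub>mps R\<^esub> g) k = (\<Oplus>a\<in>{a. a \<subseteq># k}. f a \<otimes> g (k - a))"
  by (simp add: mps_def)

text \<open>The powers of the variable \<open>None\<close> record the power of \<open>I\<close> that contains the coefficient: the
  series in question form the Rees algebra of \<open>I\<close>, with a further variable \<open>Some e\<close> for each
  \<open>e \<in> E\<close>. It is noetherian, and comparing coefficients in a relation between the elements
  \<open>\<Sum>\<^sub>e c n e \<cdot> None\<^sup>n \<cdot> Some e\<close> yields the claim.\<close>

lemma ideal_pow_sequence:
  fixes c :: "nat \<Rightarrow> 'e \<Rightarrow> 'a" and P :: "('e \<Rightarrow> 'a) \<Rightarrow> bool"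
  assumes fg: "finitely_generated_ring R" and I: "ideal I R" and E: "finite E"
    and c: "\<And>n e. c n e \<in> I [^]\<^bsub>ideals_set R\<^esub> n" and c0: "\<And>n e. e \<notin> E \<Longrightarrow> c n e = \<zero>"
    and P0: "P (\<lambda>e. \<zero>)"
    and Pstep: "\<And>a i v. a \<in> I \<Longrightarrow> P v \<Longrightarrow> P (\<lambda>e. a \<otimes> c i e \<oplus> v e)"
  shows "\<exists>n. P (c n)"
proof -
  obtain S where S: "finite S" "S \<subseteq> carrier R" "generate_ring R S = carrier R"
    using fg by (auto simp: finitely_generated_ring_def)
  interpret I: ideal I R by (rule I)
  have T: "cring_subring R (carrier R)"
    using generate_ring_cring_subring[OF S(2)] by (simp only: S(3))
  have "noetherian_on R (carrier R)" using noetherian_on_generate_ring[OF S(1,2)] by (simp only: S(3))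
  then obtain F where F: "F \<subseteq> I" "finite F" "I \<subseteq> hspan R (carrier R) F"
    using cring_subring.noetherian_on_finite_span[OF T _ I.a_subset] by blast
  have cc: "c n e \<in> carrier R" for n e by (rule ideal.Icarr[OF ideal_pow_ideal[OF I] c])
  interpret M: cring "mps R :: ('e option multiset \<Rightarrow> 'a) ring" by (rule mps_cring)
  let ?M = "mps R :: ('e option multiset \<Rightarrow> 'a) ring"
  \<comment> \<open>Finitely many generators: those of the ring, the variables
    \<open>Some e\<close>, and \<open>None\<close> times the generators of \<open>I\<close>. The
    variables \<open>Some e\<close> pack a vector indexed by \<open>E\<close> into one element, so
    that a noetherian ring can be used in place of a noetherian module.\<close>
  define G where "G = monom_fun R {#} ` S \<union> (\<lambda>e. monom_fun R {#Some e#} \<one>) ` E \<union> monom_fun R {#None :: 'e option#} ` F"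
  define C where "C = generate_ring ?M G"
  have mc: "b \<in> carrier R \<Longrightarrow> monom_fun R a b \<in> carrier ?M" for a b
    by (auto simp: monom_fun_def mps_def)
  have Fc: "F \<subseteq> carrier R" using F(1) I.a_subset by blast
  have G: "finite G" "G \<subseteq> carrier ?M" unfolding G_def using S(1,2) E F(2) Fc by (auto intro!: mc)
  interpret C: cring_subring ?M C unfolding C_def by (rule M.generate_ring_cring_subring[OF G(2)])
  have noeth: "noetherian_on ?M C" unfolding C_def by (rule M.noetherian_on_generate_ring[OF G])
  have GC: "x \<in> G \<Longrightarrow> x \<in> C" for x unfolding C_def by (rule generate_ring.incl)
  have const: "monom_fun R {#} a \<in> C" if "a \<in> carrier R" for a
  proof -
    have "a \<in> generate_ring R S" using that S(3) by simp
    then show ?thesis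
    proof (induction rule: generate_ring.induct)
      case one
      have "monom_fun R {#} \<one> = \<one>\<^bsub>?M\<^esub>" by (auto simp: monom_fun_def mps_def)
      then show ?case by simp
    next
      case (incl h)
      then show ?case by (intro GC) (simp add: G_def)
    next
      case (a_inv h)
      have h: "h \<in> carrier R" using a_inv.hyps generate_ring_in_carrier[OF S(2)] by blast
      have "\<ominus>\<^bsub>?M\<^esub> monom_fun R {#} h = monom_fun R {#} (\<ominus> h)"
        using h by (subst mps_a_inv) (auto simp: monom_fun_def mc[unfolded monom_fun_def])
      then show ?case using C.H_closed(5)[OF a_inv.IH] by simp
    next
      case (eng_add h k)
      have h: "h \<in> carrier R" "k \<in> carrier R"
        using eng_add.hyps generate_ring_in_carrier[OF S(2)] by blast+
      show ?case using C.H_closed(4)[OF eng_add.IH] monom_add[OF h, of "{#} :: 'e option multiset"] by simp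
    next
      case (eng_mult h k)
      have h: "h \<in> carrier R" "k \<in> carrier R"
        using eng_mult.hyps generate_ring_in_carrier[OF S(2)] by blast+
      show ?case using C.H_closed(3)[OF eng_mult.IH] monom_mult[OF h, of "{#} :: 'e option multiset" "{#}"] by simp
    qed
  qed
  have monI: "monom_fun R {#None#} a \<in> C" if "a \<in> I" for a
  proof -
    have "a \<in> hspan R (carrier R) F" using that F(3) by blast
    then show ?thesis
    proof (induction rule: hspan.induct)
      case zero
      have "monom_fun R {#None#} \<zero> = \<zero>\<^bsub>?M\<^esub>" by (auto simp: monom_fun_def mps_def)
      then show ?case by simp
    next
      case (step h g y)
      have cl: "g \<in> carrier R" "y \<in> carrier R"
        using step.hyps Fc cring_subring.hspan_carrier[OF T step.hyps(3)] by auto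
      have "monom_fun R {#None#} g \<in> C" using step.hyps(2) by (intro GC) (simp add: G_def)
      with const[OF step.hyps(1)] have "monom_fun R {#} h \<otimes>\<^bsub>?M\<^esub> monom_fun R {#None#} g \<in> C" by simp
      then have "monom_fun R {#None#} (h \<otimes> g) \<in> C"
        using monom_mult[OF step.hyps(1) cl(1), of "{#}" "{#None :: 'e option#}"] by simp
      with step.IH show ?case
        using C.H_closed(4) monom_add[of "h \<otimes> g" y "{#None :: 'e option#}"] cl step.hyps(1) by fastforce
    qed
  qed
  have mon: "monom_fun R (replicate_mset n None) a \<in> C" if "a \<in> I [^]\<^bsub>ideals_set R\<^esub> n" for n a
    using that
  proof (induction n arbitrary: a)
    case 0
    then show ?case using const by (simp add: ideals_set_one)
  next
    case (Suc n)
    have pc: "x \<in> I [^]\<^bsub>ideals_set R\<^esub> k \<Longrightarrow> x \<in> carrier R" for x and k :: nat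
      using ideal.Icarr[OF ideal_pow_ideal[OF I]] .
    from Suc.prems have "a \<in> (I [^]\<^bsub>ideals_set R\<^esub> n) \<cdot> I" by (simp only: ideal_pow_Suc)
    then show ?case
    proof (induction rule: ideal_prod.induct)
      case (prod i j)
      have "monom_fun R (replicate_mset n None) i \<otimes>\<^bsub>?M\<^esub> monom_fun R {#None#} j \<in> C"
        using Suc.IH[OF prod(1)] monI[OF prod(2)] by simp
      then show ?case using monom_mult[of i j "replicate_mset n (None :: 'e option)" "{#None#}"] pc[OF prod(1)] prod(2) by simp
    next
      case (sum s t)
      have "s \<in> carrier R" "t \<in> carrier R"
        using sum.hyps ideal_prod_in_carrier[OF ideal_pow_ideal[OF I] I] by blast+
      then show ?case using C.H_closed(4)[OF sum.IH] monom_add[of s t "replicate_mset (Suc n) (None :: 'e option)"] by simp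
    qed
  qed
  define m where "m n e = add_mset (Some e) (replicate_mset n None)" for n :: nat and e :: 'e
  define f where "f n = (\<lambda>k. \<Oplus>e\<in>E. monom_fun R (m n e) (c n e) k)" for n
  have mfc: "monom_fun R a b k \<in> carrier R" if "b \<in> carrier R" for a b and k :: "'e option multiset"
    using that by (simp add: monom_fun_def)
  have fC: "f n \<in> C" for n
  proof -
    have "(\<lambda>k. \<Oplus>e\<in>E'. monom_fun R (m n e) (c n e) k) \<in> C" if "finite E'" "E' \<subseteq> E" for E'
      using that
    proof (induction E' rule: finite_induct)
      case empty
      have "(\<lambda>k. \<zero>) = \<zero>\<^bsub>?M\<^esub>" by (simp add: mps_def)
      then show ?case by simp
    next
      case (insert e E')
      have "monom_fun R {#Some e#} \<one> \<in> C" using insert.prems by (intro GC) (simp add: G_def)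
      then have "monom_fun R {#Some e#} \<one> \<otimes>\<^bsub>?M\<^esub> monom_fun R (replicate_mset n None) (c n e) \<in> C"
        using mon[OF c] by simp
      then have 1: "monom_fun R (m n e) (c n e) \<in> C"
        by (simp add: monom_mult cc m_def)
      have "(\<lambda>k. \<Oplus>e\<in>insert e E'. monom_fun R (m n e) (c n e) k)
        = monom_fun R (m n e) (c n e) \<oplus>\<^bsub>?M\<^esub> (\<lambda>k. \<Oplus>e\<in>E'. monom_fun R (m n e) (c n e) k)"
        using insert.hyps by (intro ext) (simp add: mps_add_apply mfc cc)
      then show ?case using 1 insert by simp
    qed
    from this[OF E order_refl] show ?thesis by (simp only: f_def)
  qed
  have m_inj: "m n e = m i e' \<longleftrightarrow> n = i \<and> e = e'" for n i e e'
  proof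
    assume *: "m n e = m i e'"
    from arg_cong[OF *, of size] have "n = i" by (simp add: m_def)
    with * show "n = i \<and> e = e'" by (simp add: m_def)
  qed simp
  have f_m: "f n (m n e) = c n e" for n e
  proof (cases "e \<in> E")
    case True
    have "f n (m n e) = (\<Oplus>e'\<in>E. if e = e' then c n e' else \<zero>)"
      unfolding f_def monom_fun_def m_inj by simp
    also have "\<dots> = c n e" using True E cc by (intro add.finprod_singleton) auto
    finally show ?thesis .
  next
    case False
    then have "f n (m n e) = \<zero>"
      unfolding f_def monom_fun_def m_inj by (intro add.finprod_one_eqI) auto
    then show ?thesis using False c0 by simp
  qed
  have f_0: "f n k = \<zero>" if "\<And>e. k \<noteq> m n e" for n k
    unfolding f_def monom_fun_def using that by (intro add.finprod_one_eqI) auto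
  have fc: "f n k \<in> carrier R" for n k
    unfolding f_def using cc by (intro finsum_closed) (auto simp: mfc)
  \<comment> \<open>A converse to \<open>mon\<close>: it holds for the generators and survives sums
    and products. It will place the coefficients of the linear relation in \<open>I\<close>.\<close>
  have Rees: "p k \<in> I [^]\<^bsub>ideals_set R\<^esub> count k None" if "p \<in> C" for p k
    using that unfolding C_def
  proof (induction arbitrary: k rule: generate_ring.induct)
    case one
    show ?case
      using additive_subgroup.zero_closed[OF ideal.axioms(1)[OF ideal_pow_ideal[OF I]]]
      by (simp add: mps_def ideals_set_one)
  next
    case (incl h)
    have 1: "carrier R \<otimes>\<^bsub>ideals_set R\<^esub> I = I"
      using ideal_prod_one[OF I] ideal_prod_commute[OF I oneideal] by (simp add: ideals_set_def)
    have z: "\<zero> \<in> I [^]\<^bsub>ideals_set R\<^esub> count k None"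
      using additive_subgroup.zero_closed[OF ideal.axioms(1)[OF ideal_pow_ideal[OF I]]] .
    show ?case using incl S(2) F(1) z by (auto simp: G_def monom_fun_def ideals_set_one 1)
  next
    case (a_inv h)
    have "h \<in> carrier ?M" using a_inv.hyps M.generate_ring_in_carrier[OF G(2)] by blast
    then show ?case
      using additive_subgroup.a_inv_closed[OF ideal.axioms(1)[OF ideal_pow_ideal[OF I]] a_inv.IH]
      by (simp add: mps_a_inv)
  next
    case (eng_add g h)
    then show ?case
      using additive_subgroup.a_closed[OF ideal.axioms(1)[OF ideal_pow_ideal[OF I]]]
      by (simp add: mps_add_apply)
  next
    case (eng_mult g h)
    interpret K: ideal "I [^]\<^bsub>ideals_set R\<^esub> count k None" R by (rule ideal_pow_ideal[OF I])
    have gh: "g a \<otimes> h (k - a) \<in> I [^]\<^bsub>ideals_set R\<^esub> count k None" if "a \<subseteq># k" for a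
    proof -
      have "count k None = count a None + count (k - a) None"
        using that by (simp add: mset_subset_eq_count)
      then show ?thesis using ideal_pow_mult_mem[OF I eng_mult.IH(1)[of a] eng_mult.IH(2)[of "k - a"]] by simp
    qed
    have "(\<Oplus>a\<in>A. g a \<otimes> h (k - a)) \<in> I [^]\<^bsub>ideals_set R\<^esub> count k None"
      if "finite A" "A \<subseteq> {a. a \<subseteq># k}" for A
      using that
    proof (induction A rule: finite_induct)
      case empty
      then show ?case by simp
    next
      case (insert a A)
      then have "g a \<otimes> h (k - a) \<in> I [^]\<^bsub>ideals_set R\<^esub> count k None" using gh by simp
      moreover have "(\<lambda>a. g a \<otimes> h (k - a)) \<in> A \<rightarrow> carrier R"
        using gh insert.prems K.Icarr by auto
      ultimately show ?case using insert K.Icarr by (simp add: finsum_insert)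
    qed
    from this[OF finite_submultisets order_refl] show ?case by (simp add: mps_mult_apply)
  qed
  have "range f \<subseteq> C" using fC by blast
  then obtain N where N: "f N \<in> hspan ?M C (f ` {..<N})"
    using noeth unfolding noetherian_on_def by blast
  \<comment> \<open>\<open>P\<close> abstracts membership in the span of the vectors
    \<open>c i\<close> with coefficients in \<open>I\<close>. Reading off the coefficients at
    \<open>m N e\<close> turns each term of the relation into one application of
    \<open>Pstep\<close>.\<close>
  have "P (\<lambda>e. y (m N e))" if "y \<in> hspan ?M C (f ` {..<N})" for y
    using that
  proof (induction rule: hspan.induct)
    case zero
    then show ?case using P0 by (simp add: mps_def)
  next
    case (step h g y)
    obtain i where i: "i < N" "g = f i" using step.hyps(2) by auto
    let ?t = "replicate_mset (N - i) (None :: 'e option)"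
    have hc: "h k \<in> carrier R" for k
      using step.hyps(1) C.H_closed(6) mps_memD by blast
    \<comment> \<open>As \<open>i < N\<close> is strict, \<open>?t\<close> contains
      \<open>None\<close> at least once, which puts its coefficient into \<open>I\<close>.\<close>
    have "h ?t \<in> I" using Rees[OF step.hyps(1), of ?t] ideal_pow_subset[OF I, of "N - i"] i(1) by auto
    \<comment> \<open>Every monomial of \<open>g\<close> contains exactly one variable
      \<open>Some e'\<close>, and \<open>m N e\<close> contains only \<open>Some e\<close>. The
      complementary factor is therefore a power of \<open>None\<close>, namely
      \<open>?t\<close>.\<close>
    moreover have "(h \<otimes>\<^bsub>?M\<^esub> g) (m N e) = h ?t \<otimes> c i e" for e
    proof -
      have mN: "m N e = ?t + m i e"
        using i(1) by (simp add: m_def multiset_eq_iff)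
      have "(h \<otimes>\<^bsub>?M\<^esub> g) (m N e) = (\<Oplus>a\<in>{a. a \<subseteq># m N e}. if ?t = a then h ?t \<otimes> c i e else \<zero>)"
        unfolding mps_mult_apply
      proof (rule add.finprod_cong')
        fix a assume "a \<in> {a. a \<subseteq># m N e}"
        then have a: "m N e = a + (m N e - a)" by simp
        show "h a \<otimes> g (m N e - a) = (if ?t = a then h ?t \<otimes> c i e else \<zero>)"
        proof (cases "\<exists>e'. m N e - a = m i e'")
          case True
          then obtain e' where e': "m N e - a = m i e'" ..
          have "Some e' \<in># m N e - a" unfolding e' by (simp add: m_def)
          then have "Some e' \<in># m N e" by (rule in_diffD)
          then have "e' = e" by (simp add: m_def split: if_splits)
          then have "a + m i e = ?t + m i e" using a mN e' by simp
          then have "a = ?t" by simp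
          then show ?thesis using e' \<open>e' = e\<close> i(2) by (simp add: f_m)
        next
          case False
          then have "g (m N e - a) = \<zero>" unfolding i(2) by (intro f_0) blast
          moreover have "?t \<noteq> a" using False mN by auto
          ultimately show ?thesis using hc by simp
        qed
      qed (use hc cc in auto)
      also have "\<dots> = h ?t \<otimes> c i e"
        using hc cc mN finite_submultisets by (intro add.finprod_singleton) auto
      finally show ?thesis .
    qed
    ultimately show ?case using Pstep[of "h ?t" "\<lambda>e. y (m N e)" i] step.IH by (simp add: mps_add_apply)
  qed
  from this[OF N] show ?thesis by (auto simp: f_m)
qed

end

section \<open>Separatedness over the localization\<close>

text \<open>Let \<open>x\<close> lie in every \<open>I^n M\<close>. For each \<open>n\<close> some
  \<open>s n\<close> outside \<open>I\<close> makes \<open>s n\<close> times \<open>x\<close> a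
  combination of the generators with coefficients \<open>c n\<close> in \<open>I^n\<close>. By
  \<open>ideal_pow_sequence\<close>, for some \<open>n\<close> this combination equals
  \<open>q\<close> times \<open>x\<close> with \<open>q\<close> in \<open>I\<close>, so
  \<open>s n - q\<close> kills \<open>x\<close>; being outside \<open>I\<close>, it acts
  invertibly.\<close>

theorem localized_module_adically_separated:
  fixes A :: "('a, 'x) ring_scheme" and M :: "(('a \<times> 'a) set, 'c, 'y) module_scheme"
  assumes A: "cring A" "finitely_generated_ring A" and I: "maximalideal I A"
    and M: "finitely_generated_module (localize_at A I) M"
  shows "adically_separated A I (restrict_scalars (localize_map A I) M)"
proof -
  interpret A: cring A by fact
  interpret maximalideal I A by (rule I)
  define D where "D = carrier A - I"
  interpret D: mult_subset A D unfolding D_def by (rule maximal_ideal_complement[OF A(1) I])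
  define B where "B = localize_at A I"
  have B: "B = localization A D" by (simp add: B_def localize_at_def D_def)
  obtain E where E: "finite E" "E \<subseteq> carrier M"
    and span: "carrier M = {\<Oplus>\<^bsub>M\<^esub>s\<in>E. c s \<odot>\<^bsub>M\<^esub> s |c. c \<in> E \<rightarrow> carrier B}"
    using M by (auto simp: finitely_generated_module_def B_def)
  interpret M: module B M using M by (simp add: finitely_generated_module_def B_def)
  define \<phi> where "\<phi> = localize_map A I"
  have \<phi>: "\<phi> a = loc_frac A D a \<one>\<^bsub>A\<^esub>" for a by (simp add: \<phi>_def localize_map_def D_def)
  interpret \<phi>: ring_hom_cring A B \<phi>
    using localize_map_hom[OF A(1) I] A(1) M.R.is_cring
    by (simp add: ring_hom_cring_def ring_hom_cring_axioms_def \<phi>_def B_def)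
  \<comment> \<open>Here the localization enters: elements outside \<open>I\<close> become
    invertible and hence act injectively on \<open>M\<close>.\<close>
  have unit: "y = \<zero>\<^bsub>M\<^esub>" if s: "s \<in> D" and y: "y \<in> carrier M" and 0: "\<phi> s \<odot>\<^bsub>M\<^esub> y = \<zero>\<^bsub>M\<^esub>" for s y
  proof -
    have i: "loc_frac A D \<one>\<^bsub>A\<^esub> s \<in> carrier B" unfolding B D.loc_carrier using s by blast
    have "loc_frac A D \<one>\<^bsub>A\<^esub> s \<otimes>\<^bsub>B\<^esub> \<phi> s = \<one>\<^bsub>B\<^esub>"
      unfolding \<phi> B using s D.one_S by (simp add: D.loc_mult D.loc_one) (rule D.loc_frac_eqI, auto)
    then have "y = loc_frac A D \<one>\<^bsub>A\<^esub> s \<odot>\<^bsub>M\<^esub> (\<phi> s \<odot>\<^bsub>M\<^esub> y)"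
      using M.smult_assoc1[OF i _ y, of "\<phi> s"] s y by simp
    then show ?thesis using 0 i by simp
  qed
  define L where "L v = (\<Oplus>\<^bsub>M\<^esub>e\<in>E. \<phi> (v e) \<odot>\<^bsub>M\<^esub> e)" for v
  have Ecl: "e \<in> E \<Longrightarrow> e \<in> carrier M" for e using E(2) by blast
  have L_closed: "L v \<in> carrier M" if "\<And>e. v e \<in> carrier A" for v
    unfolding L_def using that Ecl by (intro M.M.finsum_closed) auto
  have L_add: "L (\<lambda>e. v e \<oplus>\<^bsub>A\<^esub> w e) = L v \<oplus>\<^bsub>M\<^esub> L w"
    if v: "\<And>e. v e \<in> carrier A" and w: "\<And>e. w e \<in> carrier A" for v w
  proof -
    have "L (\<lambda>e. v e \<oplus>\<^bsub>A\<^esub> w e) = (\<Oplus>\<^bsub>M\<^esub>e\<in>E. \<phi> (v e) \<odot>\<^bsub>M\<^esub> e \<oplus>\<^bsub>M\<^esub> \<phi> (w e) \<odot>\<^bsub>M\<^esub> e)"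
      unfolding L_def using v w Ecl by (intro M.M.add.finprod_cong') (auto simp: M.smult_l_distr)
    also have "\<dots> = L v \<oplus>\<^bsub>M\<^esub> L w"
      unfolding L_def using v w Ecl by (intro M.M.finsum_addf) auto
    finally show ?thesis .
  qed
  have L_mult: "L (\<lambda>e. a \<otimes>\<^bsub>A\<^esub> v e) = \<phi> a \<odot>\<^bsub>M\<^esub> L v"
    if a: "a \<in> carrier A" and v: "\<And>e. v e \<in> carrier A" for a v
  proof -
    have "L (\<lambda>e. a \<otimes>\<^bsub>A\<^esub> v e) = (\<Oplus>\<^bsub>M\<^esub>e\<in>E. \<phi> a \<odot>\<^bsub>M\<^esub> (\<phi> (v e) \<odot>\<^bsub>M\<^esub> e))"
      unfolding L_def using a v Ecl by (intro M.M.add.finprod_cong') (auto simp: M.smult_assoc1)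
    also have "\<dots> = \<phi> a \<odot>\<^bsub>M\<^esub> L v"
      unfolding L_def using a v Ecl E(1) by (intro M.finsum_smult_ldistr[symmetric]) auto
    finally show ?thesis .
  qed
  have L_zero: "L (\<lambda>e. \<zero>\<^bsub>A\<^esub>) = \<zero>\<^bsub>M\<^esub>"
    unfolding L_def using Ecl by (intro M.M.add.finprod_one_eqI) auto
  define M' where "M' = restrict_scalars \<phi> M"
  define pw where "pw n = I [^]\<^bsub>ideals_set A\<^esub> n" for n :: nat
  have pw_ideal: "ideal (pw n) A" for n
    unfolding pw_def by (rule A.ideal_pow_ideal[OF is_ideal])
  \<comment> \<open>Elements with coordinates in \<open>I^n\<close> once a denominator is cleared;
    the coordinates then live in the noetherian ring \<open>A\<close>. That \<open>I^n M\<close>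
    lies in \<open>Y n\<close> follows from closure under sums and negation, as the generating
    products belong to it.\<close>
  define Y where "Y n = {x \<in> carrier M. \<exists>s\<in>D. \<exists>c. (\<forall>e. c e \<in> pw n) \<and> (\<forall>e. e \<notin> E \<longrightarrow> c e = \<zero>\<^bsub>A\<^esub>) \<and> \<phi> s \<odot>\<^bsub>M\<^esub> x = L c}" for n
  have Y_0: "\<zero>\<^bsub>M\<^esub> \<in> Y n" for n
  proof -
    interpret K: ideal "pw n" A by (rule pw_ideal)
    show ?thesis unfolding Y_def using L_zero D.one_S
      by (auto intro!: bexI[of _ "\<one>\<^bsub>A\<^esub>"] exI[of _ "\<lambda>e. \<zero>\<^bsub>A\<^esub>"])
  qed
  have Y_add: "x \<oplus>\<^bsub>M\<^esub> y \<in> Y n" if "x \<in> Y n" "y \<in> Y n" for x y n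
  proof -
    interpret K: ideal "pw n" A by (rule pw_ideal)
    have xc: "x \<in> carrier M" and "\<exists>s\<in>D. \<exists>c. (\<forall>e. c e \<in> pw n) \<and> (\<forall>e. e \<notin> E \<longrightarrow> c e = \<zero>\<^bsub>A\<^esub>) \<and> \<phi> s \<odot>\<^bsub>M\<^esub> x = L c"
      using \<open>x \<in> Y n\<close> unfolding Y_def by simp_all
    then obtain s c where x: "x \<in> carrier M" "s \<in> D" "\<forall>e. c e \<in> pw n" "\<forall>e. e \<notin> E \<longrightarrow> c e = \<zero>\<^bsub>A\<^esub>"
        "\<phi> s \<odot>\<^bsub>M\<^esub> x = L c" by (elim bexE exE conjE)
    have yc: "y \<in> carrier M" and "\<exists>t\<in>D. \<exists>d. (\<forall>e. d e \<in> pw n) \<and> (\<forall>e. e \<notin> E \<longrightarrow> d e = \<zero>\<^bsub>A\<^esub>) \<and> \<phi> t \<odot>\<^bsub>M\<^esub> y = L d"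
      using \<open>y \<in> Y n\<close> unfolding Y_def by simp_all
    then obtain t d where y: "y \<in> carrier M" "t \<in> D" "\<forall>e. d e \<in> pw n" "\<forall>e. e \<notin> E \<longrightarrow> d e = \<zero>\<^bsub>A\<^esub>"
        "\<phi> t \<odot>\<^bsub>M\<^esub> y = L d" by (elim bexE exE conjE)
    have st: "s \<in> carrier A" "t \<in> carrier A" using x(2) y(2) by auto
    have cd: "\<And>e. c e \<in> carrier A" "\<And>e. d e \<in> carrier A" using x(3) y(3) K.Icarr by auto
    have "\<phi> (s \<otimes>\<^bsub>A\<^esub> t) \<odot>\<^bsub>M\<^esub> (x \<oplus>\<^bsub>M\<^esub> y) = \<phi> (t \<otimes>\<^bsub>A\<^esub> s) \<odot>\<^bsub>M\<^esub> x \<oplus>\<^bsub>M\<^esub> \<phi> (s \<otimes>\<^bsub>A\<^esub> t) \<odot>\<^bsub>M\<^esub> y"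
      using st x(1) y(1) by (simp add: M.smult_r_distr A.m_comm[of s t])
    also have "\<dots> = \<phi> t \<odot>\<^bsub>M\<^esub> L c \<oplus>\<^bsub>M\<^esub> \<phi> s \<odot>\<^bsub>M\<^esub> L d"
      using st x(1) y(1) by (simp add: M.smult_assoc1 x(5) y(5))
    also have "\<dots> = L (\<lambda>e. t \<otimes>\<^bsub>A\<^esub> c e \<oplus>\<^bsub>A\<^esub> s \<otimes>\<^bsub>A\<^esub> d e)"
      using st cd by (simp add: L_add L_mult)
    finally have eq: "\<phi> (s \<otimes>\<^bsub>A\<^esub> t) \<odot>\<^bsub>M\<^esub> (x \<oplus>\<^bsub>M\<^esub> y) = L (\<lambda>e. t \<otimes>\<^bsub>A\<^esub> c e \<oplus>\<^bsub>A\<^esub> s \<otimes>\<^bsub>A\<^esub> d e)" .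
    have "t \<otimes>\<^bsub>A\<^esub> c e \<oplus>\<^bsub>A\<^esub> s \<otimes>\<^bsub>A\<^esub> d e \<in> pw n" for e
      using st x(3) y(3) by (auto intro!: K.a_closed K.I_l_closed)
    moreover have "e \<notin> E \<Longrightarrow> t \<otimes>\<^bsub>A\<^esub> c e \<oplus>\<^bsub>A\<^esub> s \<otimes>\<^bsub>A\<^esub> d e = \<zero>\<^bsub>A\<^esub>" for e
      using st x(4) y(4) by simp
    moreover have "s \<otimes>\<^bsub>A\<^esub> t \<in> D" using x(2) y(2) by (rule D.mult_S)
    ultimately show ?thesis unfolding Y_def using eq x(1) y(1)
      by (intro CollectI conjI M.M.a_closed bexI[of _ "s \<otimes>\<^bsub>A\<^esub> t"] exI[of _ "\<lambda>e. t \<otimes>\<^bsub>A\<^esub> c e \<oplus>\<^bsub>A\<^esub> s \<otimes>\<^bsub>A\<^esub> d e"]) auto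
  qed
  have Y_neg: "\<ominus>\<^bsub>M\<^esub> x \<in> Y n" if "x \<in> Y n" for x n
  proof -
    interpret K: ideal "pw n" A by (rule pw_ideal)
    have xc: "x \<in> carrier M" and "\<exists>s\<in>D. \<exists>c. (\<forall>e. c e \<in> pw n) \<and> (\<forall>e. e \<notin> E \<longrightarrow> c e = \<zero>\<^bsub>A\<^esub>) \<and> \<phi> s \<odot>\<^bsub>M\<^esub> x = L c"
      using that unfolding Y_def by simp_all
    then obtain s c where x: "x \<in> carrier M" "s \<in> D" "\<forall>e. c e \<in> pw n" "\<forall>e. e \<notin> E \<longrightarrow> c e = \<zero>\<^bsub>A\<^esub>"
        "\<phi> s \<odot>\<^bsub>M\<^esub> x = L c" by (elim bexE exE conjE)
    have cd: "\<And>e. c e \<in> carrier A" using x(3) K.Icarr by auto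
    have neg: "\<phi> (\<ominus>\<^bsub>A\<^esub> \<one>\<^bsub>A\<^esub>) \<odot>\<^bsub>M\<^esub> z = \<ominus>\<^bsub>M\<^esub> z" if "z \<in> carrier M" for z
      using that by (simp add: M.smult_l_minus)
    have "\<phi> s \<odot>\<^bsub>M\<^esub> (\<ominus>\<^bsub>M\<^esub> x) = L (\<lambda>e. (\<ominus>\<^bsub>A\<^esub> \<one>\<^bsub>A\<^esub>) \<otimes>\<^bsub>A\<^esub> c e)"
      using x cd L_closed[of c] by (subst L_mult) (auto simp: neg M.smult_r_minus M.smult_l_minus)
    moreover have "(\<ominus>\<^bsub>A\<^esub> \<one>\<^bsub>A\<^esub>) \<otimes>\<^bsub>A\<^esub> c e \<in> pw n" for e using x(3) by (intro K.I_l_closed) auto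
    moreover have "e \<notin> E \<Longrightarrow> (\<ominus>\<^bsub>A\<^esub> \<one>\<^bsub>A\<^esub>) \<otimes>\<^bsub>A\<^esub> c e = \<zero>\<^bsub>A\<^esub>" for e using x(4) by simp
    ultimately show ?thesis unfolding Y_def using x(1,2)
      by (intro CollectI conjI bexI[of _ s] exI[of _ "\<lambda>e. (\<ominus>\<^bsub>A\<^esub> \<one>\<^bsub>A\<^esub>) \<otimes>\<^bsub>A\<^esub> c e"]) auto
  qed
  have Y_gen: "\<phi> a \<odot>\<^bsub>M\<^esub> x \<in> Y n" if a: "a \<in> pw n" and x: "x \<in> carrier M" for a x n
  proof -
    interpret K: ideal "pw n" A by (rule pw_ideal)
    have ac: "a \<in> carrier A" using a K.Icarr by blast
    obtain b where b: "b \<in> E \<rightarrow> carrier B" and xb: "x = (\<Oplus>\<^bsub>M\<^esub>s\<in>E. b s \<odot>\<^bsub>M\<^esub> s)"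
      using x span by blast
    have summand: "\<phi> a \<odot>\<^bsub>M\<^esub> (b e \<odot>\<^bsub>M\<^esub> e) \<in> Y n" if e: "e \<in> E" for e
    proof -
      have be: "b e \<in> carrier B" using b e by blast
      then obtain u s where u: "b e = loc_frac A D u s" "u \<in> carrier A" "s \<in> D"
        unfolding B D.loc_carrier by blast
      define c where "c = (\<lambda>e'. if e = e' then a \<otimes>\<^bsub>A\<^esub> u else \<zero>\<^bsub>A\<^esub>)"
      have sb: "\<phi> s \<otimes>\<^bsub>B\<^esub> b e = \<phi> u"
        unfolding \<phi> B u(1) using u(2,3) D.one_S by (simp add: D.loc_mult) (rule D.loc_frac_eqI, auto simp: A.m_comm)
      have "\<phi> s \<odot>\<^bsub>M\<^esub> (\<phi> a \<odot>\<^bsub>M\<^esub> (b e \<odot>\<^bsub>M\<^esub> e)) = \<phi> a \<odot>\<^bsub>M\<^esub> ((\<phi> s \<otimes>\<^bsub>B\<^esub> b e) \<odot>\<^bsub>M\<^esub> e)"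
        using u(3) ac be Ecl[OF e] by (simp flip: M.smult_assoc1 add: M.R.m_ac)
      also have "\<dots> = \<phi> (a \<otimes>\<^bsub>A\<^esub> u) \<odot>\<^bsub>M\<^esub> e"
        unfolding sb using u(2) ac Ecl[OF e] by (simp add: M.smult_assoc1)
      also have "\<dots> = (\<Oplus>\<^bsub>M\<^esub>e'\<in>E. if e = e' then \<phi> (a \<otimes>\<^bsub>A\<^esub> u) \<odot>\<^bsub>M\<^esub> e' else \<zero>\<^bsub>M\<^esub>)"
        using e E(1) Ecl ac u(2) by (intro M.M.add.finprod_singleton[symmetric]) auto
      also have "\<dots> = L c"
        unfolding L_def using Ecl ac u(2) by (intro M.M.add.finprod_cong') (auto simp: c_def)
      finally have eq: "\<phi> s \<odot>\<^bsub>M\<^esub> (\<phi> a \<odot>\<^bsub>M\<^esub> (b e \<odot>\<^bsub>M\<^esub> e)) = L c" .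
      have "\<forall>e. c e \<in> pw n" using a u(2) by (simp add: c_def K.I_r_closed)
      moreover have "\<forall>e. e \<notin> E \<longrightarrow> c e = \<zero>\<^bsub>A\<^esub>" using e by (auto simp: c_def)
      ultimately show ?thesis unfolding Y_def using eq u(3) be ac Ecl[OF e] by auto
    qed
    have tc: "(\<lambda>e. \<phi> a \<odot>\<^bsub>M\<^esub> (b e \<odot>\<^bsub>M\<^esub> e)) \<in> E \<rightarrow> carrier M" using b ac Ecl by auto
    have "(\<Oplus>\<^bsub>M\<^esub>e\<in>E'. \<phi> a \<odot>\<^bsub>M\<^esub> (b e \<odot>\<^bsub>M\<^esub> e)) \<in> Y n" if "finite E'" "E' \<subseteq> E" for E'
      using that
    proof (induction E' rule: finite_induct)
      case empty
      then show ?case using Y_0 by simp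
    next
      case (insert e E')
      have "(\<Oplus>\<^bsub>M\<^esub>e\<in>insert e E'. \<phi> a \<odot>\<^bsub>M\<^esub> (b e \<odot>\<^bsub>M\<^esub> e))
        = \<phi> a \<odot>\<^bsub>M\<^esub> (b e \<odot>\<^bsub>M\<^esub> e) \<oplus>\<^bsub>M\<^esub> (\<Oplus>\<^bsub>M\<^esub>e\<in>E'. \<phi> a \<odot>\<^bsub>M\<^esub> (b e \<odot>\<^bsub>M\<^esub> e))"
        using insert.hyps insert.prems tc by (intro M.M.finsum_insert) auto
      then show ?case using Y_add[OF summand] insert by simp
    qed
    moreover have "\<phi> a \<odot>\<^bsub>M\<^esub> x = (\<Oplus>\<^bsub>M\<^esub>e\<in>E. \<phi> a \<odot>\<^bsub>M\<^esub> (b e \<odot>\<^bsub>M\<^esub> e))"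
      unfolding xb using E(1) ac b Ecl by (intro M.finsum_smult_ldistr) auto
    ultimately show ?thesis using E(1) by simp
  qed
  have M'_simps: "carrier M' = carrier M" "add M' = add M" "zero M' = zero M"
    by (simp_all add: M'_def restrict_scalars_def)
  have M'_inv: "inv\<^bsub>add_monoid M'\<^esub> h = \<ominus>\<^bsub>M\<^esub> h" for h
    by (simp add: m_inv_def a_inv_def M'_simps)
  have inY: "x \<in> Y n" if "x \<in> ideal_times_module (pw n) M'" for x n
    using that unfolding ideal_times_module_def
  proof (induction rule: generate.induct)
    case one
    then show ?case using Y_0 by (simp add: M'_simps)
  next
    case (incl h)
    then show ?case using Y_gen by (auto simp: M'_def restrict_scalars_def)
  next
    case (inv h)
    then have "h \<in> Y n" using Y_gen by (auto simp: M'_def restrict_scalars_def)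
    then show ?case using Y_neg by (simp add: M'_inv)
  next
    case (eng h k)
    then show ?case using Y_add by (simp add: M'_simps)
  qed
  have "x = \<zero>\<^bsub>M\<^esub>" if x: "\<And>n. x \<in> ideal_times_module (pw n) M'" for x
  proof -
    have "\<forall>n. \<exists>p. fst p \<in> D \<and> (\<forall>e. snd p e \<in> pw n) \<and> (\<forall>e. e \<notin> E \<longrightarrow> snd p e = \<zero>\<^bsub>A\<^esub>)
        \<and> \<phi> (fst p) \<odot>\<^bsub>M\<^esub> x = L (snd p)"
      using inY[OF x] unfolding Y_def by fastforce
    from choice[OF this] obtain p where p: "\<forall>n. fst (p n) \<in> D \<and> (\<forall>e. snd (p n) e \<in> pw n)
        \<and> (\<forall>e. e \<notin> E \<longrightarrow> snd (p n) e = \<zero>\<^bsub>A\<^esub>) \<and> \<phi> (fst (p n)) \<odot>\<^bsub>M\<^esub> x = L (snd (p n))" ..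
    define s c where "s n = fst (p n)" and "c n = snd (p n)" for n
    have s: "s n \<in> D" and c: "c n e \<in> pw n" and c0: "e \<notin> E \<Longrightarrow> c n e = \<zero>\<^bsub>A\<^esub>"
      and sx: "\<phi> (s n) \<odot>\<^bsub>M\<^esub> x = L (c n)" for n e
      using p[rule_format, of n] by (simp_all add: s_def c_def)
    have xc: "x \<in> carrier M" using inY[OF x] unfolding Y_def by blast
    have sc: "s n \<in> carrier A" for n using s by simp
    have cc: "c n e \<in> carrier A" for n e using ideal.Icarr[OF pw_ideal c] .
    \<comment> \<open>Coordinate vectors whose combination of the generators lies in
      \<open>I x\<close>. Since \<open>L (c i)\<close> is \<open>s i\<close> times \<open>x\<close>,
      adding an \<open>I\<close>-multiple of \<open>c i\<close> preserves this.\<close>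
    define P where "P v \<longleftrightarrow> (\<forall>e. v e \<in> carrier A) \<and> (\<exists>q\<in>I. L v = \<phi> q \<odot>\<^bsub>M\<^esub> x)" for v
    have "\<exists>n. P (c n)"
    proof (rule A.ideal_pow_sequence[OF A(2) is_ideal E(1)])
      show "c n e \<in> I [^]\<^bsub>ideals_set A\<^esub> n" for n e using c by (simp add: pw_def)
      show "e \<notin> E \<Longrightarrow> c n e = \<zero>\<^bsub>A\<^esub>" for n e by (rule c0)
      show "P (\<lambda>e. \<zero>\<^bsub>A\<^esub>)" unfolding P_def using xc by (auto simp: L_zero intro!: bexI[of _ "\<zero>\<^bsub>A\<^esub>"])
      show "P (\<lambda>e. a \<otimes>\<^bsub>A\<^esub> c i e \<oplus>\<^bsub>A\<^esub> v e)" if a: "a \<in> I" and v: "P v" for a i v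
      proof -
        obtain q where q: "q \<in> I" "L v = \<phi> q \<odot>\<^bsub>M\<^esub> x" and vc: "\<And>e. v e \<in> carrier A"
          using v unfolding P_def by blast
        have "L (\<lambda>e. a \<otimes>\<^bsub>A\<^esub> c i e \<oplus>\<^bsub>A\<^esub> v e) = \<phi> a \<odot>\<^bsub>M\<^esub> (\<phi> (s i) \<odot>\<^bsub>M\<^esub> x) \<oplus>\<^bsub>M\<^esub> \<phi> q \<odot>\<^bsub>M\<^esub> x"
          using a vc cc q(2) by (simp add: L_add L_mult sx)
        also have "\<dots> = \<phi> (a \<otimes>\<^bsub>A\<^esub> s i \<oplus>\<^bsub>A\<^esub> q) \<odot>\<^bsub>M\<^esub> x"
          using a sc q(1) xc by (simp add: M.smult_l_distr M.smult_assoc1)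
        finally show ?thesis unfolding P_def using a vc cc q(1) sc
          by (auto intro!: bexI[of _ "a \<otimes>\<^bsub>A\<^esub> s i \<oplus>\<^bsub>A\<^esub> q"] a_closed I_r_closed)
      qed
    qed
    then obtain n q where q: "q \<in> I" "L (c n) = \<phi> q \<odot>\<^bsub>M\<^esub> x" unfolding P_def by blast
    have qc: "q \<in> carrier A" using q(1) by simp
    \<comment> \<open>A denominator minus an element of \<open>I\<close> is again a
      denominator.\<close>
    have "s n \<ominus>\<^bsub>A\<^esub> q \<in> D"
    proof -
      have "s n \<in> I" if "s n \<ominus>\<^bsub>A\<^esub> q \<in> I"
      proof -
        have "s n = (s n \<ominus>\<^bsub>A\<^esub> q) \<oplus>\<^bsub>A\<^esub> q" using qc sc[of n] by algebra
        then show ?thesis using a_closed[OF that q(1)] by simp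
      qed
      then show ?thesis using s[of n] qc unfolding D_def by blast
    qed
    moreover have "\<phi> (s n \<ominus>\<^bsub>A\<^esub> q) \<odot>\<^bsub>M\<^esub> x = \<zero>\<^bsub>M\<^esub>"
      using sc qc xc by (simp add: a_minus_def M.smult_l_distr M.smult_l_minus sx q(2) M.M.r_neg)
    ultimately show ?thesis using unit xc by blast
  qed
  moreover have "\<zero>\<^bsub>M\<^esub> \<in> ideal_times_module J M'" for J
    unfolding ideal_times_module_def using generate.one[of "add_monoid M'"] by (simp add: M'_simps)
  ultimately have "(\<Inter>n. ideal_times_module (pw n) M') = {\<zero>\<^bsub>M\<^esub>}" by blast
  then show ?thesis
    by (simp add: adically_separated_def M'_def pw_def \<phi>_def restrict_scalars_def)
qed

section \<open>Homogeneous power series\<close>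

text \<open>These are closure properties only, so they hold as well for the graded pieces of a
  subalgebra generated by a few elements, before those pieces are known to exhaust the ring.\<close>

locale graded_cring = cring +
  fixes W :: "int \<Rightarrow> 'a set"
  assumes W_carrier: "W d \<subseteq> carrier R" and W_zero: "\<zero> \<in> W d"
    and W_add: "a \<in> W d \<Longrightarrow> b \<in> W d \<Longrightarrow> a \<oplus> b \<in> W d" and W_neg: "a \<in> W d \<Longrightarrow> \<ominus> a \<in> W d"
    and W_one: "\<one> \<in> W 0" and W_mult: "a \<in> W d \<Longrightarrow> b \<in> W e \<Longrightarrow> a \<otimes> b \<in> W (d + e)"
begin

lemma W_closed: "a \<in> W d \<Longrightarrow> a \<in> carrier R"
  using W_carrier by blast

lemma W_mult_eq: "a \<in> W d \<Longrightarrow> b \<in> W e \<Longrightarrow> k = d + e \<Longrightarrow> a \<otimes> b \<in> W k"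
  using W_mult by simp

lemma W_finsum: "(\<And>a. a \<in> A \<Longrightarrow> f a \<in> W d) \<Longrightarrow> (\<Oplus>a\<in>A. f a) \<in> W d"
proof (induction A rule: infinite_finite_induct)
  case (insert a A)
  then have "(\<Oplus>a\<in>insert a A. f a) = f a \<oplus> (\<Oplus>a\<in>A. f a)"
    using W_closed by (intro finsum_insert) auto
  then show ?case using insert by (simp add: W_add)
qed (simp_all add: W_zero)

text \<open>Variables count with degree -1, so a series of total degree \<open>-k\<close> has its
  coefficient at a monomial of size \<open>n\<close> in degree \<open>n - k\<close>. Vanishing below
  size \<open>k\<close> is a separate condition because \<open>W\<close> may be nonzero in negative
  degrees.\<close>

definition homog :: "int \<Rightarrow> ('v multiset \<Rightarrow> 'a) set" where
  "homog k = {f. \<forall>m. f m \<in> W (int (size m) - k) \<and> (int (size m) < k \<longrightarrow> f m = \<zero>)}"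

lemma homogD: "f \<in> homog k \<Longrightarrow> f m \<in> W (int (size m) - k)"
  and homog_eq_0: "f \<in> homog k \<Longrightarrow> int (size m) < k \<Longrightarrow> f m = \<zero>"
  by (simp_all add: homog_def)

lemma homog_closed: "f \<in> homog k \<Longrightarrow> f \<in> carrier (mps R)"
  using homogD[THEN W_closed] by (auto intro!: mps_memI)

lemma homog_mult:
  fixes f g :: "'v multiset \<Rightarrow> 'a"
  assumes f: "f \<in> homog j" and g: "g \<in> homog k"
  shows "f \<otimes>\<^bsub>mps R\<^esub> g \<in> homog (j + k)"
proof -
  have eq: "(f \<otimes>\<^bsub>mps R\<^esub> g) m = (\<Oplus>a\<in>{a. a \<subseteq># m}. f a \<otimes> g (m - a))" for m
    by (simp add: mps_def)
  have size: "int (size m) = int (size a) + int (size (m - a))" if "a \<subseteq># m" for a m :: "'v multiset"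
    using that size_mset_mono[OF that] by (simp add: size_Diff_submset)
  have cl: "f a \<in> carrier R" "g a \<in> carrier R" for a
    by (rule W_closed[OF homogD[OF f]], rule W_closed[OF homogD[OF g]])
  show ?thesis unfolding homog_def
  proof (intro CollectI allI conjI impI)
    fix m
    show "(f \<otimes>\<^bsub>mps R\<^esub> g) m \<in> W (int (size m) - (j + k))"
      unfolding eq
    proof (rule W_finsum)
      fix a assume "a \<in> {a. a \<subseteq># m}"
      then show "f a \<otimes> g (m - a) \<in> W (int (size m) - (j + k))"
        using size[of a m] by (intro W_mult_eq[OF homogD[OF f] homogD[OF g]]) simp
    qed
    assume lt: "int (size m) < j + k"
    show "(f \<otimes>\<^bsub>mps R\<^esub> g) m = \<zero>"
      unfolding eq
    proof (rule add.finprod_one_eqI)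
      fix a assume "a \<in> {a. a \<subseteq># m}"
      then have "int (size a) < j \<or> int (size (m - a)) < k" using lt size[of a m] by auto
      then show "f a \<otimes> g (m - a) = \<zero>"
        using homog_eq_0[OF f] homog_eq_0[OF g] cl by auto
    qed
  qed
qed

lemma homog_one: "\<one>\<^bsub>mps R\<^esub> \<in> homog 0"
  using W_one W_zero by (simp add: homog_def mps_def)

lemma homog_indet: "indet R v \<in> homog 1"
  using W_one W_zero by (simp add: homog_def indet_def)

lemma homog_pow: "f \<in> homog 1 \<Longrightarrow> f [^]\<^bsub>mps R\<^esub> (i::nat) \<in> homog (int i)"
proof (induction i)
  case 0
  then show ?case using homog_one by (simp add: nat_pow_def)
next
  case (Suc i)
  then have "f [^]\<^bsub>mps R\<^esub> i \<otimes>\<^bsub>mps R\<^esub> f \<in> homog (int i + 1)" by (intro homog_mult) auto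
  then show ?case by (simp add: nat_pow_def add.commute)
qed

text \<open>The index cancels: \<open>i - 1\<close> from the coefficient and
  \<open>size m - i\<close> from the power add up to \<open>size m - 1\<close>. The condition
  \<open>f 0 = \<zero>\<close> keeps the constant term zero.\<close>

lemma homog_subst1:
  assumes f: "\<And>i. f i \<in> W (int i - 1)" and f0: "f 0 = \<zero>" and g: "g \<in> homog 1"
  shows "subst1 R f g \<in> homog 1"
  unfolding homog_def
proof (intro CollectI allI conjI impI)
  fix m
  show "subst1 R f g m \<in> W (int (size m) - 1)"
    unfolding subst1_def
    by (intro W_finsum W_mult_eq[OF f homogD[OF homog_pow[OF g]]]) simp
  assume "int (size m) < 1"
  then have "size m = 0" by simp
  then show "subst1 R f g m = \<zero>"
    unfolding subst1_def
    using mps_pow_closed[OF homog_closed[OF g], of 0 m] by (intro add.finprod_one_eqI) (simp add: f0)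
qed

lemma homog_subst2:
  assumes F: "\<And>i j. F i j \<in> W (int i + int j - 1)" and F0: "F 0 0 = \<zero>"
    and f: "f \<in> homog 1" and g: "g \<in> homog 1"
  shows "subst2 R F f g \<in> homog 1"
  unfolding homog_def
proof (intro CollectI allI conjI impI)
  fix m
  show "subst2 R F f g m \<in> W (int (size m) - 1)"
    unfolding subst2_def
    by (intro W_finsum W_mult_eq[OF F homogD[OF homog_mult[OF homog_pow[OF f] homog_pow[OF g]]]]) simp
  assume "int (size m) < 1"
  then have "size m = 0" by simp
  then show "subst2 R F f g m = \<zero>"
    unfolding subst2_def
    using mps_powmult_closed[OF homog_closed[OF f] homog_closed[OF g], of 0 0 m]
    by (intro add.finprod_one_eqI) (simp add: F0)
qed

text \<open>In the product of the \<open>i\<close>-th power with one more factor \<open>g\<close>, a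
  first monomial of size below \<open>i\<close> is excluded by the order of the power, and the full
  monomial meets the zero constant term of \<open>g\<close>. One summand remains.\<close>

lemma homog_pow_lead:
  assumes g: "g \<in> homog 1"
  shows "(g [^]\<^bsub>mps R\<^esub> i) (replicate_mset i v) = g {#v#} [^] i"
proof (induction i)
  case 0
  show ?case by (simp add: nat_pow_def) (simp add: mps_def)
next
  case (Suc i)
  let ?r = "replicate_mset (Suc i) v" and ?s = "replicate_mset i v"
  have gc: "g m \<in> carrier R" "(g [^]\<^bsub>mps R\<^esub> i) m \<in> carrier R" for m
    by (rule W_closed[OF homogD[OF g]], rule W_closed[OF homogD[OF homog_pow[OF g]]])
  have "(g [^]\<^bsub>mps R\<^esub> Suc i) ?r = (\<Oplus>a\<in>{a. a \<subseteq># ?r}. (g [^]\<^bsub>mps R\<^esub> i) a \<otimes> g (?r - a))"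
    by (simp add: nat_pow_def) (simp add: mps_def)
  also have "\<dots> = (\<Oplus>a\<in>{a. a \<subseteq># ?r}. if ?s = a then (g [^]\<^bsub>mps R\<^esub> i) ?s \<otimes> g {#v#} else \<zero>)"
  proof (rule add.finprod_cong')
    fix a assume "a \<in> {a. a \<subseteq># ?r}"
    then have a: "a \<subseteq># ?r" by simp
    then obtain j where j: "a = replicate_mset j v" "j \<le> Suc i" by (rule msubseteq_replicate_msetE)
    consider "j < i" | "j = i" | "j = Suc i" using j(2) by linarith
    then show "(g [^]\<^bsub>mps R\<^esub> i) a \<otimes> g (?r - a) = (if ?s = a then (g [^]\<^bsub>mps R\<^esub> i) ?s \<otimes> g {#v#} else \<zero>)"
    proof cases
      case 1
      then have "?s \<noteq> a" using j by (auto dest: arg_cong[of _ _ size])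
      then show ?thesis using homog_eq_0[OF homog_pow[OF g], of a i] 1 j gc by simp
    next
      case 2
      then show ?thesis using j by simp
    next
      case 3
      then have "?s \<noteq> a" using j by (auto dest: arg_cong[of _ _ size])
      moreover have "g (?r - a) = \<zero>" using homog_eq_0[OF g, of "?r - a"] 3 j by simp
      ultimately show ?thesis using gc by simp
    qed
  qed (use gc in auto)
  also have "\<dots> = (g [^]\<^bsub>mps R\<^esub> i) ?s \<otimes> g {#v#}"
    using gc finite_submultisets by (intro add.finprod_singleton) auto
  finally show ?case using Suc.IH by simp
qed

lemma subst1_indet_single:
  assumes "\<And>i. f i \<in> carrier R"
  shows "subst1 R f (indet R v) {#v#} = f 1"
proof -
  have 0: "(indet R v [^]\<^bsub>mps R\<^esub> (0::nat)) {#v#} = \<zero>" by (simp add: nat_pow_def) (simp add: mps_def)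
  have 1: "(indet R v [^]\<^bsub>mps R\<^esub> (1::nat)) {#v#} = \<one>"
    using homog_pow_lead[OF homog_indet[of v], where i = 1 and v = v] by (simp add: indet_def)
  have "{..size {#v#}} = {0, 1}" by auto
  then show ?thesis unfolding subst1_def using 0 1 assms by simp
qed

end

section \<open>Homogeneity of the structure series of a formal module\<close>

text \<open>Homogeneity is assumed for \<open>F\<close> and the scalars; for the series
  \<open>\<rho> b\<close> it is the property to be propagated from generators of \<open>B\<close> to
  all of \<open>B\<close>.\<close>

locale graded_formal_module = graded_cring +
  fixes B :: "('c, 'y) ring_scheme" and \<phi> F \<rho>
  assumes fm: "formal_module B R \<phi> F \<rho>"
    and W_unit: "b \<in> carrier B \<Longrightarrow> \<phi> b \<in> W 0" and W_F: "F i j \<in> W (int i + int j - 1)"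
    and F00: "F 0 0 = \<zero>"
begin

sublocale B: cring B using fm by (simp add: formal_module_def)

definition homog_rho :: "'c \<Rightarrow> bool" where
  "homog_rho b \<longleftrightarrow> b \<in> carrier B \<and> (\<forall>i. \<rho> b i \<in> W (int i - 1))"

lemma homog_rho_series: "homog_rho b \<Longrightarrow> subst1 R (\<rho> b) (indet R v) \<in> homog 1"
  using formal_module_closed(3)[OF fm]
  by (intro homog_subst1 homog_indet) (simp_all add: homog_rho_def)

lemma rho_hom: "\<rho> \<in> ring_hom B (fgl_End R F)"
  using fm by (simp add: formal_module_def)

lemma rho_mult:
  assumes "b \<in> carrier B" "c \<in> carrier B"
  shows "\<rho> (b \<otimes>\<^bsub>B\<^esub> c) i = subst1 R (\<rho> b) (subst1 R (\<rho> c) (indet R Xvar)) (replicate_mset i Xvar)"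
  using ring_hom_mult[OF rho_hom assms] by (simp add: fgl_End_def Let_def X_coeffs_def)

lemma rho_add:
  assumes "b \<in> carrier B" "c \<in> carrier B"
  shows "\<rho> (b \<oplus>\<^bsub>B\<^esub> c) i = subst2 R F (subst1 R (\<rho> b) (indet R Xvar))
    (subst1 R (\<rho> c) (indet R Xvar)) (replicate_mset i Xvar)"
  using ring_hom_add[OF rho_hom assms] by (simp add: fgl_End_def Let_def X_coeffs_def)

lemma rho_one: "\<rho> \<one>\<^bsub>B\<^esub> i = indet R Xvar (replicate_mset i Xvar)"
  using ring_hom_one[OF rho_hom] by (simp add: fgl_End_def Let_def X_coeffs_def)

lemma homog_rho_one: "homog_rho \<one>\<^bsub>B\<^esub>"
  using homogD[OF homog_indet[of Xvar], of "replicate_mset i Xvar" for i]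
  by (simp add: homog_rho_def rho_one)

lemma homog_rho_mult: "homog_rho b \<Longrightarrow> homog_rho c \<Longrightarrow> homog_rho (b \<otimes>\<^bsub>B\<^esub> c)"
  using homogD[OF homog_subst1[of "\<rho> b", OF _ _ homog_rho_series[of c Xvar]], of "replicate_mset i Xvar" for i]
    formal_module_closed(3)[OF fm]
  by (simp add: homog_rho_def rho_mult)

lemma homog_rho_add: "homog_rho b \<Longrightarrow> homog_rho c \<Longrightarrow> homog_rho (b \<oplus>\<^bsub>B\<^esub> c)"
  using homogD[OF homog_subst2[of F, OF W_F F00 homog_rho_series[of b Xvar] homog_rho_series[of c Xvar]],
      of "replicate_mset i Xvar" for i]
  by (simp add: homog_rho_def rho_add)

text \<open>The coefficients of \<open>\<rho>\<^sub>c\<close> are determined recursively by \<open>\<rho>\<^sub>c(\<rho>\<^sub>b(X)) = X\<close>, where the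
  coefficient of \<open>X^i\<close> involves \<open>\<rho>\<^sub>c\<^sub>,\<^sub>i\<close> with the unit \<open>b^i\<close> as its factor.\<close>

lemma homog_rho_inverse:
  assumes b: "homog_rho b" and c: "c \<in> carrier B" and cb: "c \<otimes>\<^bsub>B\<^esub> b = \<one>\<^bsub>B\<^esub>"
  shows "homog_rho c"
proof -
  have bc: "b \<in> carrier B" using b by (simp add: homog_rho_def)
  define g where "g = subst1 R (\<rho> b) (indet R Xvar)"
  have g: "g \<in> homog 1" unfolding g_def by (rule homog_rho_series[OF b])
  note cl = formal_module_closed[OF fm]
  \<comment> \<open>The normalisation of \<open>\<rho>\<close> makes the linear coefficient of
    \<open>g\<close> the image of \<open>b\<close>, hence a unit with inverse
    \<open>\<phi> c\<close>.\<close>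
  have gX: "g {#Xvar#} = \<phi> b"
    unfolding g_def using subst1_indet_single[of "\<rho> b" Xvar] cl(2)[OF bc] fm bc
    by (simp add: formal_module_def)
  have phi: "\<phi> c \<otimes> \<phi> b = \<one>"
    using fm ring_hom_mult[of \<phi> B R c b] ring_hom_one[of \<phi> B R] bc c cb by (simp add: formal_module_def)
  define p where "p j i = (g [^]\<^bsub>mps R\<^esub> j) (replicate_mset i Xvar)" for i j :: nat
  have p: "p j i \<in> W (int i - int j)" for i j
    using homogD[OF homog_pow[OF g], of j "replicate_mset i Xvar"] by (simp add: p_def)
  have "\<rho> c i \<in> W (int i - 1)" for i
  proof (induction i rule: less_induct)
    case (less i)
    define r where "r = (\<Oplus>j\<in>{..<i}. \<rho> c j \<otimes> p j i)"
    have r: "r \<in> W (int i - 1)"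
      unfolding r_def using less.IH by (intro W_finsum W_mult_eq[OF _ p]) auto
    have d: "indet R Xvar (replicate_mset i Xvar) \<in> W (int i - 1)"
      using homogD[OF homog_indet[of Xvar], of "replicate_mset i Xvar"] by simp
    have "indet R Xvar (replicate_mset i Xvar) = \<rho> (c \<otimes>\<^bsub>B\<^esub> b) i" by (simp add: cb rho_one)
    also have "\<dots> = (\<Oplus>j\<in>{..i}. \<rho> c j \<otimes> p j i)"
      by (simp add: rho_mult[OF c bc] subst1_def[of R "\<rho> c"] g_def p_def)
    also have "{..i} = insert i {..<i}" by auto
    also have "(\<Oplus>j\<in>insert i {..<i}. \<rho> c j \<otimes> p j i) = \<rho> c i \<otimes> p i i \<oplus> r"
      unfolding r_def using cl(2)[OF c] W_closed[OF p] by (intro finsum_insert) auto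
    also have "p i i = \<phi> b [^] i" unfolding p_def gX[symmetric] by (rule homog_pow_lead[OF g])
    finally have eq: "indet R Xvar (replicate_mset i Xvar) = \<rho> c i \<otimes> \<phi> b [^] i \<oplus> r" .
    have rc: "r \<in> carrier R" "\<rho> c i \<in> carrier R" "\<phi> b \<in> carrier R" "\<phi> c \<in> carrier R"
      using W_closed[OF r] cl(2)[OF c] cl(4) bc c by auto
    have "indet R Xvar (replicate_mset i Xvar) \<oplus> \<ominus> r = \<rho> c i \<otimes> \<phi> b [^] i"
      unfolding eq using rc by (simp add: a_assoc r_neg)
    then have "\<rho> c i \<otimes> \<phi> b [^] i \<in> W (int i - 1)" using W_add[OF d W_neg[OF r]] by simp
    \<comment> \<open>Multiplying by this inverse of \<open>\<phi> b [^] i\<close> isolates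
      \<open>\<rho> c i\<close> without changing the degree, as scalars have degree zero.\<close>
    moreover have "\<phi> c [^] i \<in> W 0"
      by (induction i) (use W_one W_mult_eq[OF _ W_unit[OF c], of _ 0 0] in simp_all)
    ultimately have "\<rho> c i \<otimes> \<phi> b [^] i \<otimes> \<phi> c [^] i \<in> W (int i - 1)" by (rule W_mult_eq) simp
    moreover have "\<phi> b [^] i \<otimes> \<phi> c [^] i = (\<phi> c \<otimes> \<phi> b) [^] i"
      using rc by (subst m_comm) (simp_all only: nat_pow_closed nat_pow_distrib)
    then have "\<rho> c i \<otimes> \<phi> b [^] i \<otimes> \<phi> c [^] i = \<rho> c i"
      using rc by (simp add: m_assoc phi)
    ultimately show ?case by simp
  qed
  then show ?thesis using c by (simp add: homog_rho_def)
qed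

end

section \<open>The summands of the classifying ring\<close>

definition homog_poly :: "('b, 'x) ring_scheme \<Rightarrow> 'b gen set \<Rightarrow> int \<Rightarrow> ('b gen multiset \<Rightarrow> 'b) set" where
  "homog_poly B V d = {p \<in> carrier (mpoly B V). \<forall>m. p m \<noteq> \<zero>\<^bsub>B\<^esub> \<longrightarrow> mono_degree m = d}"

text \<open>The degree \<open>d\<close> part of the \<open>B\<close>-subalgebra generated by the
  classes of \<open>V\<close>. The aim is to reach the case \<open>V = gens B\<close>, which is the
  summand itself, from a much smaller \<open>V\<close>.\<close>

definition L_part where
  "L_part B V d = L_class B ` homog_poly B V d"

lemma carrier_L_summand: "carrier (L_summand B d) = L_part B (gens B) d"
  by (auto simp: L_summand_def L_part_def homog_poly_def)

lemma mono_degree_union: "mono_degree (m + n) = mono_degree m + mono_degree n"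
  by (simp add: mono_degree_def)

text \<open>Compare the coefficients of 1 and X in F(X,0) = X and F(0,X) = X. This removes the
  generators \<open>Alpha i j\<close> of degree at most zero, which would allow infinitely many
  monomials in one degree.\<close>

lemma (in cring) fgl_linear_coeffs:
  assumes "formal_group_law R F"
  shows "F 0 0 = \<zero>" "F 1 0 = \<one>" "F 0 1 = \<one>"
proof -
  interpret M: cring "mps R :: (xyz multiset \<Rightarrow> 'a) ring" by (rule mps_cring)
  let ?M = "mps R :: (xyz multiset \<Rightarrow> 'a) ring"
  let ?X = "indet R Xvar"
  have F: "F i j \<in> carrier R" for i j using assms by (simp add: formal_group_law_def Let_def)
  have 1: "subst2 R F ?X \<zero>\<^bsub>?M\<^esub> = ?X" and 2: "subst2 R F \<zero>\<^bsub>?M\<^esub> ?X = ?X"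
    using assms by (simp_all add: formal_group_law_def Let_def)
  have X: "?X \<in> carrier ?M" by (rule indet_closed)
  have set: "{..size {#Xvar#}} = {0, Suc 0}" by auto
  have vals: "\<one>\<^bsub>?M\<^esub> {#} = \<one>" "\<one>\<^bsub>?M\<^esub> {#Xvar#} = \<zero>" "\<zero>\<^bsub>?M\<^esub> m = \<zero>" "?X {#} = \<zero>" "?X {#Xvar#} = \<one>" for m
    by (simp_all add: mps_def indet_def)
  have "subst2 R F ?X \<zero>\<^bsub>?M\<^esub> {#} = F 0 0"
    unfolding subst2_def using F vals by simp
  then show F0: "F 0 0 = \<zero>" unfolding 1 vals by simp
  have "subst2 R F ?X \<zero>\<^bsub>?M\<^esub> {#Xvar#} = F 1 0"
    unfolding subst2_def set using F X vals F0 by simp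
  then show "F 1 0 = \<one>" unfolding 1 vals by simp
  have "subst2 R F \<zero>\<^bsub>?M\<^esub> ?X {#Xvar#} = F 0 1"
    unfolding subst2_def set using F X vals F0 by simp
  then show "F 0 1 = \<one>" unfolding 2 vals by simp
qed

section \<open>Graded parts of subalgebras of the classifying ring\<close>

context cring
begin

lemma homog_poly_mult:
  assumes p: "p \<in> homog_poly R V d" and q: "q \<in> homog_poly R V e"
  shows "p \<otimes>\<^bsub>mps R\<^esub> q \<in> homog_poly R V (d + e)"
proof -
  have "mono_degree m = d + e" if nz: "(p \<otimes>\<^bsub>mps R\<^esub> q) m \<noteq> \<zero>" for m
  proof (rule ccontr)
    assume neq: "mono_degree m \<noteq> d + e"
    have "(\<Oplus>a\<in>{a. a \<subseteq># m}. p a \<otimes> q (m - a)) = \<zero>"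
    proof (rule add.finprod_one_eqI)
      fix a assume "a \<in> {a. a \<subseteq># m}"
      then have "mono_degree a + mono_degree (m - a) = mono_degree m"
        by (simp add: mono_degree_union[symmetric])
      then have "p a = \<zero> \<or> q (m - a) = \<zero>" using neq p q by (auto simp: homog_poly_def)
      moreover have "p a \<in> carrier R" "q (m - a) \<in> carrier R"
        using p q by (simp_all add: homog_poly_def mpoly_mem)
      ultimately show "p a \<otimes> q (m - a) = \<zero>" by auto
    qed
    then show False using nz by (simp add: mps_def)
  qed
  then show ?thesis using p q mpoly_mult_closed by (auto simp: homog_poly_def)
qed

lemma monom_homog_poly:
  assumes "set_mset m \<subseteq> V" "c \<in> carrier R"
  shows "monom_fun R m c \<in> homog_poly R V (mono_degree m)"
  using monom_closed[OF assms] by (simp add: homog_poly_def) (simp add: monom_fun_def)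

lemma L_class_ring_hom: "ring_hom_cring (gen_poly R) (L_ring R) (L_class R)"
  using L_class_hom[OF is_cring] L_ring_cring[OF is_cring] gen_poly_cring[OF is_cring]
  by (simp add: ring_hom_cring_def ring_hom_cring_axioms_def)

lemma homog_poly_closed: "V \<subseteq> gens R \<Longrightarrow> p \<in> homog_poly R V d \<Longrightarrow> p \<in> carrier (gen_poly R)"
  by (auto simp: homog_poly_def mpoly_mem)

lemma L_part_monom:
  "set_mset m \<subseteq> V \<Longrightarrow> c \<in> carrier R \<Longrightarrow> L_class R (monom_fun R m c) \<in> L_part R V (mono_degree m)"
  unfolding L_part_def by (intro imageI monom_homog_poly)

lemma L_part_unit: "c \<in> carrier R \<Longrightarrow> L_unit R c \<in> L_part R V 0"
  using L_part_monom[of "{#}" V c] by (simp add: L_unit_def mconst_monom mono_degree_def)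

lemma L_part_indet: "v \<in> V \<Longrightarrow> L_class R (indet R v) \<in> L_part R V (gen_degree v)"
  using L_part_monom[of "{#v#}" V \<one>] by (simp add: indet_monom mono_degree_def)

lemma L_unit_one: "L_unit R \<one> = \<one>\<^bsub>L_ring R\<^esub>"
proof -
  interpret l: ring_hom_cring "gen_poly R" "L_ring R" "L_class R" by (rule L_class_ring_hom)
  show ?thesis
    unfolding L_unit_def using ring_hom_one[OF mconst_hom[of "gens R"]] l.hom_one by (simp del: mpoly_ops)
qed

lemma L_part_graded:
  assumes V: "V \<subseteq> gens R"
  shows "graded_cring (L_ring R) (L_part R V)"
proof -
  interpret l: ring_hom_cring "gen_poly R" "L_ring R" "L_class R" by (rule L_class_ring_hom)
  note cl = homog_poly_closed[OF V]
  show ?thesis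
  proof unfold_locales
    show "L_part R V d \<subseteq> carrier (L_ring R)" for d
      unfolding L_part_def using cl by auto
    have "\<zero>\<^bsub>gen_poly R\<^esub> \<in> homog_poly R V d" for d
      by (auto simp: homog_poly_def mps_def mpoly_mem)
    then show "\<zero>\<^bsub>L_ring R\<^esub> \<in> L_part R V d" for d
      unfolding L_part_def using l.hom_zero by (metis imageI)
    show "\<one>\<^bsub>L_ring R\<^esub> \<in> L_part R V 0"
      using L_part_unit[of \<one> V] by (simp add: L_unit_one)
    fix x y d e
    assume x: "x \<in> L_part R V d"
    then obtain p where p: "p \<in> homog_poly R V d" "x = L_class R p" unfolding L_part_def by blast
    show "\<ominus>\<^bsub>L_ring R\<^esub> x \<in> L_part R V d"
    proof -
      have hom: "mconst R \<in> ring_hom R (gen_poly R)" by (rule mconst_hom)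
      interpret c: ring_hom_cring R "gen_poly R" "mconst R"
        using is_cring l.R.is_cring hom by (simp add: ring_hom_cring_def ring_hom_cring_axioms_def)
      \<comment> \<open>Negation as multiplication by the constant polynomial -1, which has degree
        zero.\<close>
      have "monom_fun R {#} (\<ominus> \<one>) \<otimes>\<^bsub>mps R\<^esub> p \<in> homog_poly R V (0 + d)"
        using monom_homog_poly[of "{#}" V "\<ominus> \<one>"] p(1) by (intro homog_poly_mult) (simp_all add: mono_degree_def)
      moreover have "monom_fun R {#} (\<ominus> \<one>) \<otimes>\<^bsub>gen_poly R\<^esub> p = \<ominus>\<^bsub>gen_poly R\<^esub> p"
        unfolding mconst_monom[symmetric] using cl[OF p(1)] c.hom_one
        by (simp del: mpoly_ops add: l.R.l_minus)
      ultimately have "\<ominus>\<^bsub>gen_poly R\<^esub> p \<in> homog_poly R V d" by simp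
      then show ?thesis unfolding L_part_def p(2) using l.hom_a_inv[OF cl[OF p(1)]] by (metis imageI)
    qed
    show "x \<otimes>\<^bsub>L_ring R\<^esub> y \<in> L_part R V (d + e)" if y: "y \<in> L_part R V e"
    proof -
      obtain q where q: "q \<in> homog_poly R V e" "y = L_class R q" using y unfolding L_part_def by blast
      have "x \<otimes>\<^bsub>L_ring R\<^esub> y = L_class R (p \<otimes>\<^bsub>gen_poly R\<^esub> q)"
        unfolding p(2) q(2) by (rule l.hom_mult[symmetric]) (rule cl[OF p(1)], rule cl[OF q(1)])
      then show ?thesis unfolding L_part_def using homog_poly_mult[OF p(1) q(1)] by simp
    qed
    show "x \<oplus>\<^bsub>L_ring R\<^esub> y \<in> L_part R V d" if y: "y \<in> L_part R V d"
    proof -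
      obtain q where q: "q \<in> homog_poly R V d" "y = L_class R q" using y unfolding L_part_def by blast
      interpret V: cring "mpoly R V" by (rule mpoly_cring)
      have "p \<oplus>\<^bsub>mpoly R V\<^esub> q \<in> carrier (mpoly R V)"
        using p(1) q(1) by (intro V.a_closed) (simp_all add: homog_poly_def)
      moreover have "mono_degree m = d" if "(p \<oplus>\<^bsub>mps R\<^esub> q) m \<noteq> \<zero>" for m
      proof -
        have "p m \<noteq> \<zero> \<or> q m \<noteq> \<zero>" using that by (auto simp: mps_def)
        then show ?thesis using p(1) q(1) by (auto simp: homog_poly_def)
      qed
      ultimately have "p \<oplus>\<^bsub>mps R\<^esub> q \<in> homog_poly R V d" by (simp add: homog_poly_def)
      moreover have "x \<oplus>\<^bsub>L_ring R\<^esub> y = L_class R (p \<oplus>\<^bsub>gen_poly R\<^esub> q)"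
        unfolding p(2) q(2) by (rule l.hom_add[symmetric]) (rule cl[OF p(1)], rule cl[OF q(1)])
      ultimately show ?thesis unfolding L_part_def by simp
    qed
  qed
qed

lemma L_class_expand:
  assumes p: "p \<in> carrier (gen_poly R)"
  shows "L_class R p = (\<Oplus>\<^bsub>L_ring R\<^esub>m\<in>{m. p m \<noteq> \<zero>}. L_unit R (p m) \<otimes>\<^bsub>L_ring R\<^esub> L_class R (monom_fun R m \<one>))"
proof -
  interpret l: ring_hom_cring "gen_poly R" "L_ring R" "L_class R" by (rule L_class_ring_hom)
  let ?S = "{m. p m \<noteq> \<zero>}"
  have V: "set_mset m \<subseteq> gens R" if "m \<in> ?S" for m using p that by (auto simp: mpoly_mem)
  have c: "p m \<in> carrier R" for m using p by (simp add: mpoly_mem)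
  have cl: "mconst R (p m) \<in> carrier (gen_poly R)" "m \<in> ?S \<Longrightarrow> monom_fun R m \<one> \<in> carrier (gen_poly R)" for m
    using gen_poly_closed(1)[OF is_cring c] monom_closed[OF V] by blast+
  let ?t = "\<lambda>m. mconst R (p m) \<otimes>\<^bsub>gen_poly R\<^esub> monom_fun R m \<one>"
  have t: "?t \<in> ?S \<rightarrow> carrier (gen_poly R)" using cl by (intro Pi_I l.R.m_closed)
  have "p = (\<Oplus>\<^bsub>gen_poly R\<^esub>m\<in>?S. mconst R (p m) \<otimes>\<^bsub>gen_poly R\<^esub> mono_eval (gen_poly R) (indet R) m)"
    by (rule mpoly_expand[OF p])
  also have "\<dots> = (\<Oplus>\<^bsub>gen_poly R\<^esub>m\<in>?S. ?t m)"
    using t V by (intro l.R.add.finprod_cong') (simp_all add: mono_eval_indet del: mpoly_ops)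
  finally have "L_class R p = L_class R (\<Oplus>\<^bsub>gen_poly R\<^esub>m\<in>?S. ?t m)" by simp
  also have "\<dots> = (\<Oplus>\<^bsub>L_ring R\<^esub>m\<in>?S. (L_class R \<circ> ?t) m)" by (rule l.hom_finsum[OF t])
  also have "\<dots> = (\<Oplus>\<^bsub>L_ring R\<^esub>m\<in>?S. L_unit R (p m) \<otimes>\<^bsub>L_ring R\<^esub> L_class R (monom_fun R m \<one>))"
    using cl by (intro l.S.add.finprod_cong') (auto simp: L_unit_def simp del: mpoly_ops)
  finally show ?thesis .
qed

text \<open>Products of homogeneous elements are homogeneous, so expressing each generator through
  \<open>V\<close> in its own degree expresses every monomial, and then every homogeneous
  polynomial, through \<open>V\<close> without leaving its degree.\<close>

lemma L_part_gens_subset: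
  assumes V: "V \<subseteq> gens R"
    and gen: "\<And>v. v \<in> gens R \<Longrightarrow> L_class R (indet R v) \<in> L_part R V (gen_degree v)"
  shows "L_part R (gens R) d \<subseteq> L_part R V d"
proof
  interpret l: ring_hom_cring "gen_poly R" "L_ring R" "L_class R" by (rule L_class_ring_hom)
  interpret W: graded_cring "L_ring R" "L_part R V" by (rule L_part_graded[OF V])
  have mon: "L_class R (monom_fun R m \<one>) \<in> L_part R V (mono_degree m)" if "set_mset m \<subseteq> gens R" for m
    using that
  proof (induction m)
    case empty
    have "\<one>\<^bsub>L_ring R\<^esub> \<in> L_part R V 0" by (rule W.W_one)
    then show ?case using L_unit_one by (simp add: L_unit_def mconst_monom mono_degree_def)
  next
    case (add v m)
    have "L_class R (monom_fun R (add_mset v m) \<one>) = L_class R (indet R v \<otimes>\<^bsub>gen_poly R\<^esub> monom_fun R m \<one>)"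
      by (simp add: indet_monom monom_mult)
    also have "\<dots> = L_class R (indet R v) \<otimes>\<^bsub>L_ring R\<^esub> L_class R (monom_fun R m \<one>)"
      using add.prems monom_closed[of _ "gens R" \<one>] by (intro l.hom_mult) (simp_all add: indet_monom)
    finally show ?case
      using gen[of v] add W.W_mult[of "L_class R (indet R v)"] by (simp add: mono_degree_def)
  qed
  fix x assume "x \<in> L_part R (gens R) d"
  then obtain p where p: "p \<in> homog_poly R (gens R) d" "x = L_class R p" unfolding L_part_def by blast
  have pc: "p \<in> carrier (gen_poly R)" using p(1) by (simp add: homog_poly_def)
  show "x \<in> L_part R V d"
    unfolding p(2) L_class_expand[OF pc]
  proof (rule W.W_finsum)
    fix m assume m: "m \<in> {m. p m \<noteq> \<zero>}"
    have "set_mset m \<subseteq> gens R" "p m \<in> carrier R" "mono_degree m = d"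
      using p(1) m by (auto simp: homog_poly_def mpoly_mem)
    then show "L_unit R (p m) \<otimes>\<^bsub>L_ring R\<^esub> L_class R (monom_fun R m \<one>) \<in> L_part R V d"
      using mon[of m] by (intro W.W_mult_eq[OF L_part_unit]) auto
  qed
qed

section \<open>The summands as modules\<close>

lemma L_unit_hom: "L_unit R \<in> ring_hom R (L_ring R)"
  using universal_formal_module[OF is_cring] by (simp add: formal_module_def)

lemma L_summand_module: "module R (L_summand R d)"
proof -
  interpret L: cring "L_ring R" by (rule L_ring_cring[OF is_cring])
  interpret W: graded_cring "L_ring R" "L_part R (gens R)" by (rule L_part_graded) simp
  interpret u: ring_hom_cring R "L_ring R" "L_unit R"
    using is_cring L.is_cring L_unit_hom by (simp add: ring_hom_cring_def ring_hom_cring_axioms_def)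
  note [simp] = W.W_closed
  have ops: "add (L_summand R d) = add (L_ring R)" "zero (L_summand R d) = zero (L_ring R)"
    "a \<odot>\<^bsub>L_summand R d\<^esub> x = L_unit R a \<otimes>\<^bsub>L_ring R\<^esub> x" for a x
    by (simp_all add: L_summand_def)
  show ?thesis
  proof (rule moduleI)
    show "abelian_group (L_summand R d)"
    proof (rule abelian_groupI; unfold ops carrier_L_summand)
      fix x assume x: "x \<in> L_part R (gens R) d"
      show "\<exists>y\<in>L_part R (gens R) d. y \<oplus>\<^bsub>L_ring R\<^esub> x = \<zero>\<^bsub>L_ring R\<^esub>"
        using x by (intro bexI[OF _ W.W_neg[OF x]]) (simp add: L.l_neg)
    qed (auto simp: W.W_add W.W_zero L.a_ac)
  qed (use is_cring in \<open>auto simp: ops carrier_L_summand L.l_distr L.r_distr L.m_assoc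
      intro: W.W_mult_eq[OF L_part_unit]\<close>)
qed

text \<open>The classes of the finitely many monomials in \<open>V\<close> of degree
  \<open>d\<close> span the summand over the scalars.\<close>

theorem L_summand_finitely_generated:
  assumes V: "V \<subseteq> gens R" and fin: "finite {m. set_mset m \<subseteq> V \<and> mono_degree m = d}"
    and gen: "\<And>v. v \<in> gens R \<Longrightarrow> L_class R (indet R v) \<in> L_part R V (gen_degree v)"
  shows "finitely_generated_module R (L_summand R d)"
proof -
  define M where "M = L_summand R d"
  interpret M: module R M unfolding M_def by (rule L_summand_module)
  interpret L: cring "L_ring R" by (rule L_ring_cring[OF is_cring])
  interpret W: graded_cring "L_ring R" "L_part R V" by (rule L_part_graded[OF V])
  have ops: "add M = add (L_ring R)" "zero M = zero (L_ring R)"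
    "a \<odot>\<^bsub>M\<^esub> x = L_unit R a \<otimes>\<^bsub>L_ring R\<^esub> x" for a x
    by (simp_all add: M_def L_summand_def)
  define T where "T = {m. set_mset m \<subseteq> V \<and> mono_degree m = d}"
  define S where "S = (\<lambda>m. L_class R (monom_fun R m \<one>)) ` T"
  have finS: "finite S" using fin by (simp add: S_def T_def)
  have car: "carrier M = L_part R (gens R) d" by (simp add: M_def carrier_L_summand)
  have SM: "S \<subseteq> carrier M"
    unfolding S_def car using V by (auto simp: T_def intro!: L_part_monom)
  \<comment> \<open>Distinct monomials may have the same class, so the coefficients of a polynomial
    are not directly a family indexed by \<open>S\<close>. Closure of \<open>Sp\<close> under sums
    lets the terms be added one monomial at a time.\<close>
  define Sp where "Sp = {\<Oplus>\<^bsub>M\<^esub>s\<in>S. c s \<odot>\<^bsub>M\<^esub> s |c. c \<in> S \<rightarrow> carrier R}"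
  have Sp_add: "x \<oplus>\<^bsub>M\<^esub> y \<in> Sp" if x: "x \<in> Sp" and y: "y \<in> Sp" for x y
  proof -
    obtain c where c: "c \<in> S \<rightarrow> carrier R" "x = (\<Oplus>\<^bsub>M\<^esub>s\<in>S. c s \<odot>\<^bsub>M\<^esub> s)" using x by (auto simp: Sp_def)
    obtain e where e: "e \<in> S \<rightarrow> carrier R" "y = (\<Oplus>\<^bsub>M\<^esub>s\<in>S. e s \<odot>\<^bsub>M\<^esub> s)" using y by (auto simp: Sp_def)
    have "x \<oplus>\<^bsub>M\<^esub> y = (\<Oplus>\<^bsub>M\<^esub>s\<in>S. c s \<odot>\<^bsub>M\<^esub> s \<oplus>\<^bsub>M\<^esub> e s \<odot>\<^bsub>M\<^esub> s)"
      unfolding c(2) e(2) using c(1) e(1) SM by (intro M.M.finsum_addf[symmetric]) auto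
    also have "\<dots> = (\<Oplus>\<^bsub>M\<^esub>s\<in>S. (c s \<oplus> e s) \<odot>\<^bsub>M\<^esub> s)"
      using c(1) e(1) SM by (intro M.M.add.finprod_cong') (auto simp: M.smult_l_distr Pi_iff subset_iff)
    finally show ?thesis unfolding Sp_def using c(1) e(1)
      by (intro CollectI exI[of _ "\<lambda>s. c s \<oplus> e s"]) auto
  qed
  have Sp_single: "b \<odot>\<^bsub>M\<^esub> s \<in> Sp" if b: "b \<in> carrier R" and s: "s \<in> S" for b s
  proof -
    have "b \<odot>\<^bsub>M\<^esub> s = (\<Oplus>\<^bsub>M\<^esub>s'\<in>S. if s = s' then b \<odot>\<^bsub>M\<^esub> s' else \<zero>\<^bsub>M\<^esub>)"
      using b s finS SM by (intro M.M.add.finprod_singleton[symmetric]) auto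
    also have "\<dots> = (\<Oplus>\<^bsub>M\<^esub>s'\<in>S. (if s = s' then b else \<zero>) \<odot>\<^bsub>M\<^esub> s')"
      using b SM by (intro M.M.add.finprod_cong') (auto simp: subset_iff)
    finally show ?thesis unfolding Sp_def using b
      by (intro CollectI exI[of _ "\<lambda>s'. if s = s' then b else \<zero>"]) auto
  qed
  have Sp_zero: "\<zero>\<^bsub>M\<^esub> \<in> Sp"
  proof -
    have "(\<Oplus>\<^bsub>M\<^esub>s\<in>S. \<zero> \<odot>\<^bsub>M\<^esub> s) = \<zero>\<^bsub>M\<^esub>" using SM by (intro M.M.add.finprod_one_eqI) auto
    then show ?thesis unfolding Sp_def by (intro CollectI exI[of _ "\<lambda>s. \<zero>"]) auto
  qed
  have "x \<in> Sp" if "x \<in> carrier M" for x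
  proof -
    have "x \<in> L_part R V d" using that L_part_gens_subset[OF V gen, of d] car by auto
    then obtain p where p: "p \<in> homog_poly R V d" "x = L_class R p" unfolding L_part_def by blast
    have pT: "{m. p m \<noteq> \<zero>} \<subseteq> T" and pf: "finite {m. p m \<noteq> \<zero>}" and pc: "p m \<in> carrier R" for m
      using p(1) by (auto simp: homog_poly_def T_def mpoly_mem)
    have "(\<Oplus>\<^bsub>L_ring R\<^esub>m\<in>K. L_unit R (p m) \<otimes>\<^bsub>L_ring R\<^esub> L_class R (monom_fun R m \<one>)) \<in> Sp"
      if "finite K" "K \<subseteq> T" for K
      using that
    proof (induction K rule: finite_induct)
      case empty
      then show ?case using Sp_zero by (simp add: ops)
    next
      case (insert m K)
      have cl: "L_unit R (p m) \<otimes>\<^bsub>L_ring R\<^esub> L_class R (monom_fun R m \<one>) \<in> carrier (L_ring R)" if "m \<in> T" for m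
        using that pc W.W_closed[OF W.W_mult[OF L_part_unit L_part_monom]] by (auto simp: T_def)
      have "p m \<odot>\<^bsub>M\<^esub> L_class R (monom_fun R m \<one>) \<in> Sp"
        using insert.prems pc by (intro Sp_single) (auto simp: S_def)
      moreover have "(\<Oplus>\<^bsub>L_ring R\<^esub>m\<in>insert m K. L_unit R (p m) \<otimes>\<^bsub>L_ring R\<^esub> L_class R (monom_fun R m \<one>))
        = L_unit R (p m) \<otimes>\<^bsub>L_ring R\<^esub> L_class R (monom_fun R m \<one>) \<oplus>\<^bsub>L_ring R\<^esub>
          (\<Oplus>\<^bsub>L_ring R\<^esub>m\<in>K. L_unit R (p m) \<otimes>\<^bsub>L_ring R\<^esub> L_class R (monom_fun R m \<one>))"
        using insert.hyps insert.prems cl by (intro L.finsum_insert) auto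
      ultimately show ?case using Sp_add[of "p m \<odot>\<^bsub>M\<^esub> L_class R (monom_fun R m \<one>)"] insert
        by (simp add: ops)
    qed
    from this[OF pf pT] show ?thesis
      unfolding p(2) L_class_expand[OF homog_poly_closed[OF V p(1)]] .
  qed
  moreover have "Sp \<subseteq> carrier M"
    unfolding Sp_def using SM by (auto intro!: M.M.finsum_closed)
  ultimately have "carrier M = Sp" by blast
  then show ?thesis
    unfolding finitely_generated_module_def M_def[symmetric] Sp_def
    using M.module_axioms finS SM by blast
qed

end

section \<open>Finitely many monomials in each degree\<close>

text \<open>Generators of degree at least 2. Those left out with small indices have classes 0, 1 or
  a scalar; the series \<open>Rho b\<close> with \<open>b\<close> outside \<open>T\<close> are to be
  expressed through these.\<close>

definition basic_gens :: "'b set \<Rightarrow> 'b gen set" where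
  "basic_gens T = {Alpha i j |i j. 2 \<le> i + j} \<union> {Rho b i |b i. b \<in> T \<and> 2 \<le> i}"

lemma gen_degree_basic_gens: "v \<in> basic_gens T \<Longrightarrow> 2 \<le> gen_degree v"
  by (auto simp: basic_gens_def)

lemma mono_degree_basic_gens: "set_mset m \<subseteq> basic_gens T \<Longrightarrow> 2 * int (size m) \<le> mono_degree m"
proof (induction m)
  case (add v m)
  then show ?case using gen_degree_basic_gens[of v T] by (simp add: mono_degree_def)
qed (simp add: mono_degree_def)

lemma finite_basic_monomials:
  assumes "finite T"
  shows "finite {m. set_mset m \<subseteq> basic_gens T \<and> mono_degree m = d}"
proof -
  \<comment> \<open>A factor of a monomial of degree \<open>d\<close> has degree between 2 and
    \<open>d\<close>, so \<open>i + j\<close> is at most d/2 + 1, hence at most \<open>d\<close>,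
    for \<open>Alpha i j\<close>, and \<open>i\<close> is at most d/2 + 1 for
    \<open>Rho b i\<close>.\<close>
  define K where "K = (\<lambda>(i, j). Alpha i j) ` ({..nat d} \<times> {..nat d}) \<union> (\<lambda>(b, i). Rho b i) ` (T \<times> {..nat d + 1})"
  have "finite K" using assms by (simp add: K_def)
  then have "finite (\<Union>n\<in>{..nat d}. multisets_of_size K n)" by auto
  moreover have "{m. set_mset m \<subseteq> basic_gens T \<and> mono_degree m = d} \<subseteq> (\<Union>n\<in>{..nat d}. multisets_of_size K n)"
  proof
    fix m assume "m \<in> {m. set_mset m \<subseteq> basic_gens T \<and> mono_degree m = d}"
    then have m: "set_mset m \<subseteq> basic_gens T" "mono_degree m = d" by auto
    have "v \<in> K" if v: "v \<in># m" for v
    proof -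
      have "m = add_mset v (m - {#v#})" using v by simp
      then have "d = gen_degree v + mono_degree (m - {#v#})"
        unfolding m(2)[symmetric] by (metis mono_degree_def image_mset_add_mset sum_mset.add_mset)
      moreover have "0 \<le> mono_degree (m - {#v#})"
        using mono_degree_basic_gens[of "m - {#v#}" T] m(1) in_diffD[of _ m] by fastforce
      ultimately have "gen_degree v \<le> d" by simp
      moreover have "v \<in> basic_gens T" using v m(1) by blast
      ultimately show ?thesis unfolding basic_gens_def K_def
        by (fastforce simp: image_iff)
    qed
    moreover have "size m \<le> nat d" using mono_degree_basic_gens[OF m(1)] m(2) by linarith
    ultimately show "m \<in> (\<Union>n\<in>{..nat d}. multisets_of_size K n)" by (auto simp: multisets_of_size_def)
  qed
  ultimately show ?thesis by (rule rev_finite_subset)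
qed

text \<open>The last assumption is an induction principle: \<open>R\<close> arises from
  \<open>T\<close> by sums, products and inverses. It is applied to the set of all \<open>b\<close>
  with \<open>G.homog_rho b\<close>.\<close>

theorem (in cring) L_summand_finitely_generated_over:
  assumes T: "finite T" "T \<subseteq> carrier R"
    and gen: "\<And>G b. T \<subseteq> G \<Longrightarrow> \<one> \<in> G \<Longrightarrow> (\<And>a c. a \<in> G \<Longrightarrow> c \<in> G \<Longrightarrow> a \<oplus> c \<in> G) \<Longrightarrow>
      (\<And>a c. a \<in> G \<Longrightarrow> c \<in> G \<Longrightarrow> a \<otimes> c \<in> G) \<Longrightarrow>
      (\<And>a c. a \<in> G \<Longrightarrow> c \<in> carrier R \<Longrightarrow> c \<otimes> a = \<one> \<Longrightarrow> c \<in> G) \<Longrightarrow> b \<in> carrier R \<Longrightarrow> b \<in> G"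
  shows "finitely_generated_module R (L_summand R d)"
proof -
  let ?V = "basic_gens T"
  have V: "?V \<subseteq> gens R" using T(2) by (auto simp: basic_gens_def gens_def)
  interpret W: graded_cring "L_ring R" "L_part R ?V" by (rule L_part_graded[OF V])
  have fm: "formal_module R (L_ring R) (L_unit R) (L_alpha R) (L_rho R)"
    by (rule universal_formal_module[OF is_cring])
  then have "formal_group_law (L_ring R) (L_alpha R)" by (simp add: formal_module_def)
  note lin = W.fgl_linear_coeffs[OF this]
  have alpha: "L_alpha R i j \<in> L_part R ?V (2 * (int i + int j - 1))" for i j
  proof -
    consider "2 \<le> i + j" | "i = 0 \<and> j = 0" | "i = 1 \<and> j = 0" | "i = 0 \<and> j = 1" by linarith
    then show ?thesis
    proof cases
      case 1
      then have "Alpha i j \<in> ?V" by (auto simp: basic_gens_def)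
      from L_part_indet[OF this] show ?thesis by (simp add: L_alpha_def)
    qed (use lin W.W_zero W.W_one in \<open>auto simp: algebra_simps\<close>)
  qed
  \<comment> \<open>Degrees in the classifying ring are twice the weights that count powers of the
    variables, so the grading of the power series argument consists of the even degrees.\<close>
  interpret E: graded_cring "L_ring R" "\<lambda>d. L_part R ?V (2 * d)"
    by unfold_locales (use W.W_closed W.W_zero W.W_add W.W_neg W.W_one W.W_mult in \<open>auto simp: distrib_left\<close>)
  interpret G: graded_formal_module "L_ring R" "\<lambda>d. L_part R ?V (2 * d)" R "L_unit R" "L_alpha R" "L_rho R"
    using fm alpha lin(1) L_part_unit by unfold_locales auto
  have T_homog: "G.homog_rho t" if t: "t \<in> T" for t
  proof -
    have tc: "t \<in> carrier R" using t T(2) by blast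
    have "L_rho R t i \<in> L_part R ?V (2 * (int i - 1))" for i
    proof -
      consider "i = 0" | "i = 1" | "2 \<le> i" by linarith
      then show ?thesis
      proof cases
        case 1
        then show ?thesis using formal_module_closed(3)[OF fm tc] W.W_zero by simp
      next
        case 2
        then show ?thesis using fm tc L_part_unit[OF tc] by (simp add: formal_module_def)
      next
        case 3
        then have "Rho t i \<in> ?V" using t by (auto simp: basic_gens_def)
        from L_part_indet[OF this] 3 show ?thesis by (simp add: L_rho_def rho_poly_def)
      qed
    qed
    then show ?thesis using tc by (simp add: G.homog_rho_def)
  qed
  have all: "b \<in> {b. G.homog_rho b}" if "b \<in> carrier R" for b
  proof (rule gen)
    show "T \<subseteq> {b. G.homog_rho b}" using T_homog by blast
    show "c \<in> {b. G.homog_rho b}" if "a \<in> {b. G.homog_rho b}" "c \<in> carrier R" "c \<otimes> a = \<one>" for a c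
      using that G.homog_rho_inverse[of a c] by simp
  qed (simp_all add: that G.homog_rho_one G.homog_rho_add G.homog_rho_mult)
  show ?thesis
  proof (rule L_summand_finitely_generated[OF V finite_basic_monomials[OF T(1)]])
    fix v assume "v \<in> gens R"
    then consider i j where "v = Alpha i j" | b i where "v = Rho b i" "b \<in> carrier R" "i \<ge> 1"
      by (auto simp: gens_def)
    then show "L_class R (indet R v) \<in> L_part R ?V (gen_degree v)"
    proof cases
      case 1
      then show ?thesis using alpha by (simp add: L_alpha_def)
    next
      case 2
      then have "L_rho R b i \<in> L_part R ?V (2 * (int i - 1))"
        using all[of b] by (simp add: G.homog_rho_def)
      then show ?thesis using 2 by (simp add: L_rho_def rho_poly_def)
    qed
  qed
qed

section \<open>Application to the localization\<close>

theorem localized_L_summand_finitely_generated: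
  fixes A :: "('a, 'x) ring_scheme"
  assumes A: "cring A" "finitely_generated_ring A" and I: "maximalideal I A"
  shows "finitely_generated_module (localize_at A I) (L_summand (localize_at A I) d)"
proof -
  interpret A: cring A by fact
  obtain S where S: "finite S" "S \<subseteq> carrier A" "generate_ring A S = carrier A"
    using A(2) by (auto simp: finitely_generated_ring_def)
  define D where "D = carrier A - I"
  interpret D: mult_subset A D unfolding D_def by (rule maximal_ideal_complement[OF A(1) I])
  define B where "B = localize_at A I"
  have B: "B = localization A D" by (simp add: B_def localize_at_def D_def)
  interpret B: cring B unfolding B_def by (rule localize_at_cring[OF A(1) I])
  define \<phi> where "\<phi> = localize_map A I"
  have \<phi>: "\<phi> a = loc_frac A D a \<one>\<^bsub>A\<^esub>" for a by (simp add: \<phi>_def localize_map_def D_def)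
  interpret \<phi>: ring_hom_cring A B \<phi>
    using localize_map_hom[OF A(1) I] A(1) B.is_cring
    by (simp add: ring_hom_cring_def ring_hom_cring_axioms_def \<phi>_def B_def)
  \<comment> \<open>The element -1 is included because the closure properties of \<open>G\<close>
    cover sums, products and inverses, whereas generating \<open>A\<close> as a ring also uses
    negation.\<close>
  let ?T = "insert (\<ominus>\<^bsub>B\<^esub> \<one>\<^bsub>B\<^esub>) (\<phi> ` S)"
  show ?thesis unfolding B_def[symmetric]
  proof (rule B.L_summand_finitely_generated_over)
    show "finite ?T" using S(1) by simp
    show "?T \<subseteq> carrier B" using S(2) by auto
    fix G b
    assume T: "?T \<subseteq> G" and one: "\<one>\<^bsub>B\<^esub> \<in> G"
      and add: "\<And>a c. a \<in> G \<Longrightarrow> c \<in> G \<Longrightarrow> a \<oplus>\<^bsub>B\<^esub> c \<in> G"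
      and mult: "\<And>a c. a \<in> G \<Longrightarrow> c \<in> G \<Longrightarrow> a \<otimes>\<^bsub>B\<^esub> c \<in> G"
      and inv: "\<And>a c. a \<in> G \<Longrightarrow> c \<in> carrier B \<Longrightarrow> c \<otimes>\<^bsub>B\<^esub> a = \<one>\<^bsub>B\<^esub> \<Longrightarrow> c \<in> G"
      and b: "b \<in> carrier B"
    have gc: "h \<in> generate_ring A S \<Longrightarrow> h \<in> carrier A" for h using S(3) by simp
    have \<phi>G: "\<phi> a \<in> G" if "a \<in> carrier A" for a
    proof -
      have "a \<in> generate_ring A S" using that S(3) by simp
      then show ?thesis
      proof (induction rule: generate_ring.induct)
        case one
        then show ?case using \<open>\<one>\<^bsub>B\<^esub> \<in> G\<close> by simp
      next
        case (incl h)
        then show ?case using T by blast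
      next
        case (a_inv h)
        have "\<phi> (\<ominus>\<^bsub>A\<^esub> h) = (\<ominus>\<^bsub>B\<^esub> \<one>\<^bsub>B\<^esub>) \<otimes>\<^bsub>B\<^esub> \<phi> h" using gc[OF a_inv.hyps] by (simp add: B.l_minus)
        then show ?case using mult[OF _ a_inv.IH] T by simp
      next
        case (eng_add h k)
        then show ?case using add gc by simp
      next
        case (eng_mult h k)
        then show ?case using mult gc by simp
      qed
    qed
    obtain a s where u: "b = loc_frac A D a s" "a \<in> carrier A" "s \<in> D"
      using b unfolding B D.loc_carrier by blast
    \<comment> \<open>The fraction 1/s enters \<open>G\<close> as an inverse of the image of
      \<open>s\<close>; any fraction a/s is then a product of two members.\<close>
    define i where "i = loc_frac A D \<one>\<^bsub>A\<^esub> s"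
    have i: "i \<in> carrier B" unfolding B D.loc_carrier i_def using u(3) by blast
    have "i \<otimes>\<^bsub>B\<^esub> \<phi> s = \<one>\<^bsub>B\<^esub>"
      unfolding \<phi> B i_def using u(3) D.one_S by (simp add: D.loc_mult D.loc_one) (rule D.loc_frac_eqI, auto)
    from inv[OF \<phi>G i this] have iG: "i \<in> G" using u(3) by simp
    have "b = \<phi> a \<otimes>\<^bsub>B\<^esub> i"
      unfolding \<phi> B i_def u(1) using u(2,3) D.one_S by (simp add: D.loc_mult)
    then show "b \<in> G" using mult[OF \<phi>G[OF u(2)] iG] by simp
  qed
qed

theorem corollary2p7:
  fixes A :: "('a, 'x) ring_scheme" and I :: "'a set" and m :: int
  assumes "cring A"
    and "torsion_free_ring A"
    and "finitely_generated_ring A"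
    and "maximalideal I A"
  shows "finitely_generated_module (localize_at A I) (L_summand (localize_at A I) m)
    \<and> adically_separated A I
        (restrict_scalars (localize_map A I) (L_summand (localize_at A I) m))"
proof
  show "finitely_generated_module (localize_at A I) (L_summand (localize_at A I) m)"
    using assms by (intro localized_L_summand_finitely_generated)
  then show "adically_separated A I
      (restrict_scalars (localize_map A I) (L_summand (localize_at A I) m))"
    using assms by (intro localized_module_adically_separated)
qed

end
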